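(* Let $(\mathfrak g,\mathfrak h,(\rho,\mu),(\psi,\nu))$ be a matched pair of Lie-Yamaguti algebras. Let $\mathfrak L=(C^{\bullet+1}(\mathfrak g\oplus\mathfrak h,\mathfrak g\oplus\mathfrak h),[\,,]_{\mathsf{LY}})$, let $\mathfrak a=C^{\bullet+1}(\mathfrak h,\mathfrak g)\subset\mathfrak L$, let $p:\mathfrak L\to\mathfrak a$ be the projection onto $\mathfrak a$, and let $\Pi=(\Pi_{\mathrm I},\Pi_{\mathrm{II}})\in\mathfrak L_1=C^2(\mathfrak g\oplus\mathfrak h,\mathfrak g\oplus\mathfrak h)$ be the element given by the bicrossed product operations, $\Pi_{\mathrm I}=[\,,]_{\bowtie}$, $\Pi_{\mathrm{II}}=\langle\,,,\rangle_{\bowtie}$. (i) $(\mathfrak L,\mathfrak a,p,\Pi)$ is a $V$-data. (ii) $(\mathfrak a=C^{\bullet+1}(\mathfrak h,\mathfrak g),\{l_k\}_{k=1}^\infty)$ is an $L_\infty$-algebra, where for homogeneous $P,Q,R\in\mathfrak a$, $$l_1(P)=p[\Pi,P]_{\mathsf{LY}},\quad l_2(P,Q)=p[[\Pi,P]_{\mathsf{LY}},Q]_{\mathsf{LY}},\quad l_3(P,Q,R)=p[[[\Pi,P]_{\mathsf{LY}},Q]_{\mathsf{LY}},R]_{\mathsf{LY}},$$ and $l_k=0$ for $k\ge4$. (iii) A linear map $r:\mathfrak h\to\mathfrak g$ (i.e. $r\in\mathrm{Hom}(\mathfrak h,\mathfrak g)=C^1(\mathfrak h,\mathfrak g)=\mathfrak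 a_0$) is a deformation map in the given matched pair if and only if $r\in\mathfrak a_0$ is a Maurer-Cartan element of the $L_\infty$-algebra $(\mathfrak a,\{l_k\}_{k=1}^\infty)$.
   Context: All vector spaces and (multi)linear maps are over a field $\mathbf k$ of characteristic $0$. **Lie-Yamaguti algebra.** A vector space $\mathfrak g$ with linear maps $[\,,]:\wedge^2\mathfrak g\to\mathfrak g$ and $\langle\,,,\rangle:\wedge^2\mathfrak g\otimes\mathfrak g\to\mathfrak g$ such that for all $x,y,z,w,t\in\mathfrak g$: $[[x,y],z]+[[y,z],x]+[[z,x],y]+\langle x,y,z\rangle+\langle y,z,x\rangle+\langle z,x,y\rangle=0$; $\langle[x,y],z,w\rangle+\langle[y,z],x,w\rangle+\langle[z,x],y,w\rangle=0$; $\langle x,y,[z,w]\rangle=[\langle x,y,z\rangle,w]+[z,\langle x,y,w\rangle]$; $\langle x,y,\langle z,w,t\rangle\rangle=\langle\langle x,y,z\rangle,w,t\rangle+\langle z,\langle x,y,w\rangle,t\rangle+\langle z,w,\langle x,y,t\rangle\rangle$. **Representation.** A representation $(V;\rho,\mu)$ of $\mathfrak g$ is a vector space $V$ with linear maps $\rho:\mathfrak g\to\mathrm{End}(V)$, $x\mapsto\rho_x$, and $\mu:\mathfrak g\otimes\mathfrak g\to\mathrm{End}(V)$ such that, with $D_{\rho,\mu}(x,y):=\rho_x\rho_y-\rho_y\rho_x-\rho_{[x,y]}-\mu(x,y)+\mu(y,x)$, for all $x,y,z,w\in\mathfrak g$: $\mu([x,y],z)=\mu(x,z)\rho_y-\mu(y,z)\rho_x$;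 $\mu(x,[y,z])=\rho_y\mu(x,z)-\rho_z\mu(x,y)$; $\rho_{\langle x,y,z\rangle}=D_{\rho,\mu}(x,y)\rho_z-\rho_zD_{\rho,\mu}(x,y)$; $\mu(z,w)\mu(x,y)-\mu(y,w)\mu(x,z)-\mu(x,\langle y,z,w\rangle)+D_{\rho,\mu}(y,z)\mu(x,w)=0$; $\mu(\langle x,y,z\rangle,w)+\mu(z,\langle x,y,w\rangle)=D_{\rho,\mu}(x,y)\mu(z,w)-\mu(z,w)D_{\rho,\mu}(x,y)$. **Matched pair.** A matched pair of Lie-Yamaguti algebras $(\mathfrak g,\mathfrak h,(\rho,\mu),(\psi,\nu))$ consists of Lie-Yamaguti algebras $(\mathfrak g,[\,,],\langle\,,,\rangle)$, $(\mathfrak h,[\,,]',\langle\,,,\rangle')$ and linear maps $\rho:\mathfrak g\to\mathrm{End}(\mathfrak h)$, $\mu:\mathfrak g\otimes\mathfrak g\to\mathrm{End}(\mathfrak h)$, $\psi:\mathfrak h\to\mathrm{End}(\mathfrak g)$, $\nu:\mathfrak h\otimes\mathfrak h\to\mathrm{End}(\mathfrak g)$ such that $(\mathfrak h;\rho,\mu)$ is a representation of $\mathfrak g$, $(\mathfrak g;\psi,\nu)$ is a representation of $\mathfrak h$, and for all $x,y,z\in\mathfrak g$, $\alpha,\beta,\gamma\in\mathfrak h$: (1) $\rho_x([\alpha,\beta]')=[\rho_x\alpha,\beta]'+[\alpha,\rho_x\beta]'+\rho_{\psi_\beta x}\alpha-\rho_{\psi_\alpha x}\beta$; (2) $\rho_x(\langle\alpha,\beta,\gamma\rangle')=\langle\alpha,\beta,\rho_x\gamma\rangle'-\rho_{D_{\psi,\nu}(\alpha,\beta)x}\gamma$;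 (3) $\langle\rho_x\alpha,\beta,\gamma\rangle'+\langle\alpha,\rho_x\beta,\gamma\rangle'=0$; (4) $\rho_{\nu(\alpha,\beta)x}\gamma=\rho_{\nu(\alpha,\gamma)x}\beta$; (5) $\mu(x,y)([\alpha,\beta]')=\mu(\psi_\beta x,y)\alpha-\mu(\psi_\alpha x,y)\beta$; (6) $\mu(x,y)\langle\alpha,\beta,\gamma\rangle'=\langle\alpha,\beta,\mu(x,y)\gamma\rangle'-\mu(D_{\psi,\nu}(\alpha,\beta)x,y)\gamma-\mu(x,D_{\psi,\nu}(\alpha,\beta)y)\gamma$; (7) $\mu(x,\psi_\alpha y)\beta=[\alpha,\mu(x,y)\beta]'$; (8) $\mu(\nu(\alpha,\beta)x,y)\gamma-\mu(\nu(\alpha,\gamma)x,y)\beta=\mu(x,D_{\psi,\nu}(\beta,\gamma)y)\alpha-\langle\beta,\gamma,\mu(x,y)\alpha\rangle'$; (9) $\mu(x,\nu(\alpha,\beta)y)\gamma=\langle\mu(x,y)\gamma,\alpha,\beta\rangle'-D_{\rho,\mu}(y,\nu(\gamma,\alpha)x)\beta+\mu(y,\nu(\gamma,\beta)x)\alpha$; (10) $\psi_\alpha([x,y])=[\psi_\alpha x,y]+[x,\psi_\alpha y]+\psi_{\rho_y\alpha}x-\psi_{\rho_x\alpha}y$; (11) $\psi_\alpha(\langle x,y,z\rangle)=\langle x,y,\psi_\alpha z\rangle-\psi_{D_{\rho,\mu}(x,y)\alpha}z$; (12) $\langle\psi_\alpha x,y,z\rangle+\langle x,\psi_\alpha y,z\rangle=0$;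 (13) $\psi_{\mu(x,y)\alpha}z=\psi_{\mu(x,z)\alpha}y$; (14) $\nu(\alpha,\beta)([x,y])=\nu(\rho_y\alpha,\beta)x-\nu(\rho_x\alpha,\beta)y$; (15) $\nu(\alpha,\beta)\langle x,y,z\rangle=\langle x,y,\nu(\alpha,\beta)z\rangle-\nu(D_{\rho,\mu}(x,y)\alpha,\beta)z-\nu(\alpha,D_{\rho,\mu}(x,y)\beta)z$; (16) $\nu(\alpha,\rho_x\beta)y=[x,\nu(\alpha,\beta)y]$; (17) $\nu(\mu(x,y)\alpha,\beta)z-\nu(\mu(x,z)\alpha,\beta)y=\nu(\alpha,D_{\rho,\mu}(y,z)\beta)x-\langle y,z,\nu(\alpha,\beta)x\rangle$; (18) $\nu(\alpha,\mu(x,y)\beta)z=\langle\nu(\alpha,\beta)z,x,y\rangle-D_{\psi,\nu}(\beta,\mu(z,x)\alpha)y+\nu(\beta,\mu(z,y)\alpha)x$. **Bicrossed product.** $\mathfrak g\bowtie\mathfrak h$ is the Lie-Yamaguti algebra on $\mathfrak g\oplus\mathfrak h$ with operations $[(x,\alpha),(y,\beta)]_{\bowtie}=([x,y]+\psi_\alpha y-\psi_\beta x,\ [\alpha,\beta]'+\rho_x\beta-\rho_y\alpha)$, $\langle(x,\alpha),(y,\beta),(z,\gamma)\rangle_{\bowtie}=(\langle x,y,z\rangle+D_{\psi,\nu}(\alpha,\beta)z+\nu(\beta,\gamma)x-\nu(\alpha,\gamma)y,\ \langle\alpha,\beta,\gamma\rangle'+D_{\rho,\mu}(x,y)\gamma+\mu(y,z)\alpha-\mu(x,z)\beta)$.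 (It is known that this is a Lie-Yamaguti algebra.) **Deformation map.** A linear map $r:\mathfrak h\to\mathfrak g$ is a deformation map in the matched pair if for all $\alpha,\beta,\gamma\in\mathfrak h$: $[r(\alpha),r(\beta)]+\psi_\alpha r(\beta)-\psi_\beta r(\alpha)=r([\alpha,\beta]'+\rho_{r(\alpha)}\beta-\rho_{r(\beta)}\alpha)$, and $\langle r(\alpha),r(\beta),r(\gamma)\rangle+D_{\psi,\nu}(\alpha,\beta)r(\gamma)+\nu(\beta,\gamma)r(\alpha)-\nu(\alpha,\gamma)r(\beta)=r(\langle\alpha,\beta,\gamma\rangle'+D_{\rho,\mu}(r(\alpha),r(\beta))\gamma+\mu(r(\beta),r(\gamma))\alpha-\mu(r(\alpha),r(\gamma))\beta)$. **The graded Lie algebra $(C^{\bullet+1}(W,W),[\,,]_{\mathsf{LY}})$.** For vector spaces $W,V$ put $C^1(W,V)=\mathrm{Hom}(W,V)$ and, for $p\ge1$, $C^{p+1}(W,V)=\mathrm{Hom}((\wedge^2W)^{\otimes p},V)\oplus\mathrm{Hom}((\wedge^2W)^{\otimes p}\otimes W,V)$; write $P=(P_{\mathrm I},P_{\mathrm{II}})$ for elements of the latter. The degree $p$ part of $C^{\bullet+1}(W,V)$ is $C^{p+1}(W,V)$, $p\ge0$. For $V=W$ define $\diamond:C^{p+1}(W,W)\times C^{q+1}(W,W)\to C^{p+q+1}(W,W)$ as follows, with $\mathfrak X_i=x_i\wedge y_i\in\wedge^2W$, $x\in W$, $\mathbb S_{(a,b)}$ the set of $(a,b)$-shuffles and $(-1)^\sigma$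 the sign of $\sigma$. - $f,g\in C^1$: $f\diamond g=f\circ g$. - $f\in C^1$, $P\in C^{p+1}$, $p\ge1$: $(f\diamond P)_{\mathrm I}=f\circ P_{\mathrm I}$, $(f\diamond P)_{\mathrm{II}}=f\circ P_{\mathrm{II}}$, $(P\diamond f)_{\mathrm I}(\mathfrak X_1,\dots,\mathfrak X_p)=\sum_{k=1}^pP_{\mathrm I}(\mathfrak X_1,\dots,\mathfrak X_{k-1},f(x_k)\wedge y_k+x_k\wedge f(y_k),\mathfrak X_{k+1},\dots,\mathfrak X_p)$, $(P\diamond f)_{\mathrm{II}}(\mathfrak X_1,\dots,\mathfrak X_p,x)=\sum_{k=1}^pP_{\mathrm{II}}(\mathfrak X_1,\dots,\mathfrak X_{k-1},f(x_k)\wedge y_k+x_k\wedge f(y_k),\mathfrak X_{k+1},\dots,\mathfrak X_p,x)+P_{\mathrm{II}}(\mathfrak X_1,\dots,\mathfrak X_p,f(x))$. - $P\in C^{p+1}$, $Q\in C^{q+1}$, $p,q\ge1$: $(P\diamond Q)_{\mathrm I}(\mathfrak X_1,\dots,\mathfrak X_{p+q})=\sum_{\sigma\in\mathbb S_{(p,q)},\,\sigma(p+q)=p+q}(-1)^{pq}(-1)^\sigma P_{\mathrm{II}}(\mathfrak X_{\sigma(1)},\dots,\mathfrak X_{\sigma(p)},Q_{\mathrm I}(\mathfrak X_{\sigma(p+1)},\dots,\mathfrak X_{\sigma(p+q)}))$ $+\sum_{k=1}^p(-1)^{(k-1)q}\sum_{\sigma\in\mathbb S_{(k-1,q)}}(-1)^\sigma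 P_{\mathrm I}(\mathfrak X_{\sigma(1)},\dots,\mathfrak X_{\sigma(k-1)},Q_{\mathrm{II}}(\mathfrak X_{\sigma(k)},\dots,\mathfrak X_{\sigma(k+q-1)},x_{k+q})\wedge y_{k+q},\mathfrak X_{k+q+1},\dots,\mathfrak X_{p+q})$ $+\sum_{k=1}^p(-1)^{(k-1)q}\sum_{\sigma\in\mathbb S_{(k-1,q)}}(-1)^\sigma P_{\mathrm I}(\mathfrak X_{\sigma(1)},\dots,\mathfrak X_{\sigma(k-1)},x_{k+q}\wedge Q_{\mathrm{II}}(\mathfrak X_{\sigma(k)},\dots,\mathfrak X_{\sigma(k+q-1)},y_{k+q}),\mathfrak X_{k+q+1},\dots,\mathfrak X_{p+q})$; $(P\diamond Q)_{\mathrm{II}}(\mathfrak X_1,\dots,\mathfrak X_{p+q},x)=\sum_{\sigma\in\mathbb S_{(p,q)}}(-1)^{pq}(-1)^\sigma P_{\mathrm{II}}(\mathfrak X_{\sigma(1)},\dots,\mathfrak X_{\sigma(p)},Q_{\mathrm{II}}(\mathfrak X_{\sigma(p+1)},\dots,\mathfrak X_{\sigma(p+q)},x))$ $+\sum_{k=1}^p(-1)^{(k-1)q}\sum_{\sigma\in\mathbb S_{(k-1,q)}}(-1)^\sigma P_{\mathrm{II}}(\mathfrak X_{\sigma(1)},\dots,\mathfrak X_{\sigma(k-1)},Q_{\mathrm{II}}(\mathfrak X_{\sigma(k)},\dots,\mathfrak X_{\sigma(k+q-1)},x_{k+q})\wedge y_{k+q},\mathfrak X_{k+q+1},\dots,\mathfrak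 X_{p+q},x)$ $+\sum_{k=1}^p(-1)^{(k-1)q}\sum_{\sigma\in\mathbb S_{(k-1,q)}}(-1)^\sigma P_{\mathrm{II}}(\mathfrak X_{\sigma(1)},\dots,\mathfrak X_{\sigma(k-1)},x_{k+q}\wedge Q_{\mathrm{II}}(\mathfrak X_{\sigma(k)},\dots,\mathfrak X_{\sigma(k+q-1)},y_{k+q}),\mathfrak X_{k+q+1},\dots,\mathfrak X_{p+q},x)$. Set $[P,Q]_{\mathsf{LY}}=P\diamond Q-(-1)^{pq}Q\diamond P$. It is known that $(C^{\bullet+1}(W,W),[\,,]_{\mathsf{LY}})$ is a graded Lie algebra and that the pair of operations of a Lie-Yamaguti algebra structure on $W$ is a Maurer-Cartan element $\pi\in C^2(W,W)$ of it, i.e. $[\pi,\pi]_{\mathsf{LY}}=0$. The subspace $\mathfrak a=C^{\bullet+1}(\mathfrak h,\mathfrak g)$ is embedded in $C^{\bullet+1}(\mathfrak g\oplus\mathfrak h,\mathfrak g\oplus\mathfrak h)$ by extending maps by zero on all inputs from $\mathfrak g$ and composing with $\mathfrak g\hookrightarrow\mathfrak g\oplus\mathfrak h$; the projection $p$ restricts all inputs to $\mathfrak h$ and projects the output to $\mathfrak g$. **$V$-data.** A quadruple $(\mathfrak L,\mathfrak a,p,\Delta)$ with $\mathfrak L$ a graded Lie algebra, $\mathfrak a\subset\mathfrak L$ an abelian graded Lie subalgebra, $p:\mathfrak L\to\mathfrak a\subset\mathfrak L$ a projection whose kernel is a graded Lie subalgebra, and $\Delta\in\ker(p)_1$ with $[\Delta,\Delta]=0$.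 **$L_\infty$-algebra.** A graded vector space $\mathcal L=\oplus_{n\in\mathbb Z}\mathcal L_n$ with degree $1$ graded symmetric linear maps $l_k:\mathcal L^{\otimes k}\to\mathcal L$, $k\ge1$, such that for all $N\ge1$ and homogeneous $x_1,\dots,x_N$: $\sum_{i=1}^N\sum_{\sigma\in\mathbb S_{(i,N-i)}}\epsilon(\sigma)\,l_{N-i+1}(l_i(x_{\sigma(1)},\dots,x_{\sigma(i)}),x_{\sigma(i+1)},\dots,x_{\sigma(N)})=0$, where $\epsilon(\sigma)$ is the Koszul sign. A Maurer-Cartan element is $c\in\mathcal L_0$ with $\sum_{k\ge1}\frac1{k!}l_k(c,\dots,c)=0$.
   Formalization: That the bicrossed product is a Lie-Yamaguti algebra, quoted as known, is assumed as a separate hypothesis: it does not follow from conditions (1)–(18) as printed, and without it the claim that the quadruple is a V-data can fail. *)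

theory Defs
  imports "HOL-Analysis.Product_Vector" "HOL-Library.Function_Algebras"
    "HOL-Combinatorics.Permutations"
begin

section \<open>Lie-Yamaguti algebras, representations and matched pairs\<close>

definition bilinear_map ::
  "('k::field \<Rightarrow> 'a::ab_group_add \<Rightarrow> 'a) \<Rightarrow> ('k \<Rightarrow> 'b::ab_group_add \<Rightarrow> 'b) \<Rightarrow>
   ('k \<Rightarrow> 'c::ab_group_add \<Rightarrow> 'c) \<Rightarrow> ('a \<Rightarrow> 'b \<Rightarrow> 'c) \<Rightarrow> bool" where
  "bilinear_map s1 s2 s3 f \<longleftrightarrow>
     (\<forall>x. Vector_Spaces.linear s2 s3 (\<lambda>y. f x y)) \<and>
     (\<forall>y. Vector_Spaces.linear s1 s3 (\<lambda>x. f x y))"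

definition trilinear_map ::
  "('k::field \<Rightarrow> 'a::ab_group_add \<Rightarrow> 'a) \<Rightarrow> ('k \<Rightarrow> 'b::ab_group_add \<Rightarrow> 'b) \<Rightarrow>
   ('k \<Rightarrow> 'c::ab_group_add \<Rightarrow> 'c) \<Rightarrow> ('k \<Rightarrow> 'd::ab_group_add \<Rightarrow> 'd) \<Rightarrow>
   ('a \<Rightarrow> 'b \<Rightarrow> 'c \<Rightarrow> 'd) \<Rightarrow> bool" where
  "trilinear_map s1 s2 s3 s4 f \<longleftrightarrow>
     (\<forall>x y. Vector_Spaces.linear s3 s4 (\<lambda>z. f x y z)) \<and>
     (\<forall>x z. Vector_Spaces.linear s2 s4 (\<lambda>y. f x y z)) \<and>
     (\<forall>y z. Vector_Spaces.linear s1 s4 (\<lambda>x. f x y z))"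

locale Lie_Yamaguti_algebra = vector_space scale
  for scale :: "'k::field_char_0 \<Rightarrow> 'a::ab_group_add \<Rightarrow> 'a" +
  fixes br :: "'a \<Rightarrow> 'a \<Rightarrow> 'a" and tb :: "'a \<Rightarrow> 'a \<Rightarrow> 'a \<Rightarrow> 'a"
  assumes br_bilinear: "bilinear_map scale scale scale br"
    and br_alternating: "br x x = 0"
    and tb_trilinear: "trilinear_map scale scale scale scale tb"
    and tb_alternating: "tb x x z = 0"
    and LY1: "br (br x y) z + br (br y z) x + br (br z x) y + tb x y z + tb y z x + tb z x y = 0"
    and LY2: "tb (br x y) z w + tb (br y z) x w + tb (br z x) y w = 0"
    and LY3: "tb x y (br z w) = br (tb x y z) w + br z (tb x y w)"
    and LY4: "tb x y (tb z w t) = tb (tb x y z) w t + tb z (tb x y w) t + tb z w (tb x y t)"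

definition rep_D ::
  "('a \<Rightarrow> 'a \<Rightarrow> 'a) \<Rightarrow> ('a \<Rightarrow> 'v \<Rightarrow> 'v::ab_group_add) \<Rightarrow> ('a \<Rightarrow> 'a \<Rightarrow> 'v \<Rightarrow> 'v) \<Rightarrow> 'a \<Rightarrow> 'a \<Rightarrow> 'v \<Rightarrow> 'v" where
  "rep_D br rho mu x y v = rho x (rho y v) - rho y (rho x v) - rho (br x y) v - mu x y v + mu y x v"

locale Lie_Yamaguti_representation =
  Lie_Yamaguti_algebra scale br tb + V: vector_space vscale
  for scale :: "'k::field_char_0 \<Rightarrow> 'a::ab_group_add \<Rightarrow> 'a"
    and br :: "'a \<Rightarrow> 'a \<Rightarrow> 'a" and tb :: "'a \<Rightarrow> 'a \<Rightarrow> 'a \<Rightarrow> 'a"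
    and vscale :: "'k \<Rightarrow> 'v::ab_group_add \<Rightarrow> 'v" +
  fixes rho :: "'a \<Rightarrow> 'v \<Rightarrow> 'v" and mu :: "'a \<Rightarrow> 'a \<Rightarrow> 'v \<Rightarrow> 'v"
  assumes rho_linear: "bilinear_map scale vscale vscale rho"
    and mu_linear: "trilinear_map scale scale vscale vscale mu"
    and rep1: "mu (br x y) z v = mu x z (rho y v) - mu y z (rho x v)"
    and rep2: "mu x (br y z) v = rho y (mu x z v) - rho z (mu x y v)"
    and rep3: "rho (tb x y z) v = rep_D br rho mu x y (rho z v) - rho z (rep_D br rho mu x y v)"
    and rep4: "mu z w (mu x y v) - mu y w (mu x z v) - mu x (tb y z w) v
                 + rep_D br rho mu y z (mu x w v) = 0"
    and rep5: "mu (tb x y z) w v + mu z (tb x y w) v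
                 = rep_D br rho mu x y (mu z w v) - mu z w (rep_D br rho mu x y v)"

locale matched_pair =
  g: Lie_Yamaguti_representation sg brg tbg sh rho mu +
  h: Lie_Yamaguti_representation sh brh tbh sg psi nu
  for sg :: "'k::field_char_0 \<Rightarrow> 'g::ab_group_add \<Rightarrow> 'g"
    and brg :: "'g \<Rightarrow> 'g \<Rightarrow> 'g" and tbg :: "'g \<Rightarrow> 'g \<Rightarrow> 'g \<Rightarrow> 'g"
    and sh :: "'k \<Rightarrow> 'h::ab_group_add \<Rightarrow> 'h"
    and brh :: "'h \<Rightarrow> 'h \<Rightarrow> 'h" and tbh :: "'h \<Rightarrow> 'h \<Rightarrow> 'h \<Rightarrow> 'h"
    and rho :: "'g \<Rightarrow> 'h \<Rightarrow> 'h" and mu :: "'g \<Rightarrow> 'g \<Rightarrow> 'h \<Rightarrow> 'h"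
    and psi :: "'h \<Rightarrow> 'g \<Rightarrow> 'g" and nu :: "'h \<Rightarrow> 'h \<Rightarrow> 'g \<Rightarrow> 'g" +
  assumes mp1: "rho x (brh \<alpha> \<beta>)
      = brh (rho x \<alpha>) \<beta> + brh \<alpha> (rho x \<beta>) + rho (psi \<beta> x) \<alpha> - rho (psi \<alpha> x) \<beta>"
    and mp2: "rho x (tbh \<alpha> \<beta> \<gamma>) = tbh \<alpha> \<beta> (rho x \<gamma>) - rho (rep_D brh psi nu \<alpha> \<beta> x) \<gamma>"
    and mp3: "tbh (rho x \<alpha>) \<beta> \<gamma> + tbh \<alpha> (rho x \<beta>) \<gamma> = 0"
    and mp4: "rho (nu \<alpha> \<beta> x) \<gamma> = rho (nu \<alpha> \<gamma> x) \<beta>"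
    and mp5: "mu x y (brh \<alpha> \<beta>) = mu (psi \<beta> x) y \<alpha> - mu (psi \<alpha> x) y \<beta>"
    and mp6: "mu x y (tbh \<alpha> \<beta> \<gamma>)
      = tbh \<alpha> \<beta> (mu x y \<gamma>) - mu (rep_D brh psi nu \<alpha> \<beta> x) y \<gamma> - mu x (rep_D brh psi nu \<alpha> \<beta> y) \<gamma>"
    and mp7: "mu x (psi \<alpha> y) \<beta> = brh \<alpha> (mu x y \<beta>)"
    and mp8: "mu (nu \<alpha> \<beta> x) y \<gamma> - mu (nu \<alpha> \<gamma> x) y \<beta>
      = mu x (rep_D brh psi nu \<beta> \<gamma> y) \<alpha> - tbh \<beta> \<gamma> (mu x y \<alpha>)"
    and mp9: "mu x (nu \<alpha> \<beta> y) \<gamma>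
      = tbh (mu x y \<gamma>) \<alpha> \<beta> - rep_D brg rho mu y (nu \<gamma> \<alpha> x) \<beta> + mu y (nu \<gamma> \<beta> x) \<alpha>"
    and mp10: "psi \<alpha> (brg x y)
      = brg (psi \<alpha> x) y + brg x (psi \<alpha> y) + psi (rho y \<alpha>) x - psi (rho x \<alpha>) y"
    and mp11: "psi \<alpha> (tbg x y z) = tbg x y (psi \<alpha> z) - psi (rep_D brg rho mu x y \<alpha>) z"
    and mp12: "tbg (psi \<alpha> x) y z + tbg x (psi \<alpha> y) z = 0"
    and mp13: "psi (mu x y \<alpha>) z = psi (mu x z \<alpha>) y"
    and mp14: "nu \<alpha> \<beta> (brg x y) = nu (rho y \<alpha>) \<beta> x - nu (rho x \<alpha>) \<beta> y"
    and mp15: "nu \<alpha> \<beta> (tbg x y z)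
      = tbg x y (nu \<alpha> \<beta> z) - nu (rep_D brg rho mu x y \<alpha>) \<beta> z - nu \<alpha> (rep_D brg rho mu x y \<beta>) z"
    and mp16: "nu \<alpha> (rho x \<beta>) y = brg x (nu \<alpha> \<beta> y)"
    and mp17: "nu (mu x y \<alpha>) \<beta> z - nu (mu x z \<alpha>) \<beta> y
      = nu \<alpha> (rep_D brg rho mu y z \<beta>) x - tbg y z (nu \<alpha> \<beta> x)"
    and mp18: "nu \<alpha> (mu x y \<beta>) z
      = tbg (nu \<alpha> \<beta> z) x y - rep_D brh psi nu \<beta> (mu z x \<alpha>) y + nu \<beta> (mu z y \<alpha>) x"

text \<open>
  The identities of \<^locale>\<open>matched_pair\<close> alone do not make the following operations a
  Lie-Yamaguti structure on the direct sum: they do not imply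
  \<open>rep_D brg rho mu (psi \<alpha> x) y \<beta> +
  rep_D brg rho mu x (psi \<alpha> y) \<beta> = 0\<close>, a component of \<open>LY2\<close>, and \<open>LY3\<close> can fail as well.
  Hence the Lie-Yamaguti property of the bicrossed product is a hypothesis of its own wherever
  it is used.  A counterexample with \<open>mu = nu = 0\<close>, \<open>brg = 0\<close>, \<open>tbg = 0\<close>, \<open>tbh = 0\<close>: take bases
  \<open>x, y, u\<close> and \<open>a, b, c, d, e\<close>, and let the nonzero products be \<open>brh a b = c = - brh b a\<close>,
  \<open>psi b x = u\<close>, \<open>rho u a = d\<close>, \<open>rho x c = d\<close>, \<open>rho y d = e\<close>.
\<close>

definition bicrossed_br ::
  "('g \<Rightarrow> 'g \<Rightarrow> 'g::ab_group_add) \<Rightarrow> ('h \<Rightarrow> 'h \<Rightarrow> 'h::ab_group_add) \<Rightarrow>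
   ('g \<Rightarrow> 'h \<Rightarrow> 'h) \<Rightarrow> ('h \<Rightarrow> 'g \<Rightarrow> 'g) \<Rightarrow> 'g \<times> 'h \<Rightarrow> 'g \<times> 'h \<Rightarrow> 'g \<times> 'h" where
  "bicrossed_br brg brh rho psi = (\<lambda>(x, \<alpha>) (y, \<beta>).
     (brg x y + psi \<alpha> y - psi \<beta> x, brh \<alpha> \<beta> + rho x \<beta> - rho y \<alpha>))"

definition bicrossed_tb ::
  "('g \<Rightarrow> 'g \<Rightarrow> 'g::ab_group_add) \<Rightarrow> ('g \<Rightarrow> 'g \<Rightarrow> 'g \<Rightarrow> 'g) \<Rightarrow>
   ('h \<Rightarrow> 'h \<Rightarrow> 'h::ab_group_add) \<Rightarrow> ('h \<Rightarrow> 'h \<Rightarrow> 'h \<Rightarrow> 'h) \<Rightarrow>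
   ('g \<Rightarrow> 'h \<Rightarrow> 'h) \<Rightarrow> ('g \<Rightarrow> 'g \<Rightarrow> 'h \<Rightarrow> 'h) \<Rightarrow> ('h \<Rightarrow> 'g \<Rightarrow> 'g) \<Rightarrow> ('h \<Rightarrow> 'h \<Rightarrow> 'g \<Rightarrow> 'g) \<Rightarrow>
   'g \<times> 'h \<Rightarrow> 'g \<times> 'h \<Rightarrow> 'g \<times> 'h \<Rightarrow> 'g \<times> 'h" where
  "bicrossed_tb brg tbg brh tbh rho mu psi nu = (\<lambda>(x, \<alpha>) (y, \<beta>) (z, \<gamma>).
     (tbg x y z + rep_D brh psi nu \<alpha> \<beta> z + nu \<beta> \<gamma> x - nu \<alpha> \<gamma> y,
      tbh \<alpha> \<beta> \<gamma> + rep_D brg rho mu x y \<gamma> + mu y z \<alpha> - mu x z \<beta>))"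

definition deformation_map ::
  "('k::field \<Rightarrow> 'g::ab_group_add \<Rightarrow> 'g) \<Rightarrow> ('g \<Rightarrow> 'g \<Rightarrow> 'g) \<Rightarrow> ('g \<Rightarrow> 'g \<Rightarrow> 'g \<Rightarrow> 'g) \<Rightarrow>
   ('k \<Rightarrow> 'h::ab_group_add \<Rightarrow> 'h) \<Rightarrow> ('h \<Rightarrow> 'h \<Rightarrow> 'h) \<Rightarrow> ('h \<Rightarrow> 'h \<Rightarrow> 'h \<Rightarrow> 'h) \<Rightarrow>
   ('g \<Rightarrow> 'h \<Rightarrow> 'h) \<Rightarrow> ('g \<Rightarrow> 'g \<Rightarrow> 'h \<Rightarrow> 'h) \<Rightarrow> ('h \<Rightarrow> 'g \<Rightarrow> 'g) \<Rightarrow> ('h \<Rightarrow> 'h \<Rightarrow> 'g \<Rightarrow> 'g) \<Rightarrow>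
   ('h \<Rightarrow> 'g) \<Rightarrow> bool" where
  "deformation_map sg brg tbg sh brh tbh rho mu psi nu r \<longleftrightarrow>
     Vector_Spaces.linear sh sg r \<and>
     (\<forall>\<alpha> \<beta>. brg (r \<alpha>) (r \<beta>) + psi \<alpha> (r \<beta>) - psi \<beta> (r \<alpha>)
        = r (brh \<alpha> \<beta> + rho (r \<alpha>) \<beta> - rho (r \<beta>) \<alpha>)) \<and>
     (\<forall>\<alpha> \<beta> \<gamma>. tbg (r \<alpha>) (r \<beta>) (r \<gamma>) + rep_D brh psi nu \<alpha> \<beta> (r \<gamma>)
          + nu \<beta> \<gamma> (r \<alpha>) - nu \<alpha> \<gamma> (r \<beta>)
        = r (tbh \<alpha> \<beta> \<gamma> + rep_D brg rho mu (r \<alpha>) (r \<beta>) \<gamma>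
             + mu (r \<beta>) (r \<gamma>) \<alpha> - mu (r \<alpha>) (r \<gamma>) \<beta>))"


section \<open>Shuffles and Koszul signs\<close>

text \<open>Positions are counted from \<open>0\<close>.\<close>

definition shuffle_perms :: "nat \<Rightarrow> nat \<Rightarrow> (nat \<Rightarrow> nat) set" where
  "shuffle_perms a b = {\<sigma>. \<sigma> permutes {..<a + b} \<and>
     strict_mono_on {..<a} \<sigma> \<and> strict_mono_on {a..<a + b} \<sigma>}"

text \<open>
  The sign \<open>\<epsilon>(\<sigma>)\<close> in \<open>x\<^bsub>\<sigma>(1)\<^esub> \<odot> \<dots> \<odot> x\<^bsub>\<sigma>(N)\<^esub> = \<epsilon>(\<sigma>) x\<^sub>1 \<odot> \<dots> \<odot> x\<^sub>N\<close>, where \<open>ds\<close> lists the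
  degrees of \<open>x\<^sub>1, \<dots>, x\<^sub>N\<close>.
\<close>

definition koszul_sign :: "int list \<Rightarrow> (nat \<Rightarrow> nat) \<Rightarrow> 'k::field" where
  "koszul_sign ds \<sigma> =
     (\<Prod>(i, j) \<in> {(i, j). i < j \<and> j < length ds \<and> \<sigma> j < \<sigma> i}. (- 1) powi (ds ! \<sigma> i * ds ! \<sigma> j))"


section \<open>Graded Lie algebras, V-data, and L-infinity algebras\<close>

text \<open>
  A graded vector space is given by its homogeneous components, which are independent subspaces
  of an ambient vector space; the graded space itself is their sum \<open>total_space\<close>.
\<close>

locale graded_vector_space = vector_space scale
  for scale :: "'k::field_char_0 \<Rightarrow> 'v::ab_group_add \<Rightarrow> 'v" +
  fixes L :: "int \<Rightarrow> 'v set"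
  assumes component_subspace: "subspace (L n)"
    and components_independent:
      "\<lbrakk>finite I; \<And>n. n \<in> I \<Longrightarrow> x n \<in> L n; (\<Sum>n\<in>I. x n) = 0; m \<in> I\<rbrakk> \<Longrightarrow> x m = 0"
begin

definition total_space :: "'v set" where
  "total_space = span (\<Union>n. L n)"

end

locale graded_Lie_algebra = graded_vector_space scale L
  for scale :: "'k::field_char_0 \<Rightarrow> 'v::ab_group_add \<Rightarrow> 'v" and L :: "int \<Rightarrow> 'v set" +
  fixes br :: "'v \<Rightarrow> 'v \<Rightarrow> 'v"
  assumes br_add_left: "\<lbrakk>x \<in> total_space; y \<in> total_space; z \<in> total_space\<rbrakk> \<Longrightarrow> br (x + y) z = br x z + br y z"
    and br_add_right: "\<lbrakk>x \<in> total_space; y \<in> total_space; z \<in> total_space\<rbrakk> \<Longrightarrow> br x (y + z) = br x y + br x z"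
    and br_scale_left: "\<lbrakk>x \<in> total_space; y \<in> total_space\<rbrakk> \<Longrightarrow> br (scale c x) y = scale c (br x y)"
    and br_scale_right: "\<lbrakk>x \<in> total_space; y \<in> total_space\<rbrakk> \<Longrightarrow> br x (scale c y) = scale c (br x y)"
    and br_degree: "\<lbrakk>x \<in> L m; y \<in> L n\<rbrakk> \<Longrightarrow> br x y \<in> L (m + n)"
    and br_antisym: "\<lbrakk>x \<in> L m; y \<in> L n\<rbrakk> \<Longrightarrow> br x y = - scale ((- 1) powi (m * n)) (br y x)"
    and br_Jacobi: "\<lbrakk>x \<in> L m; y \<in> L n; z \<in> L k\<rbrakk> \<Longrightarrow>
      br x (br y z) = br (br x y) z + scale ((- 1) powi (m * n)) (br y (br x z))"
begin

definition graded_Lie_subalgebra :: "(int \<Rightarrow> 'v set) \<Rightarrow> bool" where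
  "graded_Lie_subalgebra A \<longleftrightarrow> (\<forall>n. subspace (A n) \<and> A n \<subseteq> L n) \<and>
     (\<forall>m n. \<forall>x\<in>A m. \<forall>y\<in>A n. br x y \<in> A (m + n))"

end

locale V_data = graded_Lie_algebra scale L br
  for scale :: "'k::field_char_0 \<Rightarrow> 'v::ab_group_add \<Rightarrow> 'v" and L :: "int \<Rightarrow> 'v set"
    and br :: "'v \<Rightarrow> 'v \<Rightarrow> 'v" +
  fixes A :: "int \<Rightarrow> 'v set" and p :: "'v \<Rightarrow> 'v" and \<Delta> :: 'v
  assumes subalgebra: "graded_Lie_subalgebra A"
    and abelian: "\<lbrakk>x \<in> A m; y \<in> A n\<rbrakk> \<Longrightarrow> br x y = 0"
    and p_add: "\<lbrakk>x \<in> total_space; y \<in> total_space\<rbrakk> \<Longrightarrow> p (x + y) = p x + p y"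
    and p_scale: "x \<in> total_space \<Longrightarrow> p (scale c x) = scale c (p x)"
    and p_range: "x \<in> L n \<Longrightarrow> p x \<in> A n"
    and p_projection: "x \<in> A n \<Longrightarrow> p x = x"
    and kernel_subalgebra: "graded_Lie_subalgebra (\<lambda>n. {x \<in> L n. p x = 0})"
    and \<Delta>_kernel: "\<Delta> \<in> L 1" "p \<Delta> = 0"
    and \<Delta>_square: "br \<Delta> \<Delta> = 0"

text \<open>The map \<open>l\<^sub>k\<close> is \<open>l k\<close>, applied to lists of length \<open>k\<close>.\<close>

locale L_infinity_algebra = graded_vector_space scale L
  for scale :: "'k::field_char_0 \<Rightarrow> 'v::ab_group_add \<Rightarrow> 'v" and L :: "int \<Rightarrow> 'v set" +
  fixes l :: "nat \<Rightarrow> 'v list \<Rightarrow> 'v"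
  assumes l_linear:
      "\<lbrakk>k \<ge> 1; length xs = k; set xs \<subseteq> total_space; i < k; x \<in> total_space; y \<in> total_space\<rbrakk> \<Longrightarrow>
         l k (xs[i := scale c x + y]) = scale c (l k (xs[i := x])) + l k (xs[i := y])"
    and l_degree:
      "\<lbrakk>k \<ge> 1; length xs = k; length ds = k; \<And>i. i < k \<Longrightarrow> xs ! i \<in> L (ds ! i)\<rbrakk> \<Longrightarrow>
         l k xs \<in> L (sum_list ds + 1)"
    and l_symmetric:
      "\<lbrakk>k \<ge> 1; length xs = k; length ds = k; \<And>i. i < k \<Longrightarrow> xs ! i \<in> L (ds ! i);
        \<sigma> permutes {..<k}\<rbrakk> \<Longrightarrow>
         l k (permute_list \<sigma> xs) = scale (koszul_sign ds \<sigma>) (l k xs)"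
    and l_Jacobi:
      "\<lbrakk>N \<ge> 1; length xs = N; length ds = N; \<And>i. i < N \<Longrightarrow> xs ! i \<in> L (ds ! i)\<rbrakk> \<Longrightarrow>
         (\<Sum>i = 1..N. \<Sum>\<sigma> \<in> shuffle_perms i (N - i).
            scale (koszul_sign ds \<sigma>)
              (l (N - i + 1) (l i (take i (permute_list \<sigma> xs)) # drop i (permute_list \<sigma> xs)))) = 0"

text \<open>
  The Maurer-Cartan sum has no topology to converge in, so it is required to have only finitely
  many nonzero terms.
\<close>

definition maurer_cartan ::
  "('k::field_char_0 \<Rightarrow> 'v::ab_group_add \<Rightarrow> 'v) \<Rightarrow> (int \<Rightarrow> 'v set) \<Rightarrow> (nat \<Rightarrow> 'v list \<Rightarrow> 'v) \<Rightarrow>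
   'v \<Rightarrow> bool" where
  "maurer_cartan sc L l c \<longleftrightarrow> c \<in> L 0 \<and>
     finite {k. k \<ge> 1 \<and> l k (replicate k c) \<noteq> 0} \<and>
     (\<Sum>k | k \<ge> 1 \<and> l k (replicate k c) \<noteq> 0. sc (1 / fact k) (l k (replicate k c))) = 0"


section \<open>The graded Lie algebra of Lie-Yamaguti cochains\<close>

text \<open>
  A cochain is a pair \<open>(P\<^sub>I, P\<^sub>I\<^sub>I)\<close> of functions of a list of pairs, the pair \<open>(x, y)\<close> standing for
  \<open>x \<and> y\<close>.  A linear map on the \<open>p\<close>-fold tensor power of \<open>\<and>\<^sup>2 W\<close> is a function on lists of length
  \<open>p\<close> which is bilinear and alternating in each pair; it is extended by \<open>0\<close> to lists of other
  lengths, so that the components \<open>C\<^bsup>p+1\<^esup>\<close> lie in direct sum inside one ambient space.  In degree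
  \<open>0\<close> only the second entry is used, and \<open>f \<in> Hom(W, V)\<close> is its value at the empty list.
\<close>

type_synonym ('w, 'v) cochain = "(('w \<times> 'w) list \<Rightarrow> 'v) \<times> (('w \<times> 'w) list \<Rightarrow> 'w \<Rightarrow> 'v)"

definition wedge_multilinear ::
  "('k::field \<Rightarrow> 'w::ab_group_add \<Rightarrow> 'w) \<Rightarrow> ('k \<Rightarrow> 'v::ab_group_add \<Rightarrow> 'v) \<Rightarrow> nat \<Rightarrow>
   (('w \<times> 'w) list \<Rightarrow> 'v) \<Rightarrow> bool" where
  "wedge_multilinear sw sv p F \<longleftrightarrow>
     (\<forall>Xs. length Xs \<noteq> p \<longrightarrow> F Xs = 0) \<and>
     (\<forall>Xs i. length Xs = p \<and> i < p \<longrightarrow>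
        bilinear_map sw sw sv (\<lambda>x y. F (Xs[i := (x, y)])) \<and> (\<forall>x. F (Xs[i := (x, x)]) = 0))"

definition hom_cochain :: "('w \<Rightarrow> 'v) \<Rightarrow> ('w, 'v::ab_group_add) cochain" where
  "hom_cochain f = (0, \<lambda>Xs. if Xs = [] then f else 0)"

definition cochains ::
  "('k::field \<Rightarrow> 'w::ab_group_add \<Rightarrow> 'w) \<Rightarrow> ('k \<Rightarrow> 'v::ab_group_add \<Rightarrow> 'v) \<Rightarrow> nat \<Rightarrow>
   ('w, 'v) cochain set" where
  "cochains sw sv p =
     (if p = 0 then {hom_cochain f | f. Vector_Spaces.linear sw sv f}
      else {P. wedge_multilinear sw sv p (fst P) \<and>
               (\<forall>x. wedge_multilinear sw sv p (\<lambda>Xs. snd P Xs x)) \<and>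
               (\<forall>Xs. length Xs = p \<longrightarrow> Vector_Spaces.linear sw sv (snd P Xs))})"

definition cochain_scale ::
  "('k \<Rightarrow> 'v \<Rightarrow> 'v) \<Rightarrow> 'k \<Rightarrow> ('w, 'v) cochain \<Rightarrow> ('w, 'v) cochain" where
  "cochain_scale sv c P = (\<lambda>Xs. sv c (fst P Xs), \<lambda>Xs x. sv c (snd P Xs x))"

text \<open>Degree \<open>p\<close> of the graded space is \<open>C\<^bsup>p+1\<^esup>(W, V)\<close>, and \<open>0\<close> for negative \<open>p\<close>.\<close>

definition LY_graded ::
  "('k::field \<Rightarrow> 'w::ab_group_add \<Rightarrow> 'w) \<Rightarrow> ('k \<Rightarrow> 'v::ab_group_add \<Rightarrow> 'v) \<Rightarrow> int \<Rightarrow>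
   ('w, 'v) cochain set" where
  "LY_graded sw sv n = (if n < 0 then {0} else cochains sw sv (nat n))"

definition ops_cochain ::
  "('w \<Rightarrow> 'w \<Rightarrow> 'v) \<Rightarrow> ('w \<Rightarrow> 'w \<Rightarrow> 'w \<Rightarrow> 'v) \<Rightarrow> ('w, 'v::ab_group_add) cochain" where
  "ops_cochain br tb =
     (\<lambda>Xs. case Xs of [(x, y)] \<Rightarrow> br x y | _ \<Rightarrow> 0,
      \<lambda>Xs z. case Xs of [(x, y)] \<Rightarrow> tb x y z | _ \<Rightarrow> 0)"

text \<open>
  The shuffle sums over \<open>k = 1, \<dots>, p\<close> in \<open>P \<diamond> Q\<close>, with \<open>j = k - 1\<close>, for \<open>F = P\<^sub>I\<close> or
  \<open>F = P\<^sub>I\<^sub>I(\<dots>, x)\<close>.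
\<close>

definition diamond_insert ::
  "('k::field \<Rightarrow> 'w::ab_group_add \<Rightarrow> 'w) \<Rightarrow> nat \<Rightarrow> nat \<Rightarrow> (('w \<times> 'w) list \<Rightarrow> 'w) \<Rightarrow>
   ('w, 'w) cochain \<Rightarrow> ('w \<times> 'w) list \<Rightarrow> 'w" where
  "diamond_insert sc p q F Q Xs =
     (\<Sum>j<p. \<Sum>\<sigma> \<in> shuffle_perms j q. sc ((- 1) ^ (j * q) * of_int (sign \<sigma>))
        (let Ys = permute_list \<sigma> (take (j + q) Xs); As = take j Ys; Bs = drop j Ys;
             (x, y) = Xs ! (j + q); Rs = drop (j + q + 1) Xs
         in F (As @ (snd Q Bs x, y) # Rs) + F (As @ (x, snd Q Bs y) # Rs)))"

text \<open>\<open>P \<diamond> Q\<close> for \<open>P\<close> of degree \<open>p\<close> and \<open>Q\<close> of degree \<open>q\<close>.\<close>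

definition diamond ::
  "('k::field \<Rightarrow> 'w::ab_group_add \<Rightarrow> 'w) \<Rightarrow> nat \<Rightarrow> nat \<Rightarrow>
   ('w, 'w) cochain \<Rightarrow> ('w, 'w) cochain \<Rightarrow> ('w, 'w) cochain" where
  "diamond sc p q P Q =
    (if p = 0 \<and> q = 0 then
       hom_cochain (snd P [] \<circ> snd Q [])
     else if p = 0 then
       (\<lambda>Xs. if length Xs = q then snd P [] (fst Q Xs) else 0,
        \<lambda>Xs x. if length Xs = q then snd P [] (snd Q Xs x) else 0)
     else if q = 0 then
       (let f = snd Q [] in
        (\<lambda>Xs. if length Xs = p then
             (\<Sum>k<p. let (x, y) = Xs ! k in fst P (Xs[k := (f x, y)]) + fst P (Xs[k := (x, f y)]))
           else 0,
         \<lambda>Xs z. if length Xs = p then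
             (\<Sum>k<p. let (x, y) = Xs ! k in snd P (Xs[k := (f x, y)]) z + snd P (Xs[k := (x, f y)]) z)
             + snd P Xs (f z)
           else 0))
     else
       (\<lambda>Xs. if length Xs = p + q then
            (\<Sum>\<sigma> | \<sigma> \<in> shuffle_perms p q \<and> \<sigma> (p + q - 1) = p + q - 1.
               sc ((- 1) ^ (p * q) * of_int (sign \<sigma>))
                 (let Ys = permute_list \<sigma> Xs in snd P (take p Ys) (fst Q (drop p Ys))))
            + diamond_insert sc p q (fst P) Q Xs
          else 0,
        \<lambda>Xs x. if length Xs = p + q then
            (\<Sum>\<sigma> \<in> shuffle_perms p q.
               sc ((- 1) ^ (p * q) * of_int (sign \<sigma>))
                 (let Ys = permute_list \<sigma> Xs in snd P (take p Ys) (snd Q (drop p Ys) x)))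
            + diamond_insert sc p q (\<lambda>Zs. snd P Zs x) Q Xs
          else 0))"

definition LY_bracket_hom ::
  "('k::field \<Rightarrow> 'w::ab_group_add \<Rightarrow> 'w) \<Rightarrow> nat \<Rightarrow> nat \<Rightarrow>
   ('w, 'w) cochain \<Rightarrow> ('w, 'w) cochain \<Rightarrow> ('w, 'w) cochain" where
  "LY_bracket_hom sc p q P Q =
     diamond sc p q P Q - cochain_scale sc ((- 1) ^ (p * q)) (diamond sc q p Q P)"

definition cochain_component :: "nat \<Rightarrow> ('w, 'v::ab_group_add) cochain \<Rightarrow> ('w, 'v) cochain" where
  "cochain_component p P = (\<lambda>Xs. if length Xs = p then fst P Xs else 0,
                    \<lambda>Xs x. if length Xs = p then snd P Xs x else 0)"

text \<open>
  The bilinear extension of \<^const>\<open>LY_bracket_hom\<close> to sums of homogeneous cochains.  On a list of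
  length \<open>n\<close> only the components of degrees \<open>p\<close> and \<open>q\<close> with \<open>p + q = n\<close> contribute.
\<close>

definition LY_bracket ::
  "('k::field \<Rightarrow> 'w::ab_group_add \<Rightarrow> 'w) \<Rightarrow>
   ('w, 'w) cochain \<Rightarrow> ('w, 'w) cochain \<Rightarrow> ('w, 'w) cochain" where
  "LY_bracket sc P Q =
     (\<lambda>Xs. \<Sum>(p, q) \<in> {(p, q). p + q = length Xs}.
        fst (LY_bracket_hom sc p q (cochain_component p P) (cochain_component q Q)) Xs,
      \<lambda>Xs x. \<Sum>(p, q) \<in> {(p, q). p + q = length Xs}.
        snd (LY_bracket_hom sc p q (cochain_component p P) (cochain_component q Q)) Xs x)"


section \<open>Cochains from one summand to the other, and the derived brackets\<close>

definition extend_cochain ::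
  "('h, 'g) cochain \<Rightarrow> ('g \<times> 'h, 'g \<times> 'h::zero) cochain" where
  "extend_cochain P =
     (\<lambda>Xs. (fst P (map (map_prod snd snd) Xs), 0),
      \<lambda>Xs x. (snd P (map (map_prod snd snd) Xs) (snd x), 0))"

definition restrict_cochain ::
  "('g::zero \<times> 'h, 'g \<times> 'h) cochain \<Rightarrow> ('h, 'g) cochain" where
  "restrict_cochain P =
     (\<lambda>Xs. fst (fst P (map (map_prod (Pair 0) (Pair 0)) Xs)),
      \<lambda>Xs x. fst (snd P (map (map_prod (Pair 0) (Pair 0)) Xs) (0, x)))"

definition cochain_proj ::
  "('g::zero \<times> 'h::zero, 'g \<times> 'h) cochain \<Rightarrow> ('g \<times> 'h, 'g \<times> 'h) cochain" where
  "cochain_proj P = extend_cochain (restrict_cochain P)"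

definition sub_graded ::
  "('k::field \<Rightarrow> 'g::ab_group_add \<Rightarrow> 'g) \<Rightarrow> ('k \<Rightarrow> 'h::ab_group_add \<Rightarrow> 'h) \<Rightarrow> int \<Rightarrow>
   ('g \<times> 'h, 'g \<times> 'h) cochain set" where
  "sub_graded sg sh n = extend_cochain ` LY_graded sh sg n"

definition derived_bracket ::
  "('v \<Rightarrow> 'v \<Rightarrow> 'v) \<Rightarrow> ('v \<Rightarrow> 'v) \<Rightarrow> 'v \<Rightarrow> nat \<Rightarrow> 'v list \<Rightarrow> 'v::zero" where
  "derived_bracket br p \<Delta> k xs =
     (if k = 1 then p (br \<Delta> (xs ! 0))
      else if k = 2 then p (br (br \<Delta> (xs ! 0)) (xs ! 1))
      else if k = 3 then p (br (br (br \<Delta> (xs ! 0)) (xs ! 1)) (xs ! 2))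
      else 0)"

end

theory Submission
  imports Defs
begin

text \<open>
  All shuffle sums become recursions on words of elements of \<open>\<and>\<^sup>2 W\<close>, the elements being of odd
  degree.  A cochain \<open>P\<close> is a pair of functions on words, \<open>P\<^sub>I\<close> with values in \<open>W\<close> and \<open>P\<^sub>I\<^sub>I\<close> with
  values in \<open>End(W)\<close>; through the action of \<open>End(W)\<close> on \<open>\<and>\<^sup>2 W\<close>, the function \<open>Q\<^sub>I\<^sub>I\<close> induces a
  coderivation \<open>D\<^sub>Q\<close> of the Zinbiel coalgebra of words.  Then
  \<open>(P \<diamond> Q)\<^sub>I\<^sub>I = P\<^sub>I\<^sub>I * Q\<^sub>I\<^sub>I + P\<^sub>I\<^sub>I D\<^sub>Q\<close> and \<open>(P \<diamond> Q)\<^sub>I = P\<^sub>I\<^sub>I \<succ> Q\<^sub>I + P\<^sub>I D\<^sub>Q\<close> in all degrees, with the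
  convolution \<open>*\<close> and the half convolution \<open>\<succ>\<close>.  The associator of \<open>\<diamond>\<close> is graded symmetric in its
  last two arguments, since \<open>D\<^sub>Q\<close> is also a coderivation for the unshuffle coproduct and
  \<open>D\<close> turns brackets into commutators; this yields the graded Jacobi identity.

  The \<open>L\<^sub>\<infinity>\<close> relations follow as in Voronov's construction: apply \<open>p\<close> to the iterated brackets of
  \<open>[\<Delta>, \<Delta>] = 0\<close> with elements of \<open>\<aa>\<close>, expand by the Leibniz rule, and use
  \<open>p[u, v] = p[pu, v] + p[u, pv]\<close>.  The fourth and higher derived brackets vanish because the
  weight, outputs minus inputs in \<open>\<gg>\<close>, is at least \<open>- 2\<close> on \<open>\<Pi>\<close>, is \<open>1\<close> on \<open>\<aa>\<close>, and is never above
  \<open>1\<close>.  For \<open>r : \<hh> \<rightarrow> \<gg>\<close>, regarded as a square-zero map of \<open>\<gg> \<oplus> \<hh>\<close>, the Maurer-Cartan sum is the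
  exponential series of the derivation \<open>[-, r]\<close> on \<open>\<Pi>\<close>, which says that the graph of \<open>r\<close> is closed
  under the operations of the bicrossed product.
\<close>


section \<open>Signed sums over splittings of a word\<close>

text \<open>A value of \<open>Q\<close> is inserted into a letter that comes later than every letter
  consumed by \<open>Q\<close>. Every term is therefore governed by its last letter, and induction
  on that letter replaces the reindexing of permutations. Permutations survive only in the
  dictionary between shuffle sums and \<open>unshuffle\<close>. That dictionary is proved for
  letters of arbitrary degree: degree 1 gives the product of cochains, and the degrees of the
  arguments give the Koszul signs of the higher Jacobi identities. Signs are integer exponents
  acting on any abelian group, because the same sums take values in \<open>W\<close>, in
  \<open>End(W)\<close> and in groups of functions of one marked letter. In the last form,
  membership in a subgroup shows that a sum is alternating, linear or of a given type. Degrees are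
  explicit arguments of the products, since functions on lists have values at every length; guards
  on lengths select the splittings. Characteristic zero supplies division by 2 in the Jacobi
  identities and by 2 and 6 in the exponential series.\<close>

definition signed :: "int \<Rightarrow> 'v::ab_group_add \<Rightarrow> 'v" where
  "signed n x = (if even n then x else - x)"

lemma signed_simps [simp]:
  "signed n 0 = 0" "signed 0 x = x" "signed n (- x) = - signed n x" "signed n (signed m x) = signed (n + m) x"
  by (auto simp: signed_def)

lemma signed_add: "signed n (x + y) = signed n x + signed n y"
  by (auto simp: signed_def)

lemma signed_cong: "even n = even m \<Longrightarrow> signed n x = signed m x"
  by (auto simp: signed_def)

lemma signed_apply: "signed n f x = signed n (f x)"
  by (auto simp: signed_def)

lemma additive_signed:
  assumes "additive f"
  shows "f (signed n x) = signed n (f x)"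
  using additive.minus[OF assms] by (auto simp: signed_def)

abbreviation total_degree :: "('x \<Rightarrow> int) \<Rightarrow> 'x list \<Rightarrow> int" where
  "total_degree d w \<equiv> sum_list (map d w)"

text \<open>
  The sum over all splittings of \<open>w\<close> into subwords \<open>A, B\<close>, with the sign of the
  rearrangement that puts \<open>B\<close> first.  Words are read from their last letter, so that the head of
  a list is the last letter of a word.
\<close>

primrec unshuffle :: "('x \<Rightarrow> int) \<Rightarrow> ('x list \<Rightarrow> 'x list \<Rightarrow> 'v::ab_group_add) \<Rightarrow> 'x list \<Rightarrow> 'v" where
  "unshuffle d H [] = H [] []"
| "unshuffle d H (X # w) = unshuffle d (\<lambda>A B. H (X # A) B) w
     + unshuffle d (\<lambda>A B. signed (d X * total_degree d A) (H A (X # B))) w"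

text \<open>Of a splitting only the joint multiset of letters is remembered. It determines the joint
  length, degree and letter set, by which later summands are compared.\<close>

lemma unshuffle_cong:
  assumes "\<And>A B. mset A + mset B = mset w \<Longrightarrow> H A B = H' A B"
  shows "unshuffle d H w = unshuffle d H' w"
  using assms
proof (induction w arbitrary: H H')
  case (Cons X w)
  have "unshuffle d (\<lambda>A B. H (X # A) B) w = unshuffle d (\<lambda>A B. H' (X # A) B) w"
    by (rule Cons.IH) (simp add: Cons.prems)
  moreover have "unshuffle d (\<lambda>A B. signed (d X * total_degree d A) (H A (X # B))) w
      = unshuffle d (\<lambda>A B. signed (d X * total_degree d A) (H' A (X # B))) w"
    by (rule Cons.IH) (simp add: Cons.prems)
  ultimately show ?case by simp
qed simp

lemma mset_split_facts:
  assumes "mset A + mset B = mset w"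
  shows "length A + length B = length w"
    and "total_degree d A + total_degree d B = total_degree d w"
    and "set A \<union> set B = set w"
proof -
  have "mset (A @ B) = mset w"
    using assms by simp
  then have *: "length (A @ B) = length w" "set (A @ B) = set w"
    "sum_mset (image_mset d (mset (A @ B))) = sum_mset (image_mset d (mset w))"
    using mset_eq_length mset_eq_setD by (blast, blast, metis)
  show "length A + length B = length w" "set A \<union> set B = set w"
    using * by auto
  show "total_degree d A + total_degree d B = total_degree d w"
    using *(3) by (simp flip: sum_mset_sum_list)
qed

lemma unshuffle_cong_length:
  assumes "\<And>A B. length A + length B = length w \<Longrightarrow> H A B = H' A B"
  shows "unshuffle d H w = unshuffle d H' w"
  by (rule unshuffle_cong) (metis assms mset_split_facts(1))

lemma unshuffle_zero [simp]: "unshuffle d (\<lambda>A B. 0) w = 0"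
  by (induction w) auto

lemma unshuffle_add:
  "unshuffle d (\<lambda>A B. H A B + H' A B) w = unshuffle d H w + unshuffle d H' w"
  by (induction w arbitrary: H H') (simp_all add: signed_add)

lemma unshuffle_additive:
  assumes "additive f"
  shows "f (unshuffle d H w) = unshuffle d (\<lambda>A B. f (H A B)) w"
  by (induction w arbitrary: H)
     (simp_all add: additive.add[OF assms] additive_signed[OF assms])

lemma additive_signed_self: "additive (signed n)"
  by (simp add: additive_def signed_add)

lemma unshuffle_signed: "unshuffle d (\<lambda>A B. signed n (H A B)) w = signed n (unshuffle d H w)"
  by (simp add: unshuffle_additive[OF additive_signed_self])

lemma unshuffle_apply: "unshuffle d H w x = unshuffle d (\<lambda>A B. H A B x) w"
  by (rule unshuffle_additive[of "\<lambda>f. f x"]) (simp add: additive_def)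

text \<open>Both sides run over the splittings into three subwords. In the induction the last letter
  has three places to go; in the third it passes both other subwords, and its sign is additive in
  their degrees.\<close>

lemma unshuffle_coassoc:
  fixes H :: "'x list \<Rightarrow> 'x list \<Rightarrow> 'x list \<Rightarrow> 'v::ab_group_add"
  shows "unshuffle d (\<lambda>A B. unshuffle d (\<lambda>A1 A2. H A1 A2 B) A) w
   = unshuffle d (\<lambda>A B. unshuffle d (\<lambda>B1 B2. H A B1 B2) B) w"
proof (induction w arbitrary: H)
  case (Cons X w)
  have 1: "unshuffle d (\<lambda>A B. signed (d X * total_degree d A) (unshuffle d (\<lambda>A1 A2. H A1 A2 (X # B)) A)) w
    = unshuffle d (\<lambda>A B. unshuffle d (\<lambda>A1 A2. signed (d X * total_degree d A1 + d X * total_degree d A2) (H A1 A2 (X # B))) A) w"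
    by (auto intro!: unshuffle_cong signed_cong simp: distrib_left[symmetric] mset_split_facts(2) simp flip: unshuffle_signed)
  have "unshuffle d (\<lambda>A B. unshuffle d (\<lambda>A1 A2. H A1 A2 B) A) (X # w)
    = unshuffle d (\<lambda>A B. unshuffle d (\<lambda>A1 A2. H (X # A1) A2 B) A) w
    + unshuffle d (\<lambda>A B. unshuffle d (\<lambda>A1 A2. signed (d X * total_degree d A1) (H A1 (X # A2) B)) A) w
    + unshuffle d (\<lambda>A B. unshuffle d (\<lambda>A1 A2. signed (d X * total_degree d A1 + d X * total_degree d A2) (H A1 A2 (X # B))) A) w"
    by (simp add: unshuffle_add 1)
  also have "\<dots> = unshuffle d (\<lambda>A B. unshuffle d (\<lambda>B1 B2. H A B1 B2) B) (X # w)"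
    unfolding Cons.IH by (simp add: unshuffle_add signed_add add.assoc flip: unshuffle_signed)
  finally show ?case .
qed simp

text \<open>Graded cocommutativity of the unshuffle coproduct: the exchange of two subwords costs
  their Koszul sign.\<close>

lemma unshuffle_cocomm:
  "unshuffle d H w = unshuffle d (\<lambda>A B. signed (total_degree d A * total_degree d B) (H B A)) w"
proof (induction w arbitrary: H)
  case (Cons X w)
  have 1: "unshuffle d (\<lambda>A. H (X # A)) w
     = unshuffle d (\<lambda>A B. signed (total_degree d A * total_degree d B) (H (X # B) A)) w"
    by (rule Cons.IH)
  have 2: "unshuffle d (\<lambda>A B. signed (d X * total_degree d A) (H A (X # B))) w
     = unshuffle d (\<lambda>A B. signed (total_degree d A * total_degree d B) (signed (d X * total_degree d B) (H B (X # A)))) w"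
    by (rule Cons.IH)
  \<comment> \<open>The exponents differ by an even number: the last letter passes the other subword
    once in the recursion and once in the exchange.\<close>
  have 3: "unshuffle d (\<lambda>A B. signed (total_degree d A * total_degree d B) (H (X # B) A)) w
    = unshuffle d (\<lambda>A B. signed (d X * total_degree d A) (signed (total_degree d A * total_degree d (X # B)) (H (X # B) A))) w"
    by (auto intro!: unshuffle_cong signed_cong)
  have 4: "unshuffle d (\<lambda>A B. signed (total_degree d A * total_degree d B) (signed (d X * total_degree d B) (H B (X # A)))) w
    = unshuffle d (\<lambda>A B. signed (total_degree d (X # A) * total_degree d B) (H B (X # A))) w"
    by (auto intro!: unshuffle_cong signed_cong)
  show ?case
    unfolding unshuffle.simps 1 2 3 4 by (rule add.commute)
qed simp

abbreviation lunsh :: "('x list \<Rightarrow> 'x list \<Rightarrow> 'v::ab_group_add) \<Rightarrow> 'x list \<Rightarrow> 'v" where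
  "lunsh \<equiv> unshuffle (\<lambda>_. 1)"

lemma total_degree_one [simp]: "total_degree (\<lambda>_. 1) A = int (length A)"
  by (induction A) auto

section \<open>Coderivations induced by endomorphism-valued functions of words\<close>

text \<open>
  \<open>coder r Q F\<close> is \<open>F D\<^sub>Q\<close> for \<open>Q\<close> of degree \<open>r\<close>; only values of \<open>Q\<close> at words of length \<open>r\<close> enter.
\<close>

definition wedge_act :: "('w \<Rightarrow> 'w) \<Rightarrow> ('w \<times> 'w \<Rightarrow> 'v::ab_group_add) \<Rightarrow> 'w \<times> 'w \<Rightarrow> 'v" where
  "wedge_act f G X = G (f (fst X), snd X) + G (fst X, f (snd X))"

lemma wedge_act_add: "wedge_act f (\<lambda>X. G X + G' X) X = wedge_act f G X + wedge_act f G' X"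
  by (simp add: wedge_act_def)

lemma wedge_act_additive: "additive g \<Longrightarrow> g (wedge_act f G X) = wedge_act f (\<lambda>X. g (G X)) X"
  by (simp add: wedge_act_def additive.add)

lemma wedge_act_signed: "wedge_act f (\<lambda>X. signed n (G X)) X = signed n (wedge_act f G X)"
  by (simp add: wedge_act_additive[OF additive_signed_self])

lemma wedge_act_zero [simp]: "wedge_act f (\<lambda>X. 0) X = 0"
  by (simp add: wedge_act_def)

lemma wedge_act_unshuffle:
  "wedge_act f (\<lambda>Y. unshuffle d (H Y) w) X = unshuffle d (\<lambda>A B. wedge_act f (\<lambda>Y. H Y A B) X) w"
  by (simp add: wedge_act_def unshuffle_add)

text \<open>Either the last letter is left alone and the operator acts further down, or
  \<open>Q B\<close> acts on it for a subword \<open>B\<close> of the earlier letters. The action on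
  a wedge is spelled out as two values of \<open>F\<close>, because letters are plain pairs and the
  sum of two pairs does not represent the sum of the wedges.\<close>

primrec coder :: "nat \<Rightarrow> (('w \<times> 'w) list \<Rightarrow> 'w \<Rightarrow> 'w) \<Rightarrow> (('w \<times> 'w) list \<Rightarrow> 'v::ab_group_add) \<Rightarrow>
    ('w \<times> 'w) list \<Rightarrow> 'v" where
  "coder r Q F [] = 0"
| "coder r Q F (X # w) = coder r Q (\<lambda>u. F (X # u)) w
     + lunsh (\<lambda>A B. if length B = r then wedge_act (Q B) (\<lambda>Y. F (Y # A)) X else 0) w"

text \<open>The function \<open>Q\<close> consumes \<open>r\<close> letters, and the letter acted on
  stays in the word, so \<open>F\<close> is only evaluated at words shorter by
  \<open>r\<close>.\<close>

lemma coder_cong: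
  assumes "\<And>u. length u + r = length w \<Longrightarrow> F u = F' u"
  shows "coder r Q F w = coder r Q F' w"
  using assms
proof (induction w arbitrary: F F')
  case (Cons X w)
  have "coder r Q (\<lambda>u. F (X # u)) w = coder r Q (\<lambda>u. F' (X # u)) w"
    by (rule Cons.IH) (simp add: Cons.prems)
  moreover have "lunsh (\<lambda>A B. if length B = r then wedge_act (Q B) (\<lambda>Y. F (Y # A)) X else 0) w
      = lunsh (\<lambda>A B. if length B = r then wedge_act (Q B) (\<lambda>Y. F' (Y # A)) X else 0) w"
    by (rule unshuffle_cong_length) (auto simp: wedge_act_def intro!: arg_cong2[where f="(+)"] Cons.prems)
  ultimately show ?case by simp
qed simp

lemma coder_zero [simp]: "coder r Q (\<lambda>u. 0) w = 0"
  by (induction w) (simp_all cong: if_cong)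

lemma coder_add: "coder r Q (\<lambda>u. F u + F' u) w = coder r Q F w + coder r Q F' w"
proof (induction w arbitrary: F F')
  case (Cons X w)
  have "(if c then wedge_act f (\<lambda>Y. F (Y # A) + F' (Y # A)) X else 0)
    = (if c then wedge_act f (\<lambda>Y. F (Y # A)) X else 0)
    + (if c then wedge_act f (\<lambda>Y. F' (Y # A)) X else 0)" for c f A
    by (simp add: wedge_act_add)
  then show ?case by (simp add: Cons.IH unshuffle_add)
qed simp

lemma coder_additive:
  assumes "additive f"
  shows "f (coder r Q F w) = coder r Q (\<lambda>u. f (F u)) w"
proof (induction w arbitrary: F)
  case Nil
  show ?case by (simp add: additive.zero[OF assms])
next
  case (Cons X w)
  have "f (if c then wedge_act g (\<lambda>Y. F (Y # A)) X else 0)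
    = (if c then wedge_act g (\<lambda>Y. f (F (Y # A))) X else 0)" for c g A
    by (simp add: wedge_act_additive[OF assms] additive.zero[OF assms])
  then show ?case by (simp add: Cons.IH additive.add[OF assms] unshuffle_additive[OF assms])
qed

lemma coder_signed: "coder r Q (\<lambda>u. signed n (F u)) w = signed n (coder r Q F w)"
  by (simp add: coder_additive[OF additive_signed_self])

lemma coder_apply: "coder r Q F w x = coder r Q (\<lambda>u. F u x) w"
  by (rule coder_additive[of "\<lambda>f. f x"]) (simp add: additive_def)

lemma coder_wedge_act:
  "coder r Q (\<lambda>u. wedge_act f (\<lambda>Y. F Y u) X) w = wedge_act f (\<lambda>Y. coder r Q (F Y) w) X"
  by (simp add: wedge_act_def coder_add)

lemma coder_if_zero: "coder r Q (\<lambda>u. if c then F u else 0) w = (if c then coder r Q F w else 0)"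
  by simp

text \<open>The operator acts within one of the two factors. The sign convention of
  \<open>unshuffle\<close> places the second factor in front, so an operator of degree
  \<open>r\<close> that acts on the first factor has to pass the second one.\<close>

lemma coder_unshuffle:
  fixes H :: "('w \<times> 'w) list \<Rightarrow> ('w \<times> 'w) list \<Rightarrow> 'v::ab_group_add"
  shows "coder r R (\<lambda>u. lunsh H u) w
   = lunsh (\<lambda>A B. signed (int r * int (length B)) (coder r R (\<lambda>A'. H A' B) A)) w
   + lunsh (\<lambda>A B. coder r R (\<lambda>B'. H A B') B) w"
proof (induction w arbitrary: H)
  case (Cons X w)
  let ?I = "\<lambda>(B :: ('w \<times> 'w) list) x. if length B = r then x else (0::'v)"
  \<comment> \<open>These are the terms in which \<open>R\<close> acts on the last letter, with that
    letter in the first factor for \<open>K1\<close> and in the second for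
    \<open>K2\<close>.\<close>
  define K1 where "K1 = lunsh (\<lambda>A B. ?I B (lunsh (\<lambda>A1 A2. wedge_act (R B) (\<lambda>Y. H (Y # A1) A2) X) A)) w"
  define K2 where "K2 = lunsh (\<lambda>A B. ?I B (lunsh (\<lambda>A1 A2. signed (int (length A1)) (wedge_act (R B) (\<lambda>Y. H A1 (Y # A2)) X)) A)) w"
  have L: "coder r R (\<lambda>u. lunsh H u) (X # w)
    = coder r R (lunsh (\<lambda>A B. H (X # A) B)) w
    + coder r R (lunsh (\<lambda>A B. signed (int (length A)) (H A (X # B)))) w
    + (K1 + K2)"
  proof -
    have "lunsh (\<lambda>A B. ?I B (wedge_act (R B) (\<lambda>Y. lunsh H (Y # A)) X)) w = K1 + K2"
      unfolding K1_def K2_def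
      by (auto simp: wedge_act_add wedge_act_unshuffle wedge_act_signed simp flip: unshuffle_add intro!: unshuffle_cong)
    then show ?thesis
      by (simp add: coder_add)
  qed
  have IH2: "coder r R (lunsh (\<lambda>A B. signed (int (length A)) (H A (X # B)))) w
    = lunsh (\<lambda>A B. signed (int (length A)) (signed (int r * int (length (X # B))) (coder r R (\<lambda>A'. H A' (X # B)) A))) w
    + lunsh (\<lambda>A B. signed (int (length A)) (coder r R (\<lambda>B'. H A (X # B')) B)) w"
  proof -
    \<comment> \<open>The sign inside the operator sees the word after \<open>r\<close> letters have
      been consumed, hence the correction by \<open>r\<close>.\<close>
    have *: "coder r R (\<lambda>A'. signed (int (length A')) (H A' (X # B))) A
      = signed (int (length A) + int r) (coder r R (\<lambda>A'. H A' (X # B)) A)" for A B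
      unfolding coder_signed[symmetric]
    proof (rule coder_cong)
      fix u :: "('w \<times> 'w) list"
      assume "length u + r = length A"
      then have "int (length A) = int (length u) + int r"
        by simp
      then show "signed (int (length u)) (H u (X # B)) = signed (int (length A) + int r) (H u (X # B))"
        by (intro signed_cong) simp
    qed
    show ?thesis
      unfolding Cons.IH * coder_signed
      by (auto intro!: arg_cong2[where f="(+)"] unshuffle_cong signed_cong)
  qed
  have K1': "K1 = lunsh (\<lambda>A B. signed (int r * int (length B)) (lunsh (\<lambda>A1 A2. ?I A2 (wedge_act (R A2) (\<lambda>Y. H (Y # A1) B) X)) A)) w"
  proof -
    have "K1 = lunsh (\<lambda>A B. lunsh (\<lambda>A1 A2. ?I B (wedge_act (R B) (\<lambda>Y. H (Y # A1) A2) X)) A) w"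
      unfolding K1_def by (auto intro!: unshuffle_cong)
    also have "\<dots> = lunsh (\<lambda>A B. lunsh (\<lambda>B1 B2. ?I B2 (wedge_act (R B2) (\<lambda>Y. H (Y # A) B1) X)) B) w"
      by (rule unshuffle_coassoc)
    also have "\<dots> = lunsh (\<lambda>A B. lunsh (\<lambda>B1 B2. signed (int (length B1) * int (length B2)) (?I B1 (wedge_act (R B1) (\<lambda>Y. H (Y # A) B2) X))) B) w"
      by (rule unshuffle_cong, subst unshuffle_cocomm) simp
    also have "\<dots> = lunsh (\<lambda>A B. lunsh (\<lambda>A1 A2. signed (int (length A2) * int (length B)) (?I A2 (wedge_act (R A2) (\<lambda>Y. H (Y # A1) B) X))) A) w"
      by (rule unshuffle_coassoc[symmetric])
    also have "\<dots> = lunsh (\<lambda>A B. signed (int r * int (length B)) (lunsh (\<lambda>A1 A2. ?I A2 (wedge_act (R A2) (\<lambda>Y. H (Y # A1) B) X)) A)) w"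
      unfolding unshuffle_signed[symmetric] by (auto intro!: unshuffle_cong)
    finally show ?thesis .
  qed
  have K2': "K2 = lunsh (\<lambda>A B. signed (int (length A)) (lunsh (\<lambda>B1 B2. ?I B2 (wedge_act (R B2) (\<lambda>Y. H A (Y # B1)) X)) B)) w"
  proof -
    have "K2 = lunsh (\<lambda>A B. lunsh (\<lambda>A1 A2. ?I B (signed (int (length A1)) (wedge_act (R B) (\<lambda>Y. H A1 (Y # A2)) X))) A) w"
      unfolding K2_def by (auto intro!: unshuffle_cong)
    also have "\<dots> = lunsh (\<lambda>A B. lunsh (\<lambda>B1 B2. ?I B2 (signed (int (length A)) (wedge_act (R B2) (\<lambda>Y. H A (Y # B1)) X))) B) w"
      by (rule unshuffle_coassoc)
    finally show ?thesis
      unfolding unshuffle_signed[symmetric] by (auto intro!: unshuffle_cong elim!: trans)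
  qed
  have R: "lunsh (\<lambda>A B. signed (int r * int (length B)) (coder r R (\<lambda>A'. H A' B) A)) (X # w)
   + lunsh (\<lambda>A B. coder r R (\<lambda>B'. H A B') B) (X # w)
   = (lunsh (\<lambda>A B. signed (int r * int (length B)) (coder r R (\<lambda>A'. H (X # A') B) A)) w + K1)
   + lunsh (\<lambda>A B. signed (int (length A)) (signed (int r * int (length (X # B))) (coder r R (\<lambda>A'. H A' (X # B)) A))) w
   + lunsh (\<lambda>A B. coder r R (\<lambda>B'. H (X # A) B') B) w
   + (lunsh (\<lambda>A B. signed (int (length A)) (coder r R (\<lambda>B'. H A (X # B')) B)) w + K2)"
    unfolding K1' K2' by (simp add: signed_add unshuffle_add add.assoc)
  show ?case
    unfolding L R IH2 Cons.IH by (simp add: algebra_simps)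
qed simp


section \<open>Convolution and the commutator of two coderivations\<close>

definition lconv :: "nat \<Rightarrow> (('w \<times> 'w) list \<Rightarrow> 'w \<Rightarrow> 'v) \<Rightarrow> (('w \<times> 'w) list \<Rightarrow> 'u \<Rightarrow> 'w) \<Rightarrow>
    ('w \<times> 'w) list \<Rightarrow> 'u \<Rightarrow> 'v::ab_group_add" where
  "lconv r P Q w = lunsh (\<lambda>A B. if length B = r then P A \<circ> Q B else 0) w"

definition biadd :: "('w::ab_group_add \<times> 'w \<Rightarrow> 'v::ab_group_add) \<Rightarrow> bool" where
  "biadd G \<longleftrightarrow> (\<forall>x. additive (\<lambda>y. G (x, y))) \<and> (\<forall>y. additive (\<lambda>x. G (x, y)))"

text \<open>Additivity in both entries of every letter is all that the pre-Lie identity uses.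
  Scalars and the alternating property come in when products are shown to be cochains again.\<close>

definition word_additive :: "(('w::ab_group_add \<times> 'w) list \<Rightarrow> 'v::ab_group_add) \<Rightarrow> bool" where
  "word_additive F \<longleftrightarrow> (\<forall>u v. biadd (\<lambda>X. F (u @ X # v)))"

lemma word_additiveD:
  assumes "word_additive F"
  shows "biadd (\<lambda>X. F (X # v))" "word_additive (\<lambda>u. F (X # u))"
proof -
  show "biadd (\<lambda>X. F (X # v))"
    using assms[unfolded word_additive_def, rule_format, of "[]" v] by simp
  show "word_additive (\<lambda>u. F (X # u))"
    using assms[unfolded word_additive_def, rule_format, of "X # _"] by (simp add: word_additive_def)
qed

lemma wedge_act_biadd_additive:
  assumes "biadd G"
  shows "additive (\<lambda>f. wedge_act f G X)"
  using assms by (simp add: biadd_def additive_def wedge_act_def)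

text \<open>The subtracted coderivation belongs to the second entry of the product of
  \<open>Q\<close> and \<open>R\<close>. It removes the terms in which one map acts on letters
  consumed by the other or on its output. What remains has \<open>Q\<close> and \<open>R\<close>
  acting independently, and there an exchange costs only the sign of degrees \<open>q\<close> and
  \<open>r\<close>.\<close>

lemma coder_coder_commute:
  assumes "word_additive F"
  shows "coder r R (coder q Q F) w
      - coder (q + r) (\<lambda>u. lconv r Q R u + coder r R Q u) F w
    = signed (int q * int r) (coder q Q (coder r R F) w
      - coder (q + r) (\<lambda>u. lconv q R Q u + coder q Q R u) F w)"
  using assms
proof (induction w arbitrary: F)
  case (Cons X w)
  \<comment> \<open>In the remainder, both maps act below the last letter, or exactly one acts on
    it, or they act on different entries of it. The parts that cancel are isolated in 2 to
    6.\<close>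
  have expand: "coder r R (coder q Q F) (X # w)
      - coder (q + r) (\<lambda>u. lconv r Q R u + coder r R Q u) F (X # w)
    = (coder r R (coder q Q (\<lambda>u. F (X # u))) w
      - coder (q + r) (\<lambda>u. lconv r Q R u + coder r R Q u) (\<lambda>u. F (X # u)) w)
    + (lunsh (\<lambda>A B. if length B = q then signed (int q * int r) (wedge_act (Q B) (\<lambda>Y. coder r R (\<lambda>u. F (Y # u)) A) X) else 0) w
      + lunsh (\<lambda>A B. if length B = r then wedge_act (R B) (\<lambda>Y. coder q Q (\<lambda>u. F (Y # u)) A) X else 0) w)
    + lunsh (\<lambda>A B. lunsh (\<lambda>B1 B2. if length B1 = q \<and> length B2 = r then
          F ((R B2 (fst X), Q B1 (snd X)) # A) + F ((Q B1 (fst X), R B2 (snd X)) # A) else 0) B) w"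
    if F: "word_additive F" for q r Q R and F
  proof -
    have add: "additive (\<lambda>f. wedge_act f (\<lambda>Y. F (Y # A)) X)" for A
      by (rule wedge_act_biadd_additive[OF word_additiveD(1)[OF F]])
    have 1: "coder r R (coder q Q F) (X # w)
      = coder r R (coder q Q (\<lambda>u. F (X # u))) w
      + coder r R (\<lambda>u. lunsh (\<lambda>A B. if length B = q then wedge_act (Q B) (\<lambda>Y. F (Y # A)) X else 0) u) w
      + lunsh (\<lambda>A B. if length B = r then wedge_act (R B) (\<lambda>Y. coder q Q (\<lambda>u. F (Y # u)) A) X else 0) w
      + lunsh (\<lambda>A B. if length B = r then wedge_act (R B)
          (\<lambda>Y. lunsh (\<lambda>A1 A2. if length A2 = q then wedge_act (Q A2) (\<lambda>Z. F (Z # A1)) Y else 0) A) X else 0) w"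
      by (simp add: coder_add wedge_act_add add.assoc flip: unshuffle_add)
         (auto intro!: unshuffle_cong simp: wedge_act_add)
    have 2: "coder r R (\<lambda>u. lunsh (\<lambda>A B. if length B = q then wedge_act (Q B) (\<lambda>Y. F (Y # A)) X else 0) u) w
      = lunsh (\<lambda>A B. if length B = q then signed (int q * int r) (wedge_act (Q B) (\<lambda>Y. coder r R (\<lambda>u. F (Y # u)) A) X) else 0) w
      + lunsh (\<lambda>A B. if length B = q + r then wedge_act (coder r R Q B) (\<lambda>Y. F (Y # A)) X else 0) w"
    proof -
      have a: "coder r R (\<lambda>B'. if length B' = q then wedge_act (Q B') (\<lambda>Y. F (Y # A)) X else 0) B
        = (if length B = q + r then wedge_act (coder r R Q B) (\<lambda>Y. F (Y # A)) X else 0)" for A B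
      proof (cases "length B = q + r")
        case True
        then have "coder r R (\<lambda>B'. if length B' = q then wedge_act (Q B') (\<lambda>Y. F (Y # A)) X else 0) B
          = coder r R (\<lambda>B'. wedge_act (Q B') (\<lambda>Y. F (Y # A)) X) B"
          by (intro coder_cong) auto
        then show ?thesis
          using True by (simp add: coder_additive[OF add])
      next
        case False
        then have "coder r R (\<lambda>B'. if length B' = q then wedge_act (Q B') (\<lambda>Y. F (Y # A)) X else 0) B
          = coder r R (\<lambda>B'. 0) B"
          by (intro coder_cong) auto
        then show ?thesis
          using False by simp
      qed
      show ?thesis
        unfolding coder_unshuffle a
        by (auto intro!: arg_cong2[where f="(+)"] unshuffle_cong simp: coder_if_zero coder_wedge_act mult.commute)
    qed
    have 3: "coder (q + r) (\<lambda>u. lconv r Q R u + coder r R Q u) F (X # w)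
      = coder (q + r) (\<lambda>u. lconv r Q R u + coder r R Q u) (\<lambda>u. F (X # u)) w
      + lunsh (\<lambda>A B. if length B = q + r then wedge_act (lconv r Q R B) (\<lambda>Y. F (Y # A)) X else 0) w
      + lunsh (\<lambda>A B. if length B = q + r then wedge_act (coder r R Q B) (\<lambda>Y. F (Y # A)) X else 0) w"
      by (simp add: additive.add[OF add] add.assoc flip: unshuffle_add)
         (auto intro!: unshuffle_cong simp: additive.add[OF add])
    have 4: "lunsh (\<lambda>A B. if length B = q + r then wedge_act (lconv r Q R B) (\<lambda>Y. F (Y # A)) X else 0) w
      = lunsh (\<lambda>A B. lunsh (\<lambda>B1 B2. if length B1 = q \<and> length B2 = r then
          wedge_act (Q B1 \<circ> R B2) (\<lambda>Y. F (Y # A)) X else 0) B) w"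
    proof (rule unshuffle_cong_length)
      fix A B
      show "(if length B = q + r then wedge_act (lconv r Q R B) (\<lambda>Y. F (Y # A)) X else 0)
        = lunsh (\<lambda>B1 B2. if length B1 = q \<and> length B2 = r then wedge_act (Q B1 \<circ> R B2) (\<lambda>Y. F (Y # A)) X else 0) B"
      proof (cases "length B = q + r")
        case True
        have "wedge_act (lconv r Q R B) (\<lambda>Y. F (Y # A)) X
          = lunsh (\<lambda>B1 B2. wedge_act (if length B2 = r then Q B1 \<circ> R B2 else 0) (\<lambda>Y. F (Y # A)) X) B"
          unfolding lconv_def by (rule unshuffle_additive[OF add])
        also have "\<dots> = lunsh (\<lambda>B1 B2. if length B1 = q \<and> length B2 = r then wedge_act (Q B1 \<circ> R B2) (\<lambda>Y. F (Y # A)) X else 0) B"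
          by (rule unshuffle_cong_length) (use True additive.zero[OF add] in auto)
        finally show ?thesis
          using True by simp
      next
        case False
        then have "lunsh (\<lambda>B1 B2. if length B1 = q \<and> length B2 = r then wedge_act (Q B1 \<circ> R B2) (\<lambda>Y. F (Y # A)) X else 0) B
          = lunsh (\<lambda>B1 B2. 0) B"
          by (intro unshuffle_cong_length) auto
        then show ?thesis
          using False by simp
      qed
    qed
    have 5: "lunsh (\<lambda>A B. if length B = r then wedge_act (R B)
          (\<lambda>Y. lunsh (\<lambda>A1 A2. if length A2 = q then wedge_act (Q A2) (\<lambda>Z. F (Z # A1)) Y else 0) A) X else 0) w
      = lunsh (\<lambda>A B. lunsh (\<lambda>B1 B2. if length B1 = q \<and> length B2 = r then
          wedge_act (R B2) (wedge_act (Q B1) (\<lambda>Z. F (Z # A))) X else 0) B) w"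
    proof -
      have "lunsh (\<lambda>A B. if length B = r then wedge_act (R B)
          (\<lambda>Y. lunsh (\<lambda>A1 A2. if length A2 = q then wedge_act (Q A2) (\<lambda>Z. F (Z # A1)) Y else 0) A) X else 0) w
        = lunsh (\<lambda>A B. lunsh (\<lambda>A1 A2. if length A2 = q \<and> length B = r then
          wedge_act (R B) (wedge_act (Q A2) (\<lambda>Z. F (Z # A1))) X else 0) A) w"
        by (rule unshuffle_cong) (auto simp: wedge_act_unshuffle intro!: unshuffle_cong)
      then show ?thesis
        by (simp only: unshuffle_coassoc)
    qed
    \<comment> \<open>Of the four terms, two put both maps on the same entry, composed as in
      \<open>lconv\<close>; the other two put them on different entries.\<close>
    have 6: "wedge_act (R B2) (wedge_act (Q B1) (\<lambda>Z. F (Z # A))) X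
      = wedge_act (Q B1 \<circ> R B2) (\<lambda>Y. F (Y # A)) X
      + (F ((R B2 (fst X), Q B1 (snd X)) # A) + F ((Q B1 (fst X), R B2 (snd X)) # A))" for A B1 B2
      by (simp add: wedge_act_def algebra_simps)
    have 7: "lunsh (\<lambda>A B. lunsh (\<lambda>B1 B2. if length B1 = q \<and> length B2 = r then
          wedge_act (R B2) (wedge_act (Q B1) (\<lambda>Z. F (Z # A))) X else 0) B) w
      = lunsh (\<lambda>A B. lunsh (\<lambda>B1 B2. if length B1 = q \<and> length B2 = r then
          wedge_act (Q B1 \<circ> R B2) (\<lambda>Y. F (Y # A)) X else 0) B) w
      + lunsh (\<lambda>A B. lunsh (\<lambda>B1 B2. if length B1 = q \<and> length B2 = r then
          F ((R B2 (fst X), Q B1 (snd X)) # A) + F ((Q B1 (fst X), R B2 (snd X)) # A) else 0) B) w"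
      unfolding unshuffle_add[symmetric]
      by (intro unshuffle_cong) (simp add: 6)
    show ?thesis
      unfolding 1 2 3 4 5 7 by (simp add: algebra_simps)
  qed
  \<comment> \<open>The mixed terms are symmetric in the two maps up to the sign of exchanging the
    words \<open>B1\<close> and \<open>B2\<close> that these maps consume.\<close>
  have swap: "lunsh (\<lambda>A B. lunsh (\<lambda>B1 B2. if length B1 = q \<and> length B2 = r then
          F ((R B2 (fst X), Q B1 (snd X)) # A) + F ((Q B1 (fst X), R B2 (snd X)) # A) else 0) B) w
    = signed (int q * int r) (lunsh (\<lambda>A B. lunsh (\<lambda>B1 B2. if length B1 = r \<and> length B2 = q then
          F ((Q B2 (fst X), R B1 (snd X)) # A) + F ((R B1 (fst X), Q B2 (snd X)) # A) else 0) B) w)"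
    unfolding unshuffle_signed[symmetric]
    by (rule unshuffle_cong, subst unshuffle_cocomm) (auto intro!: unshuffle_cong simp: algebra_simps)
  have sgif: "signed n (lunsh (\<lambda>A B. if length B = k then signed m (G A B) else 0) w)
    = lunsh (\<lambda>A B. if length B = k then signed (n + m) (G A B) else 0) w" for n m k and G :: "_ \<Rightarrow> _ \<Rightarrow> 'b"
    unfolding unshuffle_signed[symmetric] by (rule unshuffle_cong) simp
  have sgif0: "signed n (lunsh (\<lambda>A B. if length B = k then G A B else 0) w)
    = lunsh (\<lambda>A B. if length B = k then signed n (G A B) else 0) w" for n k and G :: "_ \<Rightarrow> _ \<Rightarrow> 'b"
    unfolding unshuffle_signed[symmetric] by (rule unshuffle_cong) simp
  have even_signed: "signed (int q * int r + int r * int q) x = x" for x :: 'b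
    by (simp add: signed_def)
  show ?case
    unfolding expand[OF Cons.prems] expand[OF Cons.prems, of q Q r R, unfolded add.commute[of r q]]
    unfolding Cons.IH[OF word_additiveD(2)[OF Cons.prems]] swap signed_add sgif sgif0 even_signed
    by (simp add: algebra_simps)
qed simp

section \<open>The half convolution and the laws linking it to convolution and coderivations\<close>

text \<open>The part of the convolution in which the last letter goes to the right factor.\<close>

primrec hconv :: "nat \<Rightarrow> (('w \<times> 'w) list \<Rightarrow> 'w \<Rightarrow> 'v) \<Rightarrow> (('w \<times> 'w) list \<Rightarrow> 'w) \<Rightarrow>
    ('w \<times> 'w) list \<Rightarrow> 'v::ab_group_add" where
  "hconv r P G [] = 0"
| "hconv r P G (X # w) =
     lunsh (\<lambda>A B. if Suc (length B) = r then signed (int (length A)) (P A (G (X # B))) else 0) w"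

lemma additive_comp_left:
  fixes f :: "'w::ab_group_add \<Rightarrow> 'v::ab_group_add"
  assumes "additive f"
  shows "additive (\<lambda>g :: 'u \<Rightarrow> 'w. f \<circ> g)"
  using assms by (auto simp: additive_def fun_eq_iff)

lemma additive_comp_right: "additive (\<lambda>f :: 'w \<Rightarrow> 'v::ab_group_add. f \<circ> g)"
  by (auto simp: additive_def fun_eq_iff)

lemma zero_comp [simp]: "(0 :: 'w \<Rightarrow> 'v::ab_group_add) \<circ> g = 0"
  by (auto simp: fun_eq_iff)

lemma signed_split_length:
  "length A + length B = length w \<Longrightarrow> signed (int (length w)) x = signed (int (length A) + int (length B)) x"
  by (metis of_nat_add)

lemma lconv_add_left: "lconv r (\<lambda>w. P w + P' w) Q w = lconv r P Q w + lconv r P' Q w"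
  unfolding lconv_def unshuffle_add[symmetric]
  by (rule unshuffle_cong) (auto simp: fun_eq_iff)

lemma lconv_add_right:
  assumes "\<And>A. additive (P A)"
  shows "lconv r P (\<lambda>w. Q w + Q' w) w = lconv r P Q w + lconv r P Q' w"
  unfolding lconv_def unshuffle_add[symmetric]
  by (rule unshuffle_cong) (auto simp: additive.add[OF additive_comp_left[OF assms]])

lemma hconv_add_left: "hconv r (\<lambda>w. P w + P' w) G w = hconv r P G w + hconv r P' G w"
proof (cases w)
  case (Cons X w')
  show ?thesis
    unfolding Cons hconv.simps unshuffle_add[symmetric]
    by (rule unshuffle_cong) (auto simp: signed_add)
qed simp

lemma hconv_add_right:
  assumes "\<And>A. additive (P A)"
  shows "hconv r P (\<lambda>w. G w + G' w) w = hconv r P G w + hconv r P G' w"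
proof (cases w)
  case (Cons X w')
  show ?thesis
    unfolding Cons hconv.simps unshuffle_add[symmetric]
    by (rule unshuffle_cong) (auto simp: signed_add additive.add[OF assms])
qed simp

text \<open>This is coassociativity of the splittings; additivity of \<open>P\<close> lets its
  composition pass through the inner sum.\<close>

lemma lconv_assoc:
  assumes "\<And>A. additive (P A)"
  shows "lconv r (lconv q P Q) R w = lconv (q + r) P (lconv r Q R) w"
proof -
  have "lconv r (lconv q P Q) R w
    = lunsh (\<lambda>A B. lunsh (\<lambda>A1 A2. if length A2 = q \<and> length B = r then P A1 \<circ> Q A2 \<circ> R B else 0) A) w"
    unfolding lconv_def
    by (rule unshuffle_cong) (auto intro!: unshuffle_cong simp: unshuffle_additive[OF additive_comp_right])
  also have "\<dots> = lunsh (\<lambda>A B. lunsh (\<lambda>B1 B2. if length B1 = q \<and> length B2 = r then P A \<circ> Q B1 \<circ> R B2 else 0) B) w"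
    by (rule unshuffle_coassoc)
  also have "\<dots> = lconv (q + r) P (lconv r Q R) w"
    unfolding lconv_def
  proof (rule unshuffle_cong_length)
    fix A B
    show "lunsh (\<lambda>B1 B2. if length B1 = q \<and> length B2 = r then P A \<circ> Q B1 \<circ> R B2 else 0) B =
      (if length B = q + r then P A \<circ> lunsh (\<lambda>B1 B2. if length B2 = r then Q B1 \<circ> R B2 else 0) B else 0)"
    proof (cases "length B = q + r")
      case True
      then show ?thesis
        by (auto intro!: unshuffle_cong_length simp: unshuffle_additive[OF additive_comp_left[OF assms]]
            additive.zero[OF additive_comp_left[OF assms]] comp_assoc)
    next
      case False
      then have "lunsh (\<lambda>B1 B2. if length B1 = q \<and> length B2 = r then P A \<circ> Q B1 \<circ> R B2 else 0) B
        = lunsh (\<lambda>B1 B2. 0) B"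
        by (intro unshuffle_cong_length) auto
      then show ?thesis
        using False by simp
    qed
  qed
  finally show ?thesis .
qed

text \<open>The shift \<open>k\<close> is 0 for the convolution and 1 for the half convolution,
  whose last letter is held apart from \<open>B\<close>.\<close>

lemma coder_guarded:
  "coder r R (\<lambda>B'. if length B' + k = q then F B' else 0) B
   = (if length B + k = q + r then coder r R F B else 0)"
proof (cases "length B + k = q + r")
  case True
  then have "coder r R (\<lambda>B'. if length B' + k = q then F B' else 0) B = coder r R F B"
    by (intro coder_cong) auto
  then show ?thesis
    using True by simp
next
  case False
  then have "coder r R (\<lambda>B'. if length B' + k = q then F B' else 0) B = coder r R (\<lambda>B'. 0) B"
    by (intro coder_cong) auto
  then show ?thesis
    using False by simp
qed

text \<open>Dually to \<open>coder_unshuffle\<close>, a coderivation gives a graded derivation of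
  the convolution; reaching the left factor means passing \<open>Q\<close>, of degree
  \<open>q\<close>.\<close>

lemma coder_lconv:
  assumes "\<And>A. additive (P A)"
  shows "coder r R (lconv q P Q) w
    = signed (int q * int r) (lconv q (coder r R P) Q w) + lconv (q + r) P (coder r R Q) w"
proof -
  have "coder r R (lconv q P Q) w
    = coder r R (\<lambda>u. lunsh (\<lambda>A B. if length B + 0 = q then P A \<circ> Q B else 0) u) w"
    by (rule coder_cong) (simp add: lconv_def)
  also have "\<dots> = lunsh (\<lambda>A B. signed (int q * int r) (if length B = q then coder r R P A \<circ> Q B else 0)) w
    + lconv (q + r) P (coder r R Q) w"
    unfolding coder_unshuffle coder_guarded lconv_def
    by (auto intro!: arg_cong2[where f="(+)"] unshuffle_cong signed_cong
        simp: coder_if_zero coder_additive[OF additive_comp_right] coder_additive[OF additive_comp_left[OF assms]])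
  finally show ?thesis
    by (simp add: lconv_def unshuffle_signed)
qed

text \<open>The last letter stays with \<open>G\<close> on both sides; the remaining letters are
  distributed over three factors, so coassociativity applies. This is one of the axioms relating the
  halves of a dendriform product.\<close>

lemma hconv_assoc:
  assumes "\<And>A. additive (P A)"
  shows "hconv r (lconv q P Q) G w = hconv (q + r) P (hconv r Q G) w"
proof (cases w)
  case (Cons X v)
  have "hconv r (lconv q P Q) G (X # v)
    = lunsh (\<lambda>A B. lunsh (\<lambda>A1 A2. if length A2 = q \<and> Suc (length B) = r
        then signed (int (length A1) + int (length A2)) (P A1 (Q A2 (G (X # B)))) else 0) A) v"
    unfolding hconv.simps
  proof (rule unshuffle_cong_length)
    fix A B
    show "(if Suc (length B) = r then signed (int (length A)) (lconv q P Q A (G (X # B))) else 0)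
      = lunsh (\<lambda>A1 A2. if length A2 = q \<and> Suc (length B) = r
        then signed (int (length A1) + int (length A2)) (P A1 (Q A2 (G (X # B)))) else 0) A"
      unfolding lconv_def
      by (auto intro!: unshuffle_cong_length simp: unshuffle_apply signed_split_length simp flip: unshuffle_signed)
  qed
  also have "\<dots> = lunsh (\<lambda>A B. lunsh (\<lambda>B1 B2. if length B1 = q \<and> Suc (length B2) = r
        then signed (int (length A) + int (length B1)) (P A (Q B1 (G (X # B2)))) else 0) B) v"
    by (rule unshuffle_coassoc)
  also have "\<dots> = hconv (q + r) P (hconv r Q G) (X # v)"
    unfolding hconv.simps
  proof (rule unshuffle_cong_length)
    fix A B
    show "lunsh (\<lambda>B1 B2. if length B1 = q \<and> Suc (length B2) = r
        then signed (int (length A) + int (length B1)) (P A (Q B1 (G (X # B2)))) else 0) B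
      = (if Suc (length B) = q + r then signed (int (length A)) (P A (lunsh (\<lambda>B1 B2.
          if Suc (length B2) = r then signed (int (length B1)) (Q B1 (G (X # B2))) else 0) B)) else 0)"
    proof (cases "Suc (length B) = q + r")
      case True
      then show ?thesis
        by (auto intro!: unshuffle_cong_length simp: unshuffle_additive[OF assms]
            additive.zero[OF assms] additive_signed[OF assms] simp flip: unshuffle_signed)
    next
      case False
      then have "lunsh (\<lambda>B1 B2. if length B1 = q \<and> Suc (length B2) = r
        then signed (int (length A) + int (length B1)) (P A (Q B1 (G (X # B2)))) else 0) B
        = lunsh (\<lambda>B1 B2. 0) B"
        by (intro unshuffle_cong_length) auto
      then show ?thesis
        using False by simp
    qed
  qed
  finally show ?thesis
    by (simp only: Cons)
qed simp

text \<open>When \<open>R\<close> acts on an earlier letter, \<open>coder_unshuffle\<close> applies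
  to the word without its last letter (1). When \<open>R\<close> acts on the last letter, it acts
  inside \<open>G\<close>, because that letter belongs to \<open>G\<close>, and so contributes to
  the second summand alone (2).\<close>

lemma coder_hconv:
  assumes "\<And>A. additive (P A)"
  shows "coder r R (hconv q P G) w
    = signed (int q * int r) (hconv q (coder r R P) G w) + hconv (q + r) P (coder r R G) w"
proof (cases w)
  case (Cons X v)
  have add: "additive (\<lambda>y. signed n (P A y))" for n A
    using additive.add[OF assms] by (simp add: additive_def signed_add)
  have 1: "coder r R (\<lambda>u. hconv q P G (X # u)) v
    = signed (int q * int r) (hconv q (coder r R P) G (X # v))
    + lunsh (\<lambda>A B. if Suc (length B) = q + r then signed (int (length A)) (P A (coder r R (\<lambda>u. G (X # u)) B)) else 0) v"
  proof -
    have *: "coder r R (\<lambda>A'. signed (int (length A')) (P A' y)) A = signed (int (length A) + int r) (coder r R P A y)" for A y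
      unfolding coder_apply coder_signed[symmetric]
    proof (rule coder_cong)
      fix u :: "('a \<times> 'a) list"
      assume "length u + r = length A"
      then have "int (length A) = int (length u) + int r"
        by simp
      then show "signed (int (length u)) (P u y) = signed (int (length A) + int r) (P u y)"
        by (intro signed_cong) simp
    qed
    have "coder r R (\<lambda>u. hconv q P G (X # u)) v
      = coder r R (\<lambda>u. lunsh (\<lambda>A B. if length B + 1 = q then signed (int (length A)) (P A (G (X # B))) else 0) u) v"
      by simp
    also have "\<dots> = lunsh (\<lambda>A B. signed (int q * int r) (if Suc (length B) = q then signed (int (length A)) (coder r R P A (G (X # B))) else 0)) v
      + lunsh (\<lambda>A B. if Suc (length B) = q + r then signed (int (length A)) (P A (coder r R (\<lambda>u. G (X # u)) B)) else 0) v"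
      unfolding coder_unshuffle coder_guarded
      by (auto intro!: arg_cong2[where f="(+)"] unshuffle_cong signed_cong
          simp: coder_if_zero * coder_additive[OF add])
    finally show ?thesis
      by (simp add: unshuffle_signed)
  qed
  have 2: "lunsh (\<lambda>A B. if length B = r then wedge_act (R B) (\<lambda>Y. hconv q P G (Y # A)) X else 0) v
    = lunsh (\<lambda>A B. if Suc (length B) = q + r then signed (int (length A)) (P A
        (lunsh (\<lambda>B1 B2. if length B2 = r then wedge_act (R B2) (\<lambda>Y. G (Y # B1)) X else 0) B)) else 0) v"
  proof -
    have "lunsh (\<lambda>A B. if length B = r then wedge_act (R B) (\<lambda>Y. hconv q P G (Y # A)) X else 0) v
      = lunsh (\<lambda>A B. lunsh (\<lambda>A1 A2. if Suc (length A2) = q \<and> length B = r then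
          signed (int (length A1)) (P A1 (wedge_act (R B) (\<lambda>Y. G (Y # A2)) X)) else 0) A) v"
      by (rule unshuffle_cong)
         (auto simp: wedge_act_unshuffle wedge_act_additive[OF assms] wedge_act_signed intro!: unshuffle_cong)
    also have "\<dots> = lunsh (\<lambda>A B. lunsh (\<lambda>B1 B2. if Suc (length B1) = q \<and> length B2 = r then
          signed (int (length A)) (P A (wedge_act (R B2) (\<lambda>Y. G (Y # B1)) X)) else 0) B) v"
      by (rule unshuffle_coassoc)
    also have "\<dots> = lunsh (\<lambda>A B. if Suc (length B) = q + r then signed (int (length A)) (P A
        (lunsh (\<lambda>B1 B2. if length B2 = r then wedge_act (R B2) (\<lambda>Y. G (Y # B1)) X else 0) B)) else 0) v"
    proof (rule unshuffle_cong_length)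
      fix A B
      show "lunsh (\<lambda>B1 B2. if Suc (length B1) = q \<and> length B2 = r then
          signed (int (length A)) (P A (wedge_act (R B2) (\<lambda>Y. G (Y # B1)) X)) else 0) B
        = (if Suc (length B) = q + r then signed (int (length A)) (P A
        (lunsh (\<lambda>B1 B2. if length B2 = r then wedge_act (R B2) (\<lambda>Y. G (Y # B1)) X else 0) B)) else 0)"
      proof (cases "Suc (length B) = q + r")
        case True
        then show ?thesis
          by (auto intro!: unshuffle_cong_length simp: unshuffle_additive[OF assms]
              additive.zero[OF assms] simp flip: unshuffle_signed)
      next
        case False
        then have "lunsh (\<lambda>B1 B2. if Suc (length B1) = q \<and> length B2 = r then
          signed (int (length A)) (P A (wedge_act (R B2) (\<lambda>Y. G (Y # B1)) X)) else 0) B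
          = lunsh (\<lambda>B1 B2. 0) B"
          by (intro unshuffle_cong_length) auto
        then show ?thesis
          using False by simp
      qed
    qed
    finally show ?thesis .
  qed
  have 3: "hconv (q + r) P (coder r R G) (X # v)
    = lunsh (\<lambda>A B. if Suc (length B) = q + r then signed (int (length A)) (P A (coder r R (\<lambda>u. G (X # u)) B)) else 0) v
    + lunsh (\<lambda>A B. if Suc (length B) = q + r then signed (int (length A)) (P A
        (lunsh (\<lambda>B1 B2. if length B2 = r then wedge_act (R B2) (\<lambda>Y. G (Y # B1)) X else 0) B)) else 0) v"
    unfolding hconv.simps unshuffle_add[symmetric]
    by (rule unshuffle_cong) (simp add: additive.add[OF assms] signed_add)
  show ?thesis
    unfolding Cons 3 coder.simps 1 2 by (simp add: add.assoc)
qed simp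

section \<open>The graded pre-Lie identity\<close>

type_synonym 'w wcochain = "(('w \<times> 'w) list \<Rightarrow> 'w) \<times> (('w \<times> 'w) list \<Rightarrow> 'w \<Rightarrow> 'w)"

definition wdiamond :: "nat \<Rightarrow> 'w wcochain \<Rightarrow> 'w wcochain \<Rightarrow> ('w::ab_group_add) wcochain" where
  "wdiamond q P Q =
     (\<lambda>w. coder q (snd Q) (fst P) w + hconv q (snd P) (fst Q) w,
      \<lambda>w. lconv q (snd P) (snd Q) w + coder q (snd Q) (snd P) w)"

definition wadditive :: "('w::ab_group_add) wcochain \<Rightarrow> bool" where
  "wadditive P \<longleftrightarrow> word_additive (fst P) \<and> word_additive (snd P) \<and> (\<forall>w. additive (snd P w))"

definition wassociator :: "nat \<Rightarrow> nat \<Rightarrow> 'w wcochain \<Rightarrow> 'w wcochain \<Rightarrow> 'w wcochain \<Rightarrow> ('w::ab_group_add) wcochain" where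
  "wassociator q r P Q R = wdiamond r (wdiamond q P Q) R - wdiamond (q + r) P (wdiamond r Q R)"

text \<open>The associativity and derivation laws cancel all terms in which \<open>P\<close> is
  composed with a combination of \<open>Q\<close> and \<open>R\<close>. The rest is the term where
  \<open>Q\<close> acts inside \<open>P\<close> and \<open>R\<close> is composed with it, the same
  with the roles exchanged, and the difference of coderivations treated in
  \<open>coder_coder_commute\<close>. Each is graded symmetric.\<close>

lemma wassociator_sym:
  assumes P: "wadditive P" and Q: "wadditive Q" and R: "wadditive R"
  shows "wassociator q r P Q R = signed (int q * int r) (wassociator r q P R Q)"
proof -
  have add: "\<And>A. additive (snd P A)"
    using P by (simp add: wadditive_def)
  have expand1: "fst (wassociator q r P Q R) w
    = (hconv r (coder q (snd Q) (snd P)) (fst R) w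
      + signed (int q * int r) (hconv q (coder r (snd R) (snd P)) (fst Q) w))
    + (coder r (snd R) (coder q (snd Q) (fst P)) w
      - coder (q + r) (\<lambda>u. lconv r (snd Q) (snd R) u + coder r (snd R) (snd Q) u) (fst P) w)" for q r Q R w
    by (simp add: wassociator_def wdiamond_def coder_add hconv_add_left hconv_add_right[OF add]
        hconv_assoc[OF add] coder_hconv[OF add, unfolded fun_eq_iff] algebra_simps)
  have expand2: "snd (wassociator q r P Q R) w
    = (lconv r (coder q (snd Q) (snd P)) (snd R) w
      + signed (int q * int r) (lconv q (coder r (snd R) (snd P)) (snd Q) w))
    + (coder r (snd R) (coder q (snd Q) (snd P)) w
      - coder (q + r) (\<lambda>u. lconv r (snd Q) (snd R) u + coder r (snd R) (snd Q) u) (snd P) w)" for q r Q R w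
    by (simp add: wassociator_def wdiamond_def coder_add lconv_add_left lconv_add_right[OF add]
        lconv_assoc[OF add] coder_lconv[OF add] algebra_simps)
  have "fst (wassociator q r P Q R) w = signed (int q * int r) (fst (wassociator r q P R Q) w)" for w
    unfolding expand1 signed_add
    using coder_coder_commute[of "fst P" r "snd R" q "snd Q" w] P
    by (simp add: wadditive_def add.commute mult.commute) (simp add: signed_def)
  moreover have "snd (wassociator q r P Q R) w = signed (int q * int r) (snd (wassociator r q P R Q) w)" for w
    unfolding expand2 signed_add
    using coder_coder_commute[of "snd P" r "snd R" q "snd Q" w] P
    by (simp add: wadditive_def add.commute mult.commute) (simp add: signed_def)
  ultimately show ?thesis
    by (auto simp: prod_eq_iff fun_eq_iff signed_def)
qed

section \<open>Shuffle permutations\<close>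

text \<open>The exponent of the Koszul sign. As an integer sum over inversions it changes additively
  when a last position is added; with all degrees 1 it counts inversions.\<close>

definition inversion_exponent :: "int list \<Rightarrow> (nat \<Rightarrow> nat) \<Rightarrow> int" where
  "inversion_exponent ds \<sigma> =
     (\<Sum>(i, j) \<in> {(i, j). i < j \<and> j < length ds \<and> \<sigma> j < \<sigma> i}. ds ! \<sigma> i * ds ! \<sigma> j)"

lemma minus_one_powi: "(- 1 :: 'k::field) powi k = (if even k then 1 else - 1)"
  by (auto simp: power_int_def even_nat_iff)

lemma signed_eq_scale:
  fixes sc :: "'k::field \<Rightarrow> 'v::ab_group_add \<Rightarrow> 'v"
  assumes "module sc"
  shows "sc ((- 1) powi k) x = signed k x"
  using module.scale_one[OF assms] module.scale_minus_left[OF assms]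
  by (simp add: minus_one_powi signed_def)

lemma koszul_sign_eq: "koszul_sign ds \<sigma> = (- 1 :: 'k::field) powi (inversion_exponent ds \<sigma>)"
proof -
  let ?I = "{(i, j). i < j \<and> j < length ds \<and> \<sigma> j < \<sigma> i}"
  have "finite ?I"
    by (rule finite_subset[of _ "{..<length ds} \<times> {..<length ds}"]) auto
  then have "(\<Prod>x\<in>?I. (- 1 :: 'k) powi (case x of (i, j) \<Rightarrow> ds ! \<sigma> i * ds ! \<sigma> j))
    = (- 1) powi (\<Sum>x\<in>?I. case x of (i, j) \<Rightarrow> ds ! \<sigma> i * ds ! \<sigma> j)"
    by (induction rule: finite_induct) (simp_all add: power_int_add)
  then show ?thesis
    by (simp add: koszul_sign_def inversion_exponent_def case_prod_unfold)
qed

text \<open>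
  A shuffle of \<open>Suc n\<close> positions either fixes \<open>n\<close> or arises from a shuffle of \<open>n\<close> positions by moving
  the last value \<open>n\<close> to the end of the first block.
\<close>

definition move_last :: "nat \<Rightarrow> nat \<Rightarrow> nat \<Rightarrow> nat" where
  "move_last a n j = (if j < a \<or> n < j then j else if j = a then n else j - 1)"

lemma move_last_permutes:
  assumes "a \<le> n"
  shows "move_last a n permutes {..<Suc n}"
proof (rule bij_imp_permutes)
  show "bij_betw (move_last a n) {..<Suc n} {..<Suc n}"
    by (rule bij_betw_byWitness[where f' = "\<lambda>j. if j < a then j else if j = n then a else Suc j"])
       (use assms in \<open>auto simp: move_last_def\<close>)
qed (use assms in \<open>auto simp: move_last_def\<close>)

lemma move_last_refl: "move_last n n = id"
  by (auto simp: move_last_def fun_eq_iff)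

text \<open>The cycle is a product of \<open>n - a\<close> adjacent transpositions, split off one at
  a time while \<open>a\<close> decreases from \<open>n\<close>.\<close>

lemma sign_move_last:
  assumes "a \<le> n"
  shows "sign (move_last a n) = (- 1) ^ (n - a)"
  using assms
proof (induction rule: inc_induct)
  case base
  show ?case by (simp add: move_last_refl sign_id)
next
  case (step m)
  have eq: "move_last m n = move_last (Suc m) n \<circ> Transposition.transpose m (Suc m)"
    using step.hyps by (auto simp: fun_eq_iff move_last_def Transposition.transpose_def)
  have "permutation (move_last (Suc m) n)"
    using move_last_permutes[of "Suc m" n] step.hyps by (auto simp: permutation_permutes)
  then have "sign (move_last m n) = - sign (move_last (Suc m) n)"
    unfolding eq by (simp add: sign_compose permutation_swap_id sign_swap_id)
  also have "\<dots> = (- 1) ^ (n - m)"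
    using step by (simp add: Suc_diff_Suc[symmetric])
  finally show ?case .
qed

lemma shuffle_perms_fix_last:
  "{\<sigma> \<in> shuffle_perms a (Suc b). \<sigma> (a + b) = a + b} = shuffle_perms a b"
proof (intro equalityI subsetI)
  fix \<sigma>
  assume "\<sigma> \<in> {\<sigma> \<in> shuffle_perms a (Suc b). \<sigma> (a + b) = a + b}"
  then have \<sigma>: "\<sigma> permutes {..<Suc (a + b)}" "strict_mono_on {..<a} \<sigma>"
      "strict_mono_on {a..<Suc (a + b)} \<sigma>" "\<sigma> (a + b) = a + b"
    by (auto simp: shuffle_perms_def)
  have "\<sigma> permutes {..<a + b}"
    by (rule permutes_superset[OF \<sigma>(1)]) (use \<sigma>(4) in \<open>auto simp: less_Suc_eq\<close>)
  then show "\<sigma> \<in> shuffle_perms a b"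
    using \<sigma>(2) monotone_on_subset[OF \<sigma>(3), of "{a..<a + b}"] by (auto simp: shuffle_perms_def)
next
  fix \<sigma>
  assume "\<sigma> \<in> shuffle_perms a b"
  then have \<sigma>: "\<sigma> permutes {..<a + b}" "strict_mono_on {..<a} \<sigma>" "strict_mono_on {a..<a + b} \<sigma>"
    by (auto simp: shuffle_perms_def)
  have last: "\<sigma> (a + b) = a + b"
    using \<sigma>(1) by (simp add: permutes_def)
  have "\<sigma> permutes {..<Suc (a + b)}"
    by (rule permutes_subset[OF \<sigma>(1)]) auto
  moreover have "strict_mono_on {a..<a + Suc b} \<sigma>"
  proof (rule strict_mono_onI)
    fix i j
    assume ij: "i \<in> {a..<a + Suc b}" "j \<in> {a..<a + Suc b}" "i < j"
    show "\<sigma> i < \<sigma> j"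
    proof (cases "j = a + b")
      case True
      then have "\<sigma> i \<in> {..<a + b}"
        using ij permutes_in_image[OF \<sigma>(1), of i] by auto
      then show ?thesis
        using True last by auto
    next
      case False
      then show ?thesis
        using ij \<sigma>(3) by (auto simp: strict_mono_on_def)
    qed
  qed
  ultimately show "\<sigma> \<in> {\<sigma> \<in> shuffle_perms a (Suc b). \<sigma> (a + b) = a + b}"
    using \<sigma>(2) last by (auto simp: shuffle_perms_def)
qed

lemma shuffle_perms_move_last:
  "bij_betw (\<lambda>\<sigma>. \<sigma> \<circ> move_last a (a + b)) (shuffle_perms a b)
     {\<sigma> \<in> shuffle_perms (Suc a) b. \<sigma> a = a + b}"
proof (rule bij_betw_byWitness[where f' = "\<lambda>\<sigma>. \<sigma> \<circ> inv (move_last a (a + b))"])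
  let ?c = "move_last a (a + b)"
  have c: "?c permutes {..<Suc (a + b)}"
    by (rule move_last_permutes) simp
  show "\<forall>\<sigma>\<in>shuffle_perms a b. \<sigma> \<circ> ?c \<circ> inv ?c = \<sigma>"
    using permutes_inv_o(1)[OF c] by (auto simp: comp_assoc)
  show "\<forall>\<sigma>\<in>{\<sigma> \<in> shuffle_perms (Suc a) b. \<sigma> a = a + b}. \<sigma> \<circ> inv ?c \<circ> ?c = \<sigma>"
    using permutes_inv_o(2)[OF c] by (auto simp: comp_assoc)
  show "(\<lambda>\<sigma>. \<sigma> \<circ> ?c) ` shuffle_perms a b \<subseteq> {\<sigma> \<in> shuffle_perms (Suc a) b. \<sigma> a = a + b}"
  proof (intro subsetI, elim imageE, simp only:)
    fix \<sigma>
    assume "\<sigma> \<in> shuffle_perms a b"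
    then have \<sigma>: "\<sigma> permutes {..<a + b}" "strict_mono_on {..<a} \<sigma>" "strict_mono_on {a..<a + b} \<sigma>"
      by (auto simp: shuffle_perms_def)
    have last: "\<sigma> (a + b) = a + b"
      using \<sigma>(1) by (simp add: permutes_def)
    have less: "\<sigma> i < a + b" if "i < a + b" for i
      using that permutes_in_image[OF \<sigma>(1), of i] by auto
    have "\<sigma> \<circ> ?c permutes {..<Suc (a + b)}"
      by (rule permutes_compose[OF c permutes_subset[OF \<sigma>(1)]]) auto
    moreover have "strict_mono_on {..<Suc a} (\<sigma> \<circ> ?c)"
      using \<sigma>(2) last less by (auto simp: strict_mono_on_def move_last_def less_Suc_eq)
    moreover have "strict_mono_on {Suc a..<Suc a + b} (\<sigma> \<circ> ?c)"
    proof (rule strict_mono_onI)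
      fix i j
      assume "i \<in> {Suc a..<Suc a + b}" "j \<in> {Suc a..<Suc a + b}" "i < j"
      then show "(\<sigma> \<circ> ?c) i < (\<sigma> \<circ> ?c) j"
        using strict_mono_onD[OF \<sigma>(3), of "i - 1" "j - 1"] by (auto simp: move_last_def)
    qed
    ultimately show "\<sigma> \<circ> ?c \<in> {\<sigma> \<in> shuffle_perms (Suc a) b. \<sigma> a = a + b}"
      using last by (auto simp: shuffle_perms_def move_last_def)
  qed
  show "(\<lambda>\<sigma>. \<sigma> \<circ> inv ?c) ` {\<sigma> \<in> shuffle_perms (Suc a) b. \<sigma> a = a + b} \<subseteq> shuffle_perms a b"
  proof (intro subsetI, elim imageE, simp only:)
    fix \<sigma>
    assume "\<sigma> \<in> {\<sigma> \<in> shuffle_perms (Suc a) b. \<sigma> a = a + b}"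
    then have \<sigma>: "\<sigma> permutes {..<Suc (a + b)}" "strict_mono_on {..<Suc a} \<sigma>"
        "strict_mono_on {Suc a..<Suc (a + b)} \<sigma>" "\<sigma> a = a + b"
      by (auto simp: shuffle_perms_def)
    have inv: "inv ?c y = x" if "?c x = y" for x y
      using that c by (metis permutes_inverses(2))
    have inv_low: "inv ?c i = i" if "i < a" for i
      by (rule inv) (use that in \<open>simp add: move_last_def\<close>)
    have inv_mid: "inv ?c i = Suc i" if "a \<le> i" "i < a + b" for i
      by (rule inv) (use that in \<open>simp add: move_last_def\<close>)
    have inv_last: "inv ?c (a + b) = a"
      by (rule inv) (simp add: move_last_def)
    have "\<sigma> \<circ> inv ?c permutes {..<Suc (a + b)}"
      by (rule permutes_compose[OF permutes_inv[OF c] \<sigma>(1)])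
    then have "\<sigma> \<circ> inv ?c permutes {..<a + b}"
      by (rule permutes_superset) (use inv_last \<sigma>(4) in \<open>auto simp: less_Suc_eq\<close>)
    moreover have "strict_mono_on {..<a} (\<sigma> \<circ> inv ?c)"
      using \<sigma>(2) by (auto simp: strict_mono_on_def inv_low)
    moreover have "strict_mono_on {a..<a + b} (\<sigma> \<circ> inv ?c)"
      using \<sigma>(3) by (auto simp: strict_mono_on_def inv_mid)
    ultimately show "\<sigma> \<circ> inv ?c \<in> shuffle_perms a b"
      by (auto simp: shuffle_perms_def)
  qed
qed

text \<open>A shuffle increases on each block, so its largest value sits at the end of one of
  them.\<close>

lemma shuffle_perms_last_cases:
  assumes \<sigma>: "\<sigma> \<in> shuffle_perms a b" and n: "a + b = Suc n"
  shows "(b > 0 \<and> \<sigma> n = n) \<or> (a > 0 \<and> \<sigma> (a - 1) = n)"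
proof -
  have perm: "\<sigma> permutes {..<Suc n}" and mono: "strict_mono_on {..<a} \<sigma>" "strict_mono_on {a..<Suc n} \<sigma>"
    using assms by (auto simp: shuffle_perms_def)
  obtain j where j: "j < Suc n" "\<sigma> j = n"
    using permutes_image[OF perm] by (metis imageE lessI lessThan_iff)
  have le: "\<sigma> i \<le> n" if "i < Suc n" for i
    using that permutes_in_image[OF perm, of i] by auto
  show ?thesis
  proof (cases "j < a")
    case True
    have "a - 1 < Suc n"
      using True n by simp
    then have "\<not> j < a - 1"
      using strict_mono_onD[OF mono(1), of j "a - 1"] True j le[of "a - 1"] n by auto
    then have "a > 0" "a - 1 = j"
      using True by simp_all
    then show ?thesis
      using j(2) by simp
  next
    case False
    have "\<not> j < n"
      using strict_mono_onD[OF mono(2), of j n] False j le[of n] n by auto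
    then show ?thesis
      using False j n by (auto simp: less_Suc_eq)
  qed
qed

lemma finite_shuffle_perms: "finite (shuffle_perms a b)"
  by (rule finite_subset[of _ "{\<sigma>. \<sigma> permutes {..<a + b}}"])
     (auto simp: shuffle_perms_def finite_permutations)

lemma shuffle_perms_empty: "shuffle_perms 0 0 = {id}"
  by (auto simp: shuffle_perms_def permutes_empty)

lemma sum_shuffle_perms:
  assumes n: "a + b = Suc n"
  shows "(\<Sum>\<sigma>\<in>shuffle_perms a b. G \<sigma>)
    = (if b > 0 then \<Sum>\<sigma>\<in>shuffle_perms a (b - 1). G \<sigma> else 0)
    + (if a > 0 then \<Sum>\<sigma>\<in>shuffle_perms (a - 1) b. G (\<sigma> \<circ> move_last (a - 1) n) else 0)"
proof -
  let ?S1 = "{\<sigma> \<in> shuffle_perms a b. b > 0 \<and> \<sigma> n = n}"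
  let ?S2 = "{\<sigma> \<in> shuffle_perms a b. a > 0 \<and> \<sigma> (a - 1) = n}"
  have "shuffle_perms a b = ?S1 \<union> ?S2"
    using shuffle_perms_last_cases[OF _ n] by auto
  moreover have "?S1 \<inter> ?S2 = {}"
  proof -
    have False if "\<sigma> \<in> shuffle_perms a b" "b > 0" "\<sigma> n = n" "a > 0" "\<sigma> (a - 1) = n" for \<sigma>
    proof -
      have "inj \<sigma>"
        using that(1) permutes_inj by (auto simp: shuffle_perms_def)
      then have "n = a - 1"
        using that by (metis injD)
      then show False
        using that n by simp
    qed
    then show ?thesis by blast
  qed
  ultimately have "sum G (shuffle_perms a b) = sum G ?S1 + sum G ?S2"
    using finite_shuffle_perms[of a b] by (metis (no_types, lifting) finite_Un sum.union_disjoint)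
  moreover have "sum G ?S1 = (if b > 0 then \<Sum>\<sigma>\<in>shuffle_perms a (b - 1). G \<sigma> else 0)"
  proof (cases b)
    case (Suc b')
    then have "?S1 = shuffle_perms a b'"
      using shuffle_perms_fix_last[of a b'] n by auto
    then show ?thesis
      using Suc by simp
  qed simp
  moreover have "sum G ?S2 = (if a > 0 then \<Sum>\<sigma>\<in>shuffle_perms (a - 1) b. G (\<sigma> \<circ> move_last (a - 1) n) else 0)"
  proof (cases a)
    case (Suc a')
    then have "?S2 = {\<sigma> \<in> shuffle_perms (Suc a') b. \<sigma> a' = a' + b}" and "n = a' + b"
      using n by auto
    then show ?thesis
      using Suc sum.reindex_bij_betw[OF shuffle_perms_move_last[of a' b], of G] by simp
  qed simp
  ultimately show ?thesis by simp
qed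

lemma inversion_exponent_fix_last:
  assumes "\<sigma> permutes {..<length ds}"
  shows "inversion_exponent (ds @ [x]) \<sigma> = inversion_exponent ds \<sigma>"
proof -
  have less: "\<sigma> i < length ds" if "i < length ds" for i
    using that permutes_in_image[OF assms, of i] by auto
  have last: "\<sigma> (length ds) = length ds"
    using assms by (simp add: permutes_def)
  have eq: "{(i, j). i < j \<and> j < length (ds @ [x]) \<and> \<sigma> j < \<sigma> i} = {(i, j). i < j \<and> j < length ds \<and> \<sigma> j < \<sigma> i}"
  proof (intro Collect_cong prod.case_cong refl)
    fix i j
    have "\<not> \<sigma> j < \<sigma> i" if "i < j" "j = length ds"
      using that less[of i] last by simp
    then show "(i < j \<and> j < length (ds @ [x]) \<and> \<sigma> j < \<sigma> i) = (i < j \<and> j < length ds \<and> \<sigma> j < \<sigma> i)"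
      by (auto simp: less_Suc_eq)
  qed
  have "(ds @ [x]) ! \<sigma> i = ds ! \<sigma> i" if "i < length ds" for i
    using less[OF that] by (simp add: nth_append)
  then show ?thesis
    unfolding inversion_exponent_def eq by (intro sum.cong refl) auto
qed

text \<open>Old inversions persist at shifted positions. The new ones pair the largest value, now at
  the end of the first block, with each position of the second block.\<close>

lemma inversion_exponent_move_last:
  assumes \<sigma>: "\<sigma> permutes {..<length ds}" and a: "a \<le> length ds"
  shows "inversion_exponent (ds @ [x]) (\<sigma> \<circ> move_last a (length ds))
    = inversion_exponent ds \<sigma> + x * (\<Sum>j\<in>{a..<length ds}. ds ! \<sigma> j)"
proof -
  let ?n = "length ds"
  let ?c = "move_last a ?n"
  \<comment> \<open>Position of an old index once the position \<open>a\<close> has been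
    inserted.\<close>
  let ?t = "\<lambda>j. if j < a then j else Suc j"
  have less: "\<sigma> i < ?n" if "i < ?n" for i
    using that permutes_in_image[OF \<sigma>, of i] by auto
  have last: "\<sigma> ?n = ?n"
    using \<sigma> by (simp add: permutes_def)
  let ?f = "\<lambda>\<tau> (i, j). (ds @ [x]) ! \<tau> i * (ds @ [x]) ! (\<tau> j :: nat)"
  let ?I1 = "{(i, j). i < j \<and> j < ?n \<and> \<sigma> j < \<sigma> i}"
  let ?I2 = "(\<lambda>j. (a, Suc j)) ` {a..<?n}"
  have I: "{(i, j). i < j \<and> j < length (ds @ [x]) \<and> (\<sigma> \<circ> ?c) j < (\<sigma> \<circ> ?c) i} = map_prod ?t ?t ` ?I1 \<union> ?I2"
    (is "?L = ?R")
  proof (intro equalityI subrelI)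
    fix i j
    assume "(i, j) \<in> ?L"
    then have ij: "i < j" "j < length (ds @ [x])" "(\<sigma> \<circ> ?c) j < (\<sigma> \<circ> ?c) i"
      by simp_all
    show "(i, j) \<in> ?R"
    proof (cases "i = a")
      case True
      then have "(i, j) = (a, Suc (j - 1))" "j - 1 \<in> {a..<?n}"
        using ij by auto
      then show ?thesis by blast
    next
      case False
      have "j \<noteq> a"
      proof
        assume "j = a"
        then have "(\<sigma> \<circ> ?c) j = ?n" "(\<sigma> \<circ> ?c) i = \<sigma> i"
          using ij a last by (auto simp: move_last_def)
        then show False
          using ij less[of i] \<open>j = a\<close> a by simp
      qed
      have t: "?t (?c k) = k" if "k \<noteq> a" "k \<le> ?n" for k
        using that by (auto simp: move_last_def)
      have "(?c i, ?c j) \<in> ?I1"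
        using ij False \<open>j \<noteq> a\<close> a by (auto simp: move_last_def)
      moreover have "(i, j) = map_prod ?t ?t (?c i, ?c j)"
        using t[of i] t[of j] ij False \<open>j \<noteq> a\<close> by simp
      ultimately show ?thesis
        by (metis (no_types, lifting) UnI1 image_eqI)
    qed
  next
    fix i j
    assume "(i, j) \<in> ?R"
    then show "(i, j) \<in> ?L"
    proof
      assume "(i, j) \<in> map_prod ?t ?t ` ?I1"
      then obtain y where y: "(i, j) = map_prod ?t ?t y" "y \<in> ?I1"
        by (rule imageE)
      obtain i' j' where ij': "y = (i', j')"
        by (cases y)
      have "i' < j'" "j' < ?n" "\<sigma> j' < \<sigma> i'" and ij: "i = ?t i'" "j = ?t j'"
        using y unfolding ij' by (simp_all only: map_prod_simp prod.inject mem_Collect_eq prod.case)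
      moreover have "?c (?t k) = k" if "k < ?n" for k
        using that by (simp add: move_last_def)
      ultimately show ?thesis
        unfolding ij by simp
    next
      assume "(i, j) \<in> ?I2"
      then show ?thesis
        using last less a by (auto simp: move_last_def)
    qed
  qed
  have fin: "finite ?I1"
    by (rule finite_subset[of _ "{..<?n} \<times> {..<?n}"]) auto
  have disj: "map_prod ?t ?t ` ?I1 \<inter> ?I2 = {}"
    by (auto split: if_splits)
  have inj: "inj_on (map_prod ?t ?t) ?I1"
    by (auto simp: inj_on_def split: if_splits)
  have "inversion_exponent (ds @ [x]) (\<sigma> \<circ> ?c) = sum (?f (\<sigma> \<circ> ?c)) (map_prod ?t ?t ` ?I1) + sum (?f (\<sigma> \<circ> ?c)) ?I2"
    unfolding inversion_exponent_def I using fin disj by (simp add: sum.union_disjoint)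
  also have "sum (?f (\<sigma> \<circ> ?c)) (map_prod ?t ?t ` ?I1) = inversion_exponent ds \<sigma>"
    unfolding inversion_exponent_def sum.reindex[OF inj]
    using a by (intro sum.cong) (auto simp: move_last_def nth_append less)
  also have "sum (?f (\<sigma> \<circ> ?c)) ?I2 = x * (\<Sum>j\<in>{a..<?n}. ds ! \<sigma> j)"
    using a last less by (subst sum.reindex) (auto simp: inj_on_def move_last_def nth_append sum_distrib_left intro!: sum.cong)
  finally show ?thesis .
qed

lemma permute_list_snoc_fix:
  assumes "\<sigma> permutes {..<length Ys}"
  shows "permute_list \<sigma> (Ys @ [X]) = permute_list \<sigma> Ys @ [X]"
proof -
  have "\<sigma> i < length Ys" if "i < length Ys" for i
    using that permutes_in_image[OF assms, of i] by auto
  moreover have "\<sigma> (length Ys) = length Ys"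
    using assms by (simp add: permutes_def)
  ultimately show ?thesis
    by (auto simp: permute_list_def nth_append)
qed

lemma permute_list_move_last:
  assumes \<sigma>: "\<sigma> permutes {..<length Ys}" and a: "a \<le> length Ys"
  shows "permute_list (\<sigma> \<circ> move_last a (length Ys)) (Ys @ [X])
    = take a (permute_list \<sigma> Ys) @ X # drop a (permute_list \<sigma> Ys)"
proof -
  have less: "\<sigma> i < length Ys" if "i < length Ys" for i
    using that permutes_in_image[OF \<sigma>, of i] by auto
  have "\<sigma> (length Ys) = length Ys"
    using \<sigma> by (simp add: permutes_def)
  then show ?thesis
    using a by (intro nth_equalityI)
       (auto simp: permute_list_def nth_append move_last_def less nth_Cons' less_Suc_eq)
qed

lemma shuffle_perms_permutes: "\<sigma> \<in> shuffle_perms a b \<Longrightarrow> \<sigma> permutes {..<a + b}"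
  by (simp add: shuffle_perms_def)

text \<open>Both sides satisfy the same recursion on the last entry of \<open>Xs\<close>. The first
  block of the shuffle is the right factor \<open>B\<close>, since the sign of
  \<open>unshuffle\<close> puts \<open>B\<close> in front; the reversals arise because the head of a
  word is its last letter.\<close>

lemma shuffle_sum_eq_unshuffle:
  assumes "length Xs = a + b"
  shows "(\<Sum>\<sigma>\<in>shuffle_perms a b. signed (inversion_exponent (map d Xs) \<sigma>)
      (H (take a (permute_list \<sigma> Xs)) (drop a (permute_list \<sigma> Xs))))
    = unshuffle d (\<lambda>A B. if length B = a then H (rev B) (rev A) else 0) (rev Xs)"
  using assms
proof (induction Xs arbitrary: a b H rule: rev_induct)
  case Nil
  then show ?case
    by (simp add: shuffle_perms_empty inversion_exponent_def)
next
  case (snoc X Ys)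
  let ?n = "length Ys"
  have n: "a + b = Suc ?n"
    using snoc.prems by simp
  have 1: "(if b > 0 then \<Sum>\<sigma>\<in>shuffle_perms a (b - 1). signed (inversion_exponent (map d (Ys @ [X])) \<sigma>)
      (H (take a (permute_list \<sigma> (Ys @ [X]))) (drop a (permute_list \<sigma> (Ys @ [X])))) else 0)
    = unshuffle d (\<lambda>A B. if length B = a then H (rev B) (rev (X # A)) else 0) (rev Ys)"
  proof (cases "b > 0")
    case True
    then have len: "?n = a + (b - 1)"
      using n by simp
    have "(\<Sum>\<sigma>\<in>shuffle_perms a (b - 1). signed (inversion_exponent (map d (Ys @ [X])) \<sigma>)
      (H (take a (permute_list \<sigma> (Ys @ [X]))) (drop a (permute_list \<sigma> (Ys @ [X])))))
      = (\<Sum>\<sigma>\<in>shuffle_perms a (b - 1). signed (inversion_exponent (map d Ys) \<sigma>)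
      (H (take a (permute_list \<sigma> Ys)) (drop a (permute_list \<sigma> Ys) @ [X])))"
    proof (rule sum.cong[OF refl])
      fix \<sigma>
      assume "\<sigma> \<in> shuffle_perms a (b - 1)"
      then have "\<sigma> permutes {..<?n}"
        using shuffle_perms_permutes len by metis
      then show "signed (inversion_exponent (map d (Ys @ [X])) \<sigma>)
          (H (take a (permute_list \<sigma> (Ys @ [X]))) (drop a (permute_list \<sigma> (Ys @ [X]))))
        = signed (inversion_exponent (map d Ys) \<sigma>) (H (take a (permute_list \<sigma> Ys)) (drop a (permute_list \<sigma> Ys) @ [X]))"
        using inversion_exponent_fix_last[of \<sigma> "map d Ys" "d X"] len
        by (simp add: permute_list_snoc_fix)
    qed
    also have "\<dots> = unshuffle d (\<lambda>A B. if length B = a then H (rev B) (rev A @ [X]) else 0) (rev Ys)"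
      by (rule snoc.IH[OF len])
    finally show ?thesis
      using True by (simp cong: if_cong)
  next
    case False
    then have "unshuffle d (\<lambda>A B. if length B = a then H (rev B) (rev (X # A)) else 0) (rev Ys)
      = unshuffle d (\<lambda>A B. 0) (rev Ys)"
      using n by (intro unshuffle_cong_length) auto
    then show ?thesis
      using False by simp
  qed
  \<comment> \<open>Here the last entry joins the first block, and its sign comes from passing the
    whole second block.\<close>
  have 2: "(if a > 0 then \<Sum>\<sigma>\<in>shuffle_perms (a - 1) b. signed (inversion_exponent (map d (Ys @ [X])) (\<sigma> \<circ> move_last (a - 1) ?n))
      (H (take a (permute_list (\<sigma> \<circ> move_last (a - 1) ?n) (Ys @ [X])))
        (drop a (permute_list (\<sigma> \<circ> move_last (a - 1) ?n) (Ys @ [X])))) else 0)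
    = unshuffle d (\<lambda>A B. signed (d X * total_degree d A) (if length (X # B) = a then H (rev (X # B)) (rev A) else 0)) (rev Ys)"
  proof (cases a)
    case 0
    then show ?thesis by simp
  next
    case (Suc a')
    then have len: "?n = a' + b"
      using n by simp
    have "(\<Sum>\<sigma>\<in>shuffle_perms a' b. signed (inversion_exponent (map d (Ys @ [X])) (\<sigma> \<circ> move_last a' ?n))
      (H (take a (permute_list (\<sigma> \<circ> move_last a' ?n) (Ys @ [X])))
        (drop a (permute_list (\<sigma> \<circ> move_last a' ?n) (Ys @ [X])))))
      = (\<Sum>\<sigma>\<in>shuffle_perms a' b. signed (inversion_exponent (map d Ys) \<sigma>)
        (signed (d X * total_degree d (drop a' (permute_list \<sigma> Ys)))
          (H (take a' (permute_list \<sigma> Ys) @ [X]) (drop a' (permute_list \<sigma> Ys)))))"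
    proof (rule sum.cong[OF refl])
      fix \<sigma>
      assume "\<sigma> \<in> shuffle_perms a' b"
      then have \<sigma>: "\<sigma> permutes {..<?n}"
        using shuffle_perms_permutes len by metis
      have less: "\<sigma> i < ?n" if "i < ?n" for i
        using that permutes_in_image[OF \<sigma>, of i] by auto
      have "total_degree d (drop a' (permute_list \<sigma> Ys)) = (\<Sum>j\<in>{a'..<?n}. map d Ys ! \<sigma> j)"
      proof -
        have "map d (drop a' (permute_list \<sigma> Ys)) = map (\<lambda>j. map d Ys ! \<sigma> j) [a'..<?n]"
          by (intro nth_equalityI) (auto simp: permute_list_def less)
        then show ?thesis
          by (simp add: interv_sum_list_conv_sum_set_nat)
      qed
      then show "signed (inversion_exponent (map d (Ys @ [X])) (\<sigma> \<circ> move_last a' ?n))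
          (H (take a (permute_list (\<sigma> \<circ> move_last a' ?n) (Ys @ [X])))
            (drop a (permute_list (\<sigma> \<circ> move_last a' ?n) (Ys @ [X]))))
        = signed (inversion_exponent (map d Ys) \<sigma>)
        (signed (d X * total_degree d (drop a' (permute_list \<sigma> Ys)))
          (H (take a' (permute_list \<sigma> Ys) @ [X]) (drop a' (permute_list \<sigma> Ys))))"
        using \<sigma> len inversion_exponent_move_last[of \<sigma> "map d Ys" a' "d X"]
          permute_list_move_last[of \<sigma> Ys a' X] Suc
        by (simp add: min_def)
    qed
    also have "\<dots> = unshuffle d (\<lambda>A B. if length B = a' then
        signed (d X * total_degree d (rev A)) (H (rev B @ [X]) (rev A)) else 0) (rev Ys)"
      by (rule snoc.IH[OF len])
    also have "\<dots> = unshuffle d (\<lambda>A B. signed (d X * total_degree d A) (if length (X # B) = a then H (rev (X # B)) (rev A) else 0)) (rev Ys)"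
      by (rule unshuffle_cong) (simp add: Suc rev_map[symmetric])
    finally show ?thesis
      using Suc by simp
  qed
  show ?case
    unfolding sum_shuffle_perms[OF n] 1 2 by simp
qed

text \<open>The parity of inversions is compared with \<open>sign\<close> along the recursion for
  shuffles: fixing the last position changes neither, and the cycle changes both by the length of
  the second block.\<close>

lemma sign_shuffle:
  assumes "\<sigma> \<in> shuffle_perms a b"
  shows "sign \<sigma> = (if even (inversion_exponent (replicate (a + b) 1) \<sigma>) then 1 else - 1)"
  using assms
proof (induction "a + b" arbitrary: a b \<sigma>)
  case 0
  then show ?case
    by (simp add: shuffle_perms_empty inversion_exponent_def)
next
  case (Suc n)
  have rep: "replicate (a + b) (1 :: int) = replicate n 1 @ [1]"
    using Suc.hyps(2) by (metis replicate_Suc replicate_append_same)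
  consider "b > 0" "\<sigma> n = n" | "a > 0" "\<sigma> (a - 1) = n"
    using shuffle_perms_last_cases[OF Suc.prems Suc.hyps(2)[symmetric]] by blast
  then show ?case
  proof cases
    case 1
    have n: "n = a + (b - 1)" "b = Suc (b - 1)"
      using 1(1) Suc.hyps(2) by simp_all
    have "\<sigma> \<in> {\<sigma> \<in> shuffle_perms a (Suc (b - 1)). \<sigma> (a + (b - 1)) = a + (b - 1)}"
      using Suc.prems 1(2) unfolding n(1)[symmetric] n(2)[symmetric] by blast
    then have \<sigma>: "\<sigma> \<in> shuffle_perms a (b - 1)"
      unfolding shuffle_perms_fix_last .
    have IH: "sign \<sigma> = (if even (inversion_exponent (replicate n 1) \<sigma>) then 1 else - 1)"
      using Suc.hyps(1)[OF n(1) \<sigma>] unfolding n(1)[symmetric] .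
    have "\<sigma> permutes {..<length (replicate n (1 :: int))}"
      using shuffle_perms_permutes[OF \<sigma>] unfolding n(1)[symmetric] length_replicate .
    then have "inversion_exponent (replicate (a + b) 1) \<sigma> = inversion_exponent (replicate n 1) \<sigma>"
      unfolding rep by (rule inversion_exponent_fix_last)
    then show ?thesis
      unfolding IH by simp
  next
    case 2
    have n: "n = (a - 1) + b"
      using 2 Suc.hyps(2) by simp
    have "\<sigma> \<in> {\<sigma> \<in> shuffle_perms (Suc (a - 1)) b. \<sigma> (a - 1) = (a - 1) + b}"
      using 2 Suc.prems Suc.hyps(2) by simp
    then obtain \<tau> where \<tau>: "\<tau> \<in> shuffle_perms (a - 1) b" "\<sigma> = \<tau> \<circ> move_last (a - 1) n"
      using bij_betw_imp_surj_on[OF shuffle_perms_move_last[of "a - 1" b]] unfolding n by (metis (no_types, lifting) imageE)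
    have p: "\<tau> permutes {..<n}"
      using shuffle_perms_permutes[OF \<tau>(1)] n by simp
    have "permutation \<tau>" "permutation (move_last (a - 1) n)"
      using p move_last_permutes[of "a - 1" n] n by (auto simp: permutation_permutes)
    then have s: "sign \<sigma> = sign \<tau> * (- 1) ^ (n - (a - 1))"
      using n by (simp add: \<tau>(2) sign_compose sign_move_last)
    have "(\<Sum>j\<in>{a - 1..<n}. replicate n (1 :: int) ! \<tau> j) = (\<Sum>j\<in>{a - 1..<n}. 1)"
      using permutes_in_image[OF p] by (intro sum.cong) auto
    then have "inversion_exponent (replicate (a + b) 1) \<sigma> = inversion_exponent (replicate n 1) \<tau> + int (n - (a - 1))"
      using inversion_exponent_move_last[of \<tau> "replicate n 1" "a - 1" 1] p n
      by (simp add: rep \<tau>(2))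
    then show ?thesis
      using Suc.hyps(1)[OF n \<tau>(1)] n by (simp add: s uminus_power_if)
  qed
qed

section \<open>The graded Lie algebra of cochains\<close>

text \<open>Predicates that cut out a subgroup pass to all signed sums. They are applied to linear
  maps, to alternating forms in a marked letter, and to vectors of a given type.\<close>

definition subgroup_pred :: "('v::ab_group_add \<Rightarrow> bool) \<Rightarrow> bool" where
  "subgroup_pred Z \<longleftrightarrow> Z 0 \<and> (\<forall>x y. Z x \<longrightarrow> Z y \<longrightarrow> Z (x + y)) \<and> (\<forall>x. Z x \<longrightarrow> Z (- x))"

lemma subgroup_pred_signed: "subgroup_pred Z \<Longrightarrow> Z x \<Longrightarrow> Z (signed n x)"
  by (simp add: subgroup_pred_def signed_def)

lemma unshuffle_closed:
  assumes "subgroup_pred Z" and "\<And>A B. mset A + mset B = mset w \<Longrightarrow> Z (H A B)"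
  shows "Z (unshuffle d H w)"
  using assms(2)
proof (induction w arbitrary: H)
  case (Cons X w)
  have "Z (unshuffle d (\<lambda>A B. H (X # A) B) w)"
    by (rule Cons.IH) (simp add: Cons.prems)
  moreover have "Z (unshuffle d (\<lambda>A B. signed (d X * total_degree d A) (H A (X # B))) w)"
    by (rule Cons.IH) (simp add: Cons.prems subgroup_pred_signed[OF assms(1)])
  ultimately show ?case
    using assms(1) by (simp add: subgroup_pred_def)
qed simp

lemma coder_closed:
  assumes Z: "subgroup_pred Z" and "\<And>u. Z (F u)"
  shows "Z (coder r Q F w)"
  using assms(2)
proof (induction w arbitrary: F)
  case Nil
  show ?case using Z by (simp add: subgroup_pred_def)
next
  case (Cons X w)
  have "Z (coder r Q (\<lambda>u. F (X # u)) w)"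
    by (rule Cons.IH) (simp add: Cons.prems)
  moreover have "Z (lunsh (\<lambda>A B. if length B = r then wedge_act (Q B) (\<lambda>Y. F (Y # A)) X else 0) w)"
    by (rule unshuffle_closed[OF Z])
       (use Z Cons.prems in \<open>auto simp: subgroup_pred_def wedge_act_def\<close>)
  ultimately show ?case
    using Z by (simp add: subgroup_pred_def)
qed

text \<open>The recursion is unrolled by the position of the letter acted on, which is how
  \<open>diamond_insert\<close> is indexed.\<close>

lemma coder_sum:
  "coder r Q F w = (\<Sum>k<length w. lunsh (\<lambda>A B. if length B = r
     then wedge_act (Q B) (\<lambda>Y. F (take k w @ Y # A)) (w ! k) else 0) (drop (Suc k) w))"
proof (induction w arbitrary: F)
  case (Cons X w)
  show ?case
    unfolding coder.simps Cons.IH length_Cons sum.lessThan_Suc_shift by (simp add: add.commute cong: if_cong)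
qed simp

lemma lunsh_right_empty: "lunsh (\<lambda>A B. if length B = 0 then H A B else 0) w = H w []"
proof (induction w arbitrary: H)
  case (Cons X w)
  have "lunsh (\<lambda>A B. signed (int (length A)) (if length (X # B) = 0 then H A (X # B) else 0)) w = 0"
    by simp
  then show ?case
    using Cons.IH[of "\<lambda>A B. H (X # A) B"] by simp
qed simp

lemma lunsh_left_empty:
  assumes "length w = k"
  shows "lunsh (\<lambda>A B. if length B = k then H A B else 0) w = H [] w"
  unfolding assms[symmetric]
proof (induction w arbitrary: H)
  case (Cons X w)
  have "lunsh (\<lambda>A B. if length B = length (X # w) then H (X # A) B else 0) w = lunsh (\<lambda>A B. 0) w"
    by (rule unshuffle_cong_length) auto
  moreover have "lunsh (\<lambda>A B. signed (int (length A)) (if length (X # B) = length (X # w) then H A (X # B) else 0)) w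
      = lunsh (\<lambda>A B. if length B = length w then signed (int (length A)) (H A (X # B)) else 0) w"
    by (rule unshuffle_cong) simp
  ultimately show ?case
    using Cons.IH[of "\<lambda>A B. signed (int (length A)) (H A (X # B))"] by simp
qed simp

text \<open>The factor with exponent \<open>p * q\<close> is the sign of exchanging the blocks: it
  moves the first block from the right factor, where \<open>shuffle_sum_eq_unshuffle\<close> has it,
  to the left one.\<close>

lemma signed_shuffle_sum:
  fixes sc :: "'k::field \<Rightarrow> 'v::ab_group_add \<Rightarrow> 'v"
  assumes "module sc" and len: "length Xs = p + q"
  shows "(\<Sum>\<sigma>\<in>shuffle_perms p q. sc ((- 1) ^ (p * q) * of_int (sign \<sigma>))
      (H (take p (permute_list \<sigma> Xs)) (drop p (permute_list \<sigma> Xs))))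
    = lunsh (\<lambda>A B. if length B = q then H (rev A) (rev B) else 0) (rev Xs)"
proof -
  have "(\<Sum>\<sigma>\<in>shuffle_perms p q. sc ((- 1) ^ (p * q) * of_int (sign \<sigma>))
      (H (take p (permute_list \<sigma> Xs)) (drop p (permute_list \<sigma> Xs))))
    = (\<Sum>\<sigma>\<in>shuffle_perms p q. signed (inversion_exponent (map (\<lambda>_. 1) Xs) \<sigma>)
      (signed (int p * int q) (H (take p (permute_list \<sigma> Xs)) (drop p (permute_list \<sigma> Xs)))))"
  proof (rule sum.cong[OF refl])
    fix \<sigma>
    assume \<sigma>: "\<sigma> \<in> shuffle_perms p q"
    have "(- 1) ^ (p * q) * of_int (sign \<sigma>)
      = (- 1 :: 'k) powi (inversion_exponent (map (\<lambda>_. 1) Xs) \<sigma> + int p * int q)"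
      using sign_shuffle[OF \<sigma>] by (auto simp: minus_one_powi uminus_power_if map_replicate_const len)
    then show "sc ((- 1) ^ (p * q) * of_int (sign \<sigma>)) (H (take p (permute_list \<sigma> Xs)) (drop p (permute_list \<sigma> Xs)))
      = signed (inversion_exponent (map (\<lambda>_. 1) Xs) \<sigma>)
      (signed (int p * int q) (H (take p (permute_list \<sigma> Xs)) (drop p (permute_list \<sigma> Xs))))"
      by (simp add: signed_eq_scale[OF assms(1)])
  qed
  also have "\<dots> = lunsh (\<lambda>A B. if length B = p then signed (int p * int q) (H (rev B) (rev A)) else 0) (rev Xs)"
    by (rule shuffle_sum_eq_unshuffle[OF len])
  also have "\<dots> = lunsh (\<lambda>A B. if length B = q then H (rev A) (rev B) else 0) (rev Xs)"
    by (subst unshuffle_cocomm, rule unshuffle_cong_length) (auto simp: len signed_def)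
  finally show ?thesis .
qed

text \<open>Cochains take their letters in reading order, the recursions take the last letter first;
  this involution passes between the two.\<close>

definition rev_cochain :: "('w, 'v) cochain \<Rightarrow> ('w, 'v) cochain" where
  "rev_cochain P = (\<lambda>w. fst P (rev w), \<lambda>w. snd P (rev w))"

lemma rev_cochain_simps [simp]:
  "rev_cochain (rev_cochain P) = P"
  "fst (rev_cochain P) w = fst P (rev w)" "snd (rev_cochain P) w = snd P (rev w)"
  by (auto simp: rev_cochain_def)

definition pre_bracket :: "nat \<Rightarrow> ('w, 'w) cochain \<Rightarrow> ('w, 'w) cochain \<Rightarrow> ('w, 'w::ab_group_add) cochain" where
  "pre_bracket q P Q = rev_cochain (wdiamond q (rev_cochain P) (rev_cochain Q))"

section \<open>Preservation of multilinearity and the alternating property\<close>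

definition alt2 :: "('k::field \<Rightarrow> 'w::ab_group_add \<Rightarrow> 'w) \<Rightarrow> ('k \<Rightarrow> 'v::ab_group_add \<Rightarrow> 'v) \<Rightarrow>
    ('w \<times> 'w \<Rightarrow> 'v) \<Rightarrow> bool" where
  "alt2 sw sv G \<longleftrightarrow> bilinear_map sw sw sv (\<lambda>x y. G (x, y)) \<and> (\<forall>x. G (x, x) = 0)"

text \<open>The condition concerns words of every length and is kept apart from the support
  condition. It is thus inherited when the head is fixed, and the inductions need not track
  lengths.\<close>

definition word_alt :: "('k::field \<Rightarrow> 'w::ab_group_add \<Rightarrow> 'w) \<Rightarrow> ('k \<Rightarrow> 'v::ab_group_add \<Rightarrow> 'v) \<Rightarrow>
    (('w \<times> 'w) list \<Rightarrow> 'v) \<Rightarrow> bool" where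
  "word_alt sw sv F \<longleftrightarrow> (\<forall>u v. alt2 sw sv (\<lambda>X. F (u @ X # v)))"

lemma word_altD:
  assumes "word_alt sw sv F"
  shows "alt2 sw sv (\<lambda>X. F (X # v))" "word_alt sw sv (\<lambda>u. F (X # u))"
  using assms[unfolded word_alt_def, rule_format, of "[]" v]
    assms[unfolded word_alt_def, rule_format, of "X # _"] by (simp_all add: word_alt_def)

lemma word_alt_rev: "word_alt sw sv F \<Longrightarrow> word_alt sw sv (\<lambda>w. F (rev w))"
  by (simp add: word_alt_def)

text \<open>The last clause is special to degree 0, where the first entry has to vanish at the empty
  list as well.\<close>

definition cochain_support :: "nat \<Rightarrow> ('w, 'v::ab_group_add) cochain \<Rightarrow> bool" where
  "cochain_support p P \<longleftrightarrow> (\<forall>Xs. length Xs \<noteq> p \<longrightarrow> fst P Xs = 0 \<and> snd P Xs = 0) \<and> (p = 0 \<longrightarrow> fst P = 0)"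

lemma alt2_iff:
  assumes "vector_space sw" "vector_space sv"
  shows "alt2 sw sv G \<longleftrightarrow>
    (\<forall>x y z. G (x, y + z) = G (x, y) + G (x, z)) \<and> (\<forall>x y c. G (x, sw c y) = sv c (G (x, y))) \<and>
    (\<forall>x y z. G (x + y, z) = G (x, z) + G (y, z)) \<and> (\<forall>x y c. G (sw c x, y) = sv c (G (x, y))) \<and>
    (\<forall>x. G (x, x) = 0)"
  using assms by (auto simp: alt2_def bilinear_map_def Vector_Spaces.linear_iff)

lemma alt2_biadd: "alt2 sw sv G \<Longrightarrow> biadd G"
  by (auto simp: alt2_def bilinear_map_def Vector_Spaces.linear_iff biadd_def additive_def)

lemma word_alt_additive: "word_alt sw sv F \<Longrightarrow> word_additive F"
  by (auto simp: word_alt_def word_additive_def intro: alt2_biadd)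

context vector_space_pair
begin

lemma subgroup_alt2: "subgroup_pred (alt2 s1 s2)"
  by (auto simp: subgroup_pred_def alt2_iff[OF vs1.vector_space_axioms vs2.vector_space_axioms] algebra_simps
      vs2.scale_right_distrib)

lemma alt2_zero: "alt2 s1 s2 (\<lambda>X. 0)"
  using subgroup_alt2 by (simp add: subgroup_pred_def zero_fun_def)

lemma alt2_add: "alt2 s1 s2 G \<Longrightarrow> alt2 s1 s2 G' \<Longrightarrow> alt2 s1 s2 (\<lambda>X. G X + G' X)"
  using subgroup_alt2 by (simp add: subgroup_pred_def plus_fun_def)

lemma alt2_signed: "alt2 s1 s2 G \<Longrightarrow> alt2 s1 s2 (\<lambda>X. signed n (G X))"
  using subgroup_pred_signed[OF subgroup_alt2, of G n] by (simp add: signed_apply[abs_def] cong: if_cong)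

lemma alt2_unshuffle:
  assumes "\<And>A B. mset A + mset B = mset w \<Longrightarrow> alt2 s1 s2 (\<lambda>X. H X A B)"
  shows "alt2 s1 s2 (\<lambda>X. unshuffle d (H X) w)"
proof -
  have "alt2 s1 s2 (unshuffle d (\<lambda>A B X. H X A B) w)"
    by (rule unshuffle_closed[OF subgroup_alt2]) (rule assms)
  moreover have "unshuffle d (\<lambda>A B X. H X A B) w = (\<lambda>X. unshuffle d (H X) w)"
    by (simp add: fun_eq_iff unshuffle_apply)
  ultimately show ?thesis by simp
qed

lemma alt2_coder:
  assumes "\<And>u. alt2 s1 s2 (\<lambda>X. G X u)"
  shows "alt2 s1 s2 (\<lambda>X. coder r Q (G X) w)"
proof -
  have "alt2 s1 s2 (coder r Q (\<lambda>u X. G X u) w)"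
    by (rule coder_closed[OF subgroup_alt2]) (rule assms)
  moreover have "coder r Q (\<lambda>u X. G X u) w = (\<lambda>X. coder r Q (G X) w)"
    by (simp add: fun_eq_iff coder_apply)
  ultimately show ?thesis by simp
qed

text \<open>Neither of the two summands need be alternating; at a pair \<open>(x, x)\<close> they
  cancel because \<open>G\<close> is antisymmetric.\<close>

lemma alt2_wedge_act:
  assumes "alt2 s1 s2 G" "Vector_Spaces.linear s1 s1 f"
  shows "alt2 s1 s2 (wedge_act f G)"
proof -
  have G: "G (x, y) = - G (y, x)" for x y
  proof -
    have add: "G (x, y + z) = G (x, y) + G (x, z)" "G (x + y, z) = G (x, z) + G (y, z)" "G (x, x) = 0" for x y z
      using assms(1) unfolding alt2_iff[OF vs1.vector_space_axioms vs2.vector_space_axioms] by blast+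
    have "0 = G (x + y, x + y)"
      by (simp only: add(3))
    also have "\<dots> = G (x, y) + G (y, x)"
      by (simp only: add(1,2)) (simp add: add(3))
    finally show ?thesis
      by (simp add: eq_neg_iff_add_eq_0)
  qed
  have "G (f x, x) + G (x, f x) = 0" for x
    using G[of "f x" x] by simp
  then show ?thesis
    using assms by (auto simp: alt2_iff[OF vs1.vector_space_axioms vs2.vector_space_axioms] wedge_act_def
        Vector_Spaces.linear_iff vs2.scale_right_distrib)
qed

lemma alt2_guard: "alt2 s1 s2 G \<Longrightarrow> alt2 s1 s2 (\<lambda>X. if c then G X else 0)"
  by (cases c) (simp_all add: alt2_zero)

lemma word_alt_if: "word_alt s1 s2 F \<Longrightarrow> word_alt s1 s2 (\<lambda>A. if c then F A else 0)"
  by (cases c) (simp_all add: word_alt_def alt2_zero)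

lemma word_alt_guard: "word_alt s1 s2 K \<Longrightarrow> word_alt s1 s2 (\<lambda>B. if length B = r then K B else 0)"
  unfolding word_alt_def
proof (intro allI)
  fix u v
  assume "\<forall>u v. alt2 s1 s2 (\<lambda>X. K (u @ X # v))"
  then show "alt2 s1 s2 (\<lambda>X. if length (u @ X # v) = r then K (u @ X # v) else 0)"
    by (cases "Suc (length u + length v) = r") (simp_all add: alt2_zero)
qed

lemma word_alt_signed_length: "word_alt s1 s2 K \<Longrightarrow> word_alt s1 s2 (\<lambda>B. signed (f (length B)) (K B))"
  by (auto simp: word_alt_def alt2_signed)

lemma word_alt_zero: "word_alt s1 s2 (\<lambda>B. 0)"
  by (auto simp: word_alt_def alt2_zero)

lemma word_alt_add: "word_alt s1 s2 F \<Longrightarrow> word_alt s1 s2 F' \<Longrightarrow> word_alt s1 s2 (\<lambda>B. F B + F' B)"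
  by (auto simp: word_alt_def alt2_add)

text \<open>The marked letter goes to one of the factors with a sign that does not depend on its
  value, so each term is alternating in it.\<close>

lemma word_alt_unshuffle:
  assumes "\<And>B. word_alt s1 s2 (\<lambda>A. H A B)" and "\<And>A. word_alt s1 s2 (\<lambda>B. H A B)"
  shows "word_alt s1 s2 (lunsh H)"
  unfolding word_alt_def
proof (intro allI)
  fix u v
  show "alt2 s1 s2 (\<lambda>X. lunsh H (u @ X # v))"
    using assms
  proof (induction u arbitrary: H)
    case Nil
    show ?case
      unfolding append_Nil unshuffle.simps
      by (intro alt2_add alt2_unshuffle alt2_signed word_altD(1)[OF Nil(1)] word_altD(1)[OF Nil(2)])
  next
    case (Cons Z u)
    have "alt2 s1 s2 (\<lambda>X. lunsh (\<lambda>A B. H (Z # A) B) (u @ X # v))"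
      by (rule Cons.IH) (auto intro: Cons.prems word_altD(2))
    moreover have "alt2 s1 s2 (\<lambda>X. lunsh (\<lambda>A B. signed (1 * total_degree (\<lambda>_. 1) A) (H A (Z # B))) (u @ X # v))"
    proof (rule Cons.IH)
      show "word_alt s1 s2 (\<lambda>A. signed (1 * total_degree (\<lambda>_. 1) A) (H A (Z # B)))" for B
        using word_alt_signed_length[OF Cons.prems(1), of int "Z # B"] by simp
      show "word_alt s1 s2 (\<lambda>B. signed (1 * total_degree (\<lambda>_. 1) A) (H A (Z # B)))" for A
        using word_alt_signed_length[OF word_altD(2)[OF Cons.prems(2)], of "\<lambda>_. 1 * total_degree (\<lambda>_. 1) A"] by simp
    qed
    ultimately show ?case
      by (simp only: append_Cons unshuffle.simps alt2_add)
  qed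
qed

end

lemma alt2_comp_linear:
  assumes "alt2 sw sv G" "Vector_Spaces.linear sv su T"
  shows "alt2 sw su (\<lambda>X. T (G X))"
proof -
  have "T (0 + 0) = T 0 + T 0"
    using assms(2) unfolding Vector_Spaces.linear_iff by blast
  then show ?thesis
    using assms by (auto simp: alt2_def bilinear_map_def Vector_Spaces.linear_iff)
qed

lemma word_alt_comp_linear:
  assumes "word_alt sw sv F" "Vector_Spaces.linear sv su T"
  shows "word_alt sw su (\<lambda>B. T (F B))"
  unfolding word_alt_def
  by (intro allI alt2_comp_linear[OF _ assms(2)]) (use assms(1) in \<open>simp add: word_alt_def\<close>)

context vector_space_pair
begin

text \<open>A letter has three possible roles: it is left to \<open>F\<close>, it is acted on, or it
  is consumed by \<open>Q\<close>. In the third case the alternating property of \<open>Q\<close> is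
  carried through \<open>F\<close>, which is linear in the entry that receives the value.\<close>

lemma word_alt_coder:
  assumes "word_alt s1 s2 F" and Q: "\<And>x. word_alt s1 s1 (\<lambda>w. Q w x)" "\<And>w. Vector_Spaces.linear s1 s1 (Q w)"
  shows "word_alt s1 s2 (coder r Q F)"
  unfolding word_alt_def
proof (intro allI)
  fix u v
  show "alt2 s1 s2 (\<lambda>X. coder r Q F (u @ X # v))"
    using assms(1)
  proof (induction u arbitrary: F)
    case Nil
    have "alt2 s1 s2 (\<lambda>X. coder r Q (\<lambda>u. F (X # u)) v)"
      by (rule alt2_coder) (rule word_altD(1)[OF Nil])
    moreover have "alt2 s1 s2 (\<lambda>X. lunsh (\<lambda>A B. if length B = r then wedge_act (Q B) (\<lambda>Y. F (Y # A)) X else 0) v)"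
      by (rule alt2_unshuffle) (intro alt2_guard alt2_wedge_act[OF word_altD(1)[OF Nil] Q(2)])
    ultimately show ?case
      by (simp add: alt2_add)
  next
    case (Cons Z u)
    have "alt2 s1 s2 (\<lambda>X. coder r Q (\<lambda>w. F (Z # w)) (u @ X # v))"
      by (rule Cons.IH) (rule word_altD(2)[OF Cons.prems])
    moreover have "word_alt s1 s2 (lunsh (\<lambda>A B. if length B = r then wedge_act (Q B) (\<lambda>Y. F (Y # A)) Z else 0))"
    proof (rule word_alt_unshuffle)
      show "word_alt s1 s2 (\<lambda>A. if length B = r then wedge_act (Q B) (\<lambda>Y. F (Y # A)) Z else 0)" for B
        unfolding wedge_act_def by (intro word_alt_if word_alt_add word_altD(2)[OF Cons.prems])
      have lin: "Vector_Spaces.linear s1 s2 (\<lambda>x. F ((x, y) # A))" "Vector_Spaces.linear s1 s2 (\<lambda>x. F ((y, x) # A))" for y A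
        using word_altD(1)[OF Cons.prems, of A] by (auto simp: alt2_def bilinear_map_def)
      show "word_alt s1 s2 (\<lambda>B. if length B = r then wedge_act (Q B) (\<lambda>Y. F (Y # A)) Z else 0)" for A
        unfolding wedge_act_def
        by (intro word_alt_guard word_alt_add word_alt_comp_linear[OF Q(1) lin(1)] word_alt_comp_linear[OF Q(1) lin(2)])
    qed
    ultimately show ?case
      by (simp add: alt2_add word_alt_def)
  qed
qed

end


context vector_space
begin

interpretation self: vector_space_pair scale scale ..

lemma linear_subgroup: "subgroup_pred (Vector_Spaces.linear scale scale)"
  by (auto simp: subgroup_pred_def Vector_Spaces.linear_iff vector_space_axioms algebra_simps scale_right_distrib)

lemma word_alt_hconv:
  assumes "\<And>x. word_alt scale scale (\<lambda>w. P w x)" "\<And>w. Vector_Spaces.linear scale scale (P w)"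
    and G: "word_alt scale scale G"
  shows "word_alt scale scale (hconv r P G)"
  unfolding word_alt_def
proof (intro allI)
  fix u v
  show "alt2 scale scale (\<lambda>X. hconv r P G (u @ X # v))"
  proof (cases u)
    case Nil
    show ?thesis
      unfolding Nil append_Nil hconv.simps
      by (intro self.alt2_unshuffle self.alt2_guard self.alt2_signed alt2_comp_linear[OF word_altD(1)[OF G] assms(2)])
  next
    case (Cons Z u')
    have "word_alt scale scale (lunsh (\<lambda>A B. if Suc (length B) = r then signed (int (length A)) (P A (G (Z # B))) else 0))"
    proof (rule self.word_alt_unshuffle)
      show "word_alt scale scale (\<lambda>A. if Suc (length B) = r then signed (int (length A)) (P A (G (Z # B))) else 0)" for B
        by (intro self.word_alt_if self.word_alt_signed_length assms(1))
      \<comment> \<open>The guard is restated with \<open>r - 1\<close> to fit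
        \<open>word_alt_guard\<close>; the extra test excludes \<open>r = 0\<close>, where the
        subtraction truncates.\<close>
      have *: "word_alt scale scale (\<lambda>B. if length B = r - 1 then if r \<noteq> 0 then signed (int (length A)) (P A (G (Z # B))) else 0 else 0)" for A
        using self.word_alt_signed_length[OF word_alt_comp_linear[OF word_altD(2)[OF G] assms(2)], of "\<lambda>_. int (length A)"]
        by (intro self.word_alt_guard self.word_alt_if)
      have "(\<lambda>B. if Suc (length B) = r then signed (int (length A)) (P A (G (Z # B))) else 0)
        = (\<lambda>B. if length B = r - 1 then if r \<noteq> 0 then signed (int (length A)) (P A (G (Z # B))) else 0 else 0)" for A
        by (auto simp: fun_eq_iff)
      then show "word_alt scale scale (\<lambda>B. if Suc (length B) = r then signed (int (length A)) (P A (G (Z # B))) else 0)" for A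
        using * by simp
    qed
    then show ?thesis
      unfolding Cons append_Cons hconv.simps by (simp add: word_alt_def)
  qed
qed

lemma word_alt_lconv:
  assumes "\<And>x. word_alt scale scale (\<lambda>w. P w x)" "\<And>w. Vector_Spaces.linear scale scale (P w)"
    and "\<And>x. word_alt scale scale (\<lambda>w. Q w x)"
  shows "word_alt scale scale (\<lambda>w. lconv r P Q w x)"
proof -
  have eq: "(\<lambda>w. lconv r P Q w x) = lunsh (\<lambda>A B. if length B = r then P A (Q B x) else 0)"
    by (auto simp: fun_eq_iff lconv_def unshuffle_apply intro!: unshuffle_cong)
  show ?thesis
    unfolding eq
  proof (rule self.word_alt_unshuffle)
    show "word_alt scale scale (\<lambda>A. if length B = r then P A (Q B x) else 0)" for B
      by (intro self.word_alt_if assms(1))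
    show "word_alt scale scale (\<lambda>B. if length B = r then P A (Q B x) else 0)" for A
      by (intro self.word_alt_guard word_alt_comp_linear[OF assms(3,2)])
  qed
qed

lemma linear_lconv:
  assumes "\<And>w. Vector_Spaces.linear scale scale (P w)" "\<And>w. Vector_Spaces.linear scale scale (Q w)"
  shows "Vector_Spaces.linear scale scale (lconv r P Q w)"
  unfolding lconv_def
proof (rule unshuffle_closed[OF linear_subgroup])
  fix A B
  show "Vector_Spaces.linear scale scale (if length B = r then P A \<circ> Q B else 0)"
    using linear_subgroup Vector_Spaces.linear_compose[OF assms(2,1)] by (simp add: subgroup_pred_def)
qed

end

context vector_space_pair
begin

text \<open>One description for all degrees, in which the homomorphisms of degree 0 are no
  exception; it spares the later arguments the case distinction in \<open>cochains\<close>.\<close>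

lemma cochains_iff:
  "P \<in> cochains s1 s2 p \<longleftrightarrow> cochain_support p P \<and> word_alt s1 s2 (fst P) \<and>
     (\<forall>x. word_alt s1 s2 (\<lambda>Xs. snd P Xs x)) \<and> (\<forall>Xs. Vector_Spaces.linear s1 s2 (snd P Xs))"
proof -
  have zero: "Vector_Spaces.linear s1 s2 0"
    by (simp add: Vector_Spaces.linear_iff vs1.vector_space_axioms vs2.vector_space_axioms)
  have wm: "wedge_multilinear s1 s2 p F \<longleftrightarrow> (\<forall>Xs. length Xs \<noteq> p \<longrightarrow> F Xs = 0) \<and> word_alt s1 s2 F" for F
  proof (intro iffI conjI)
    assume F: "wedge_multilinear s1 s2 p F"
    then show "\<forall>Xs. length Xs \<noteq> p \<longrightarrow> F Xs = 0"
      by (simp add: wedge_multilinear_def)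
    show "word_alt s1 s2 F"
      unfolding word_alt_def
    proof (intro allI)
      fix u v
      show "alt2 s1 s2 (\<lambda>X. F (u @ X # v))"
      proof (cases "length u + Suc (length v) = p")
        case True
        \<comment> \<open>The letter \<open>undefined\<close> only holds the place that the list
          update overwrites.\<close>
        then have "length (u @ undefined # v) = p \<and> length u < p"
          by simp
        then have "bilinear_map s1 s1 s2 (\<lambda>x y. F ((u @ undefined # v)[length u := (x, y)])) \<and>
            (\<forall>x. F ((u @ undefined # v)[length u := (x, x)]) = 0)"
          using F unfolding wedge_multilinear_def by blast
        then show ?thesis
          by (simp add: alt2_def)
      next
        case False
        then show ?thesis
          using F by (simp add: wedge_multilinear_def alt2_zero)
      qed
    qed
  next
    assume F: "(\<forall>Xs. length Xs \<noteq> p \<longrightarrow> F Xs = 0) \<and> word_alt s1 s2 F"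
    show "wedge_multilinear s1 s2 p F"
      unfolding wedge_multilinear_def
    proof (intro conjI allI impI)
      show "F Xs = 0" if "length Xs \<noteq> p" for Xs
        using F that by blast
      fix Xs :: "('b \<times> 'b) list" and i
      assume "length Xs = p \<and> i < p"
      then have "alt2 s1 s2 (\<lambda>X. F (Xs[i := X]))"
        using F by (simp add: word_alt_def upd_conv_take_nth_drop)
      then show "bilinear_map s1 s1 s2 (\<lambda>x y. F (Xs[i := (x, y)]))" and "F (Xs[i := (x, x)]) = 0" for x
        by (simp_all add: alt2_def)
    qed
  qed
  show ?thesis
  proof (cases "p = 0")
    case True
    show ?thesis
    proof
      assume "P \<in> cochains s1 s2 p"
      then obtain f where f: "Vector_Spaces.linear s1 s2 f" "P = hom_cochain f"
        using True by (auto simp: cochains_def)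
      then show "cochain_support p P \<and> word_alt s1 s2 (fst P) \<and>
         (\<forall>x. word_alt s1 s2 (\<lambda>Xs. snd P Xs x)) \<and> (\<forall>Xs. Vector_Spaces.linear s1 s2 (snd P Xs))"
        using True by (simp add: cochain_support_def hom_cochain_def word_alt_def alt2_zero zero)
    next
      assume P: "cochain_support p P \<and> word_alt s1 s2 (fst P) \<and>
         (\<forall>x. word_alt s1 s2 (\<lambda>Xs. snd P Xs x)) \<and> (\<forall>Xs. Vector_Spaces.linear s1 s2 (snd P Xs))"
      then have "P = hom_cochain (snd P [])"
        using True by (auto simp: hom_cochain_def prod_eq_iff fun_eq_iff cochain_support_def)
      then show "P \<in> cochains s1 s2 p"
        using P True by (auto simp: cochains_def)
    qed
  next
    case False
    have "(\<forall>Xs. length Xs \<noteq> p \<longrightarrow> snd P Xs = 0) \<Longrightarrow>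
        (\<forall>Xs. length Xs = p \<longrightarrow> Vector_Spaces.linear s1 s2 (snd P Xs))
        \<longleftrightarrow> (\<forall>Xs. Vector_Spaces.linear s1 s2 (snd P Xs))"
      using zero by metis
    then show ?thesis
      using False by (auto simp: cochains_def wm cochain_support_def fun_eq_iff)
  qed
qed

end

section \<open>Comparison of the diamond product with the recursive product\<close>

lemma rev_cochain_eta:
  "(\<lambda>w. fst P (rev w)) = fst (rev_cochain P)" "(\<lambda>w. snd P (rev w)) = snd (rev_cochain P)"
  by (simp_all add: fun_eq_iff)

context vector_space
begin

interpretation self: vector_space_pair scale scale ..

lemma cochains_word_facts:
  assumes "P \<in> cochains scale scale p"
  shows "word_alt scale scale (fst P)" "word_alt scale scale (\<lambda>w. snd P w x)"
    "Vector_Spaces.linear scale scale (snd P w)"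
    "length w \<noteq> p \<Longrightarrow> fst P w = 0" "length w \<noteq> p \<Longrightarrow> snd P w = 0" "p = 0 \<Longrightarrow> fst P = 0"
    "word_alt scale scale (fst (rev_cochain P))" "word_alt scale scale (\<lambda>w. snd (rev_cochain P) w x)"
    "additive (snd P w)"
  using assms unfolding self.cochains_iff rev_cochain_eta[symmetric]
  by (simp_all add: cochain_support_def word_alt_rev[of _ _ "fst P"] word_alt_rev[of _ _ "\<lambda>w. snd P w x"]
      additive_def Vector_Spaces.linear_iff)

lemma pre_bracket_cochains:
  assumes P: "P \<in> cochains scale scale p" and Q: "Q \<in> cochains scale scale q"
  shows "pre_bracket q P Q \<in> cochains scale scale (p + q)"
proof -
  note Pf = cochains_word_facts[OF P] and Qf = cochains_word_facts[OF Q]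
  let ?P = "rev_cochain P" and ?Q = "rev_cochain Q"
  have lin: "Vector_Spaces.linear scale scale (snd ?P w)" "Vector_Spaces.linear scale scale (snd ?Q w)" for w
    using Pf Qf by simp_all
  have c0: "coder q (snd ?Q) F w = 0" if "length w \<noteq> p + q" and "\<And>u. length u \<noteq> p \<Longrightarrow> F u = 0"
    for w and F :: "('b \<times> 'b) list \<Rightarrow> 'c::ab_group_add"
    using coder_cong[of q w F "\<lambda>_. 0"] that by auto
  have l0: "lconv q (snd ?P) (snd ?Q) w = 0" if "length w \<noteq> p + q" for w
  proof -
    have "lconv q (snd ?P) (snd ?Q) w = lunsh (\<lambda>A B. 0) w"
      unfolding lconv_def by (rule unshuffle_cong_length) (use that Pf in auto)
    then show ?thesis by simp
  qed
  have h0: "hconv q (snd ?P) (fst ?Q) w = 0" if "length w \<noteq> p + q" for w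
  proof (cases w)
    case (Cons X v)
    have "hconv q (snd ?P) (fst ?Q) w = lunsh (\<lambda>A B. 0) v"
      unfolding Cons hconv.simps by (rule unshuffle_cong_length) (use that Cons Pf in auto)
    then show ?thesis by simp
  qed simp
  have "cochain_support (p + q) (pre_bracket q P Q)"
    unfolding cochain_support_def
  proof (intro conjI allI impI)
    fix Xs :: "('b \<times> 'b) list"
    assume "length Xs \<noteq> p + q"
    then show "fst (pre_bracket q P Q) Xs = 0" "snd (pre_bracket q P Q) Xs = 0"
      using c0[of "rev Xs" "fst ?P"] c0[of "rev Xs" "snd ?P"] l0 h0 Pf(4,5)
      by (simp_all add: pre_bracket_def wdiamond_def fun_eq_iff)
  next
    assume "p + q = 0"
    then have "hconv q (snd ?P) (fst ?Q) w = 0" for w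
      by (cases w) simp_all
    moreover have "fst ?P = (\<lambda>w. 0)"
      using Pf(6) \<open>p + q = 0\<close> by (simp add: fun_eq_iff)
    ultimately show "fst (pre_bracket q P Q) = 0"
      by (intro ext) (simp add: pre_bracket_def wdiamond_def)
  qed
  moreover have "word_alt scale scale (fst (pre_bracket q P Q))"
    unfolding pre_bracket_def wdiamond_def rev_cochain_def[of "(_, _)"] fst_conv snd_conv
    by (intro word_alt_rev self.word_alt_add self.word_alt_coder word_alt_hconv Pf(7,8) Qf(7,8) lin)
  moreover have "word_alt scale scale (\<lambda>Xs. snd (pre_bracket q P Q) Xs x)" for x
    unfolding pre_bracket_def wdiamond_def rev_cochain_def[of "(_, _)"] fst_conv snd_conv plus_fun_apply coder_apply
    by (intro word_alt_rev self.word_alt_add self.word_alt_coder word_alt_lconv Pf(7,8) Qf(7,8) lin)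
  moreover have "Vector_Spaces.linear scale scale (snd (pre_bracket q P Q) Xs)" for Xs
  proof -
    have "Vector_Spaces.linear scale scale (lconv q (snd ?P) (snd ?Q) (rev Xs))"
      by (rule linear_lconv[OF lin])
    moreover have "Vector_Spaces.linear scale scale (coder q (snd ?Q) (snd ?P) (rev Xs))"
      by (rule coder_closed[OF linear_subgroup]) (rule lin(1))
    ultimately show ?thesis
      using linear_subgroup by (simp add: pre_bracket_def wdiamond_def subgroup_pred_def)
  qed
  ultimately show ?thesis
    unfolding self.cochains_iff by blast
qed

text \<open>The letter acted on, at position \<open>m\<close> in reading order, cuts the list into
  the earlier letters, which are shuffled, and the later ones, which stay in place. The summand of
  index \<open>j\<close> has \<open>m = j + q\<close>.\<close>

lemma coder_eq_diamond_insert: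
  assumes len: "length Xs = p + q"
  shows "coder q (snd (rev_cochain Q)) (\<lambda>w. F (rev w)) (rev Xs) = diamond_insert scale p q F Q Xs"
    and "q = 0 \<Longrightarrow> coder q (snd (rev_cochain Q)) (\<lambda>w. F (rev w)) (rev Xs)
      = (\<Sum>k<p. case Xs ! k of (x, y) \<Rightarrow> F (Xs[k := (snd Q [] x, y)]) + F (Xs[k := (x, snd Q [] y)]))"
proof -
  define T where "T m = lunsh (\<lambda>A B. if length B = q
      then wedge_act (snd Q (rev B)) (\<lambda>Y. F (rev A @ Y # drop (Suc m) Xs)) (Xs ! m) else 0) (rev (take m Xs))" for m
  have "coder q (snd (rev_cochain Q)) (\<lambda>w. F (rev w)) (rev Xs) = (\<Sum>k<p + q. T (p + q - Suc k))"
    unfolding coder_sum length_rev len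
  proof (rule sum.cong[OF refl])
    fix k
    assume "k \<in> {..<p + q}"
    then have k: "k < length Xs" "length Xs - k = Suc (length Xs - Suc k)"
      by (simp_all add: len)
    show "lunsh (\<lambda>A B. if length B = q then wedge_act (snd (rev_cochain Q) B) (\<lambda>Y. F (rev (take k (rev Xs) @ Y # A))) (rev Xs ! k) else 0)
        (drop (Suc k) (rev Xs)) = T (p + q - Suc k)"
      using k unfolding T_def len[symmetric] by (simp add: take_rev drop_rev rev_nth cong: if_cong)
  qed
  also have "\<dots> = (\<Sum>m<p + q. T m)"
    by (rule sum.nat_diff_reindex)
  finally have coder: "coder q (snd (rev_cochain Q)) (\<lambda>w. F (rev w)) (rev Xs) = (\<Sum>m<p + q. T m)" .
  \<comment> \<open>Fewer than \<open>q\<close> letters precede position \<open>m\<close>, so there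
    is nothing for \<open>Q\<close> to consume; this accounts for the shift of the index by
    \<open>q\<close>.\<close>
  have T0: "T m = 0" if "m < q" for m
  proof -
    have "T m = lunsh (\<lambda>A B. 0) (rev (take m Xs))"
      unfolding T_def by (rule unshuffle_cong_length) (use that len in auto)
    then show ?thesis by simp
  qed
  have "(\<Sum>m<n + q. T m) = (\<Sum>m<q. T m) + (\<Sum>j<n. T (j + q))" for n
    by (induction n) (simp_all add: add.assoc)
  then have "(\<Sum>m<p + q. T m) = (\<Sum>m<q. T m) + (\<Sum>j<p. T (j + q))"
    .
  also have "\<dots> = (\<Sum>j<p. T (j + q))"
    by (simp add: T0)
  also have "\<dots> = diamond_insert scale p q F Q Xs"
    unfolding diamond_insert_def
  proof (intro sum.cong refl)
    fix j
    assume "j \<in> {..<p}"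
    then have l: "length (take (j + q) Xs) = j + q"
      using len by simp
    obtain x y where X: "Xs ! (j + q) = (x, y)"
      by (cases "Xs ! (j + q)")
    define Rs where "Rs = drop (j + q + 1) Xs"
    let ?H = "\<lambda>As Bs. F (As @ (snd Q Bs x, y) # Rs) + F (As @ (x, snd Q Bs y) # Rs)"
    have "T (j + q) = lunsh (\<lambda>A B. if length B = q then ?H (rev A) (rev B) else 0) (rev (take (j + q) Xs))"
      unfolding T_def by (rule unshuffle_cong) (simp add: wedge_act_def X Rs_def)
    also have "\<dots> = (\<Sum>\<sigma>\<in>shuffle_perms j q. scale ((- 1) ^ (j * q) * of_int (sign \<sigma>))
      (?H (take j (permute_list \<sigma> (take (j + q) Xs))) (drop j (permute_list \<sigma> (take (j + q) Xs)))))"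
      by (rule signed_shuffle_sum[OF module_axioms l, symmetric])
    finally show "T (j + q) = (\<Sum>\<sigma>\<in>shuffle_perms j q. scale ((- 1) ^ (j * q) * of_int (sign \<sigma>))
        (let Ys = permute_list \<sigma> (take (j + q) Xs); As = take j Ys; Bs = drop j Ys;
             (x, y) = Xs ! (j + q); Rs = drop (j + q + 1) Xs
         in F (As @ (snd Q Bs x, y) # Rs) + F (As @ (x, snd Q Bs y) # Rs)))"
      by (simp add: X Rs_def Let_def)
  qed
  finally show "coder q (snd (rev_cochain Q)) (\<lambda>w. F (rev w)) (rev Xs) = diamond_insert scale p q F Q Xs"
    using coder by simp
  show "coder q (snd (rev_cochain Q)) (\<lambda>w. F (rev w)) (rev Xs)
      = (\<Sum>k<p. case Xs ! k of (x, y) \<Rightarrow> F (Xs[k := (snd Q [] x, y)]) + F (Xs[k := (x, snd Q [] y)]))" if "q = 0"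
    unfolding coder
  proof (rule sum.cong)
    fix k
    assume "k \<in> {..<p}"
    then show "T k = (case Xs ! k of (x, y) \<Rightarrow> F (Xs[k := (snd Q [] x, y)]) + F (Xs[k := (x, snd Q [] y)]))"
      using that len unfolding T_def
      by (simp only: that lunsh_right_empty)
        (auto simp: wedge_act_def upd_conv_take_nth_drop split: prod.split)
  qed (simp add: that)
qed

text \<open>The separate clauses of \<open>diamond\<close> are instances of one formula: in degree 0
  the guards leave a single splitting, with one factor empty.\<close>

lemma diamond_eq_pre_bracket:
  assumes P: "P \<in> cochains scale scale p" and Q: "Q \<in> cochains scale scale q"
  shows "diamond scale p q P Q = pre_bracket q P Q"
proof -
  note Pf = cochains_word_facts[OF P] and Qf = cochains_word_facts[OF Q]
  have supp: "fst (pre_bracket q P Q) Xs = 0" "snd (pre_bracket q P Q) Xs = 0" if "length Xs \<noteq> p + q" for Xs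
    using cochains_word_facts(4,5)[OF pre_bracket_cochains[OF P Q]] that by blast+
  let ?P = "rev_cochain P" and ?Q = "rev_cochain Q"
  have rvP: "fst ?P = (\<lambda>w. fst P (rev w))" "snd ?P = (\<lambda>w. snd P (rev w))"
    by (simp_all add: fun_eq_iff)
  have snd_pre: "snd (pre_bracket q P Q) Xs x = lconv q (snd ?P) (snd ?Q) (rev Xs) x
      + coder q (snd ?Q) (\<lambda>w. snd P (rev w) x) (rev Xs)" for Xs x
    by (simp add: pre_bracket_def wdiamond_def coder_apply rvP)
  have fst_pre: "fst (pre_bracket q P Q) Xs = coder q (snd ?Q) (\<lambda>w. fst P (rev w)) (rev Xs)
      + hconv q (snd ?P) (fst ?Q) (rev Xs)" for Xs
    by (simp add: pre_bracket_def wdiamond_def rvP)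
  have ins0: "p = 0 \<Longrightarrow> diamond_insert scale p q F Q Xs = 0" for F Xs
    by (simp add: diamond_insert_def)
  consider (zero) "p = 0" | (right) "p > 0" "q = 0" | (pos) "p > 0" "q > 0"
    by blast
  then show ?thesis
  proof cases
    case zero
    have s: "snd (pre_bracket q P Q) Xs x = snd P [] (snd Q Xs x)" if "length Xs = q" for Xs x
      unfolding snd_pre lconv_def
      using that zero ins0 coder_eq_diamond_insert(1)[of Xs p q Q]
      by (simp add: lunsh_left_empty)
    have f: "fst (pre_bracket q P Q) Xs = snd P [] (fst Q Xs)" if "length Xs = q" for Xs
    proof (cases "rev Xs")
      case Nil
      then show ?thesis
        using that zero Qf(6) additive.zero[OF Pf(9)[of "[]"]] unfolding fst_pre by simp
    next
      case (Cons X v)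
      have "hconv q (snd ?P) (fst ?Q) (rev Xs)
        = lunsh (\<lambda>A B. if length B = length v then signed (int (length A)) (snd ?P A (fst ?Q (X # B))) else 0) v"
        unfolding Cons hconv.simps
        using that Cons by (intro unshuffle_cong) (auto dest: arg_cong[where f=length])
      also have "\<dots> = snd P [] (fst Q Xs)"
        by (subst lunsh_left_empty) (auto simp flip: Cons)
      finally show ?thesis
        unfolding fst_pre
        using that zero ins0 coder_eq_diamond_insert(1)[of Xs p q Q "fst P"] by simp
    qed
    show ?thesis
    proof (cases "q = 0")
      case True
      have "fst (pre_bracket q P Q) = 0"
        using cochains_word_facts(6)[OF pre_bracket_cochains[OF P Q]] zero True by simp
      moreover have "snd (pre_bracket q P Q) = (\<lambda>Xs. if Xs = [] then snd P [] \<circ> snd Q [] else 0)"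
        using s supp(2) zero True by (auto simp: fun_eq_iff)
      ultimately show ?thesis
        using zero True by (simp add: diamond_def hom_cochain_def prod_eq_iff)
    next
      case False
      then show ?thesis
        using zero s f supp by (auto simp: diamond_def prod_eq_iff fun_eq_iff)
    qed
  next
    case right
    have h: "hconv q (snd ?P) (fst ?Q) w = 0" for w
      using right by (cases w) simp_all
    have l: "lconv q (snd ?P) (snd ?Q) w x = snd P (rev w) (snd Q [] x)" for w x
      using right by (simp add: lconv_def lunsh_right_empty[simplified])
    have "fst (pre_bracket q P Q) Xs = (\<Sum>k<p. let (x, y) = Xs ! k in fst P (Xs[k := (snd Q [] x, y)]) + fst P (Xs[k := (x, snd Q [] y)]))"
      if "length Xs = p" for Xs
      using coder_eq_diamond_insert(2)[of Xs p q Q "fst P"] that right unfolding fst_pre h by simp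
    moreover have "snd (pre_bracket q P Q) Xs z = (\<Sum>k<p. let (x, y) = Xs ! k in snd P (Xs[k := (snd Q [] x, y)]) z + snd P (Xs[k := (x, snd Q [] y)]) z)
        + snd P Xs (snd Q [] z)" if "length Xs = p" for Xs z
      using coder_eq_diamond_insert(2)[of Xs p q Q "\<lambda>w. snd P w z"] that right unfolding snd_pre l by (simp add: add.commute)
    ultimately show ?thesis
      using right supp by (simp add: diamond_def prod_eq_iff fun_eq_iff Let_def)
  next
    case pos
    have l: "lconv q (snd ?P) (snd ?Q) (rev Xs) x = (\<Sum>\<sigma>\<in>shuffle_perms p q. scale ((- 1) ^ (p * q) * of_int (sign \<sigma>))
        (let Ys = permute_list \<sigma> Xs in snd P (take p Ys) (snd Q (drop p Ys) x)))" if "length Xs = p + q" for Xs x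
      unfolding Let_def signed_shuffle_sum[OF module_axioms that, of "\<lambda>A B. snd P A (snd Q B x)"]
      by (auto simp: lconv_def unshuffle_apply intro!: unshuffle_cong)
    \<comment> \<open>A shuffle that fixes the last position is a shuffle of type
      \<open>(p, q - 1)\<close>. Replacing \<open>q\<close> by \<open>q - 1\<close> in the exponent
      \<open>p * q\<close> leaves a factor of exponent \<open>p\<close>, which is the sign in
      \<open>hconv\<close> of the last letter passing the left factor.\<close>
    have h: "hconv q (snd ?P) (fst ?Q) (rev Xs) = (\<Sum>\<sigma> | \<sigma> \<in> shuffle_perms p q \<and> \<sigma> (p + q - 1) = p + q - 1.
        scale ((- 1) ^ (p * q) * of_int (sign \<sigma>))
                 (let Ys = permute_list \<sigma> Xs in snd P (take p Ys) (fst Q (drop p Ys))))" if len: "length Xs = p + q" for Xs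
    proof -
      obtain q' where q': "q = Suc q'"
        using pos by (cases q) auto
      obtain Ys X where Xs: "Xs = Ys @ [X]"
        using len pos by (cases Xs rule: rev_cases) auto
      have lY: "length Ys = p + q'"
        using len Xs q' by simp
      have "{\<sigma>. \<sigma> \<in> shuffle_perms p q \<and> \<sigma> (p + q - 1) = p + q - 1} = shuffle_perms p q'"
        using shuffle_perms_fix_last[of p q'] by (simp add: q')
      then have "(\<Sum>\<sigma> | \<sigma> \<in> shuffle_perms p q \<and> \<sigma> (p + q - 1) = p + q - 1.
        scale ((- 1) ^ (p * q) * of_int (sign \<sigma>))
                 (let Ys = permute_list \<sigma> Xs in snd P (take p Ys) (fst Q (drop p Ys))))
        = (\<Sum>\<sigma> \<in> shuffle_perms p q'. scale ((- 1) ^ (p * q') * of_int (sign \<sigma>))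
           ((\<lambda>A B. signed (int p) (snd P A (fst Q (B @ [X])))) (take p (permute_list \<sigma> Ys)) (drop p (permute_list \<sigma> Ys))))"
      proof (intro sum.cong, goal_cases)
        case (2 \<sigma>)
        then have "permute_list \<sigma> Xs = permute_list \<sigma> Ys @ [X]"
          unfolding Xs by (intro permute_list_snoc_fix) (use shuffle_perms_permutes lY in metis)
        then show ?case
          by (simp add: lY Let_def q' power_add signed_eq_scale[OF module_axioms, symmetric] mult.commute mult.left_commute)
      qed simp
      also have "\<dots> = lunsh (\<lambda>A B. if length B = q' then signed (int p) (snd P (rev A) (fst Q (rev B @ [X]))) else 0) (rev Ys)"
        by (rule signed_shuffle_sum[OF module_axioms lY])
      also have "\<dots> = hconv q (snd ?P) (fst ?Q) (rev Xs)"
        unfolding Xs rev_append rev.simps append_Nil append_Cons hconv.simps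
        by (rule unshuffle_cong_length) (auto simp: q' lY)
      finally show ?thesis ..
    qed
    have "fst (pre_bracket q P Q) Xs = hconv q (snd ?P) (fst ?Q) (rev Xs) + diamond_insert scale p q (fst P) Q Xs"
      if "length Xs = p + q" for Xs
      using coder_eq_diamond_insert(1)[OF that, of Q "fst P"] unfolding fst_pre by (simp add: add.commute)
    moreover have "snd (pre_bracket q P Q) Xs x = lconv q (snd ?P) (snd ?Q) (rev Xs) x + diamond_insert scale p q (\<lambda>Zs. snd P Zs x) Q Xs"
      if "length Xs = p + q" for Xs x
      using coder_eq_diamond_insert(1)[OF that, of Q "\<lambda>w. snd P w x"] unfolding snd_pre by simp
    ultimately show ?thesis
      using pos supp by (simp add: diamond_def prod_eq_iff fun_eq_iff h l)
  qed
qed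


lemma component_cochain:
  assumes "P \<in> cochains scale scale p"
  shows "cochain_component q P = (if q = p then P else 0)"
  using cochains_word_facts(4,5)[OF assms] by (auto simp: cochain_component_def prod_eq_iff fun_eq_iff)

lemma zero_cochain: "0 \<in> cochains scale scale p"
  by (simp add: self.cochains_iff cochain_support_def self.word_alt_zero self.word_alt_zero[folded zero_fun_def] Vector_Spaces.linear_iff vector_space_axioms)

section \<open>Bilinearity of the product and the bracket of cochains\<close>

lemma wedge_act_combination:
  assumes "alt2 scale scale G"
  shows "wedge_act (\<lambda>x. scale c (f x) + g x) G X = scale c (wedge_act f G X) + wedge_act g G X"
  using assms by (simp add: alt2_iff[OF vector_space_axioms vector_space_axioms] wedge_act_def algebra_simps scale_right_distrib)

lemma additive_scale: "additive (scale c)"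
  by (simp add: additive_def scale_right_distrib)

lemma coder_combination_left:
  "coder r Q (\<lambda>u. scale c (F u) + F' u) w = scale c (coder r Q F w) + coder r Q F' w"
  by (simp add: coder_add coder_additive[OF additive_scale])

lemma coder_combination_right:
  assumes "word_alt scale scale F"
  shows "coder r (\<lambda>w x. scale c (Q w x) + Q' w x) F w = scale c (coder r Q F w) + coder r Q' F w"
  using assms
proof (induction w arbitrary: F)
  case (Cons X w)
  have "lunsh (\<lambda>A B. if length B = r then wedge_act (\<lambda>x. scale c (Q B x) + Q' B x) (\<lambda>Y. F (Y # A)) X else 0) w
    = scale c (lunsh (\<lambda>A B. if length B = r then wedge_act (Q B) (\<lambda>Y. F (Y # A)) X else 0) w)
    + lunsh (\<lambda>A B. if length B = r then wedge_act (Q' B) (\<lambda>Y. F (Y # A)) X else 0) w"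
    unfolding unshuffle_additive[OF additive_scale] unshuffle_add[symmetric]
    by (rule unshuffle_cong) (simp add: wedge_act_combination[OF word_altD(1)[OF Cons.prems]])
  then show ?case
    by (simp add: Cons.IH[OF word_altD(2)[OF Cons.prems]] scale_right_distrib)
qed simp

lemma cochain_combination_simps [simp]:
  "fst (cochain_scale scale c P) Xs = scale c (fst P Xs)"
  "snd (cochain_scale scale c P) Xs x = scale c (snd P Xs x)"
  by (simp_all add: cochain_scale_def)

lemma pre_bracket_combination_left:
  "pre_bracket q (cochain_scale scale c P + P') Q = cochain_scale scale c (pre_bracket q P Q) + pre_bracket q P' Q"
proof -
  have sp: "fst (rev_cochain (cochain_scale scale c P + P')) = (\<lambda>w. scale c (fst (rev_cochain P) w) + fst (rev_cochain P') w)"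
     "snd (rev_cochain (cochain_scale scale c P + P')) = (\<lambda>w x. scale c (snd (rev_cochain P) w x) + snd (rev_cochain P') w x)"
    by (simp_all add: fun_eq_iff)
  have h: "hconv q (\<lambda>w x. scale c (S w x) + S' w x) G w = scale c (hconv q S G w) + hconv q S' G w" for S S' G w
  proof (cases w)
    case (Cons X v)
    show ?thesis
      unfolding Cons hconv.simps unshuffle_additive[OF additive_scale] unshuffle_add[symmetric]
      by (rule unshuffle_cong) (simp add: signed_add additive_signed[OF additive_scale])
  qed simp
  have l: "lconv q (\<lambda>w x. scale c (S w x) + S' w x) S'' w x = scale c (lconv q S S'' w x) + lconv q S' S'' w x"
    for S S' w x and S'' :: "('b \<times> 'b) list \<Rightarrow> 'b \<Rightarrow> 'b"
    unfolding lconv_def unshuffle_apply unshuffle_additive[OF additive_scale] unshuffle_add[symmetric]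
    by (rule unshuffle_cong) simp
  show ?thesis
    unfolding prod_eq_iff fun_eq_iff pre_bracket_def wdiamond_def sp h
    by (simp add: l coder_combination_left coder_apply) (simp add: algebra_simps scale_right_distrib rev_cochain_eta)
qed

text \<open>Values of \<open>Q\<close> are inserted into \<open>P\<close>, so linearity in
  \<open>Q\<close> rests on the multilinearity of \<open>P\<close>.\<close>

lemma pre_bracket_combination_right:
  assumes P: "P \<in> cochains scale scale p"
  shows "pre_bracket q P (cochain_scale scale c Q + Q') = cochain_scale scale c (pre_bracket q P Q) + pre_bracket q P Q'"
proof -
  note Pf = cochains_word_facts[OF P]
  have sp: "fst (rev_cochain (cochain_scale scale c Q + Q')) = (\<lambda>w. scale c (fst (rev_cochain Q) w) + fst (rev_cochain Q') w)"
     "snd (rev_cochain (cochain_scale scale c Q + Q')) = (\<lambda>w x. scale c (snd (rev_cochain Q) w x) + snd (rev_cochain Q') w x)"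
    by (simp_all add: fun_eq_iff)
  have lin: "snd P w (scale c x + y) = scale c (snd P w x) + snd P w y" for w x y
    using Pf(3)[of w] by (simp add: Vector_Spaces.linear_iff)
  have h: "hconv q (snd (rev_cochain P)) (\<lambda>w. scale c (G w) + G' w) w
    = scale c (hconv q (snd (rev_cochain P)) G w) + hconv q (snd (rev_cochain P)) G' w" for G G' w
  proof (cases w)
    case (Cons X v)
    show ?thesis
      unfolding Cons hconv.simps unshuffle_additive[OF additive_scale] unshuffle_add[symmetric]
      by (rule unshuffle_cong) (simp add: lin signed_add additive_signed[OF additive_scale])
  qed simp
  have l: "lconv q (snd (rev_cochain P)) (\<lambda>w x. scale c (S w x) + S' w x) w x
    = scale c (lconv q (snd (rev_cochain P)) S w x) + lconv q (snd (rev_cochain P)) S' w x"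
    for w x and S S' :: "('b \<times> 'b) list \<Rightarrow> 'b \<Rightarrow> 'b"
    unfolding lconv_def unshuffle_apply unshuffle_additive[OF additive_scale] unshuffle_add[symmetric]
    by (rule unshuffle_cong) (simp add: lin)
  show ?thesis
    unfolding prod_eq_iff fun_eq_iff pre_bracket_def wdiamond_def sp h coder_combination_right[OF Pf(7)]
    by (simp add: l coder_combination_right[OF Pf(8)[unfolded rev_cochain_simps]] coder_combination_right[OF Pf(8)] coder_apply)
       (simp add: algebra_simps scale_right_distrib rev_cochain_eta)
qed

lemma vector_space_cochain_scale: "vector_space (cochain_scale scale :: 'a \<Rightarrow> ('w, 'b) cochain \<Rightarrow> ('w, 'b) cochain)"
  by unfold_locales (auto simp: prod_eq_iff fun_eq_iff cochain_scale_def algebra_simps scale_right_distrib)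

lemma cochain_scale_signed: "cochain_scale scale ((- 1) ^ n) P = signed (int n) P"
  using signed_eq_scale[OF module_axioms, of "int n"]
  by (auto simp: prod_eq_iff fun_eq_iff signed_def)

lemma LY_bracket_hom_eq:
  assumes "P \<in> cochains scale scale p" "Q \<in> cochains scale scale q"
  shows "LY_bracket_hom scale p q P Q = pre_bracket q P Q - signed (int p * int q) (pre_bracket p Q P)"
  by (simp add: LY_bracket_hom_def diamond_eq_pre_bracket assms cochain_scale_signed)

lemma cochain_scale_zero: "cochain_scale scale 0 P = 0" "cochain_scale scale c 0 = 0"
  by (simp_all add: prod_eq_iff fun_eq_iff cochain_scale_def)

lemma pre_bracket_zero: "pre_bracket q 0 (Q :: ('b, 'b) cochain) = 0"
  using pre_bracket_combination_left[of q 1 0 0 Q] by (simp add: cochain_scale_zero)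
    (simp add: prod_eq_iff fun_eq_iff)

lemma pre_bracket_zero_right:
  assumes "P \<in> cochains scale scale p"
  shows "pre_bracket q P 0 = 0"
  using pre_bracket_combination_right[OF assms, of q 1 0 0] by (simp add: cochain_scale_zero)
    (simp add: prod_eq_iff fun_eq_iff)

text \<open>For homogeneous arguments the sum over pairs of degrees collapses to one pair, and the
  products vanish at lists of any other length.\<close>

lemma LY_bracket_cochains:
  assumes P: "P \<in> cochains scale scale p" and Q: "Q \<in> cochains scale scale q"
  shows "LY_bracket scale P Q = pre_bracket q P Q - signed (int p * int q) (pre_bracket p Q P)"
proof -
  let ?R = "pre_bracket q P Q - signed (int p * int q) (pre_bracket p Q P)"
  have hom: "LY_bracket_hom scale i j (cochain_component i P) (cochain_component j Q) = (if i = p \<and> j = q then ?R else 0)" for i j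
    using LY_bracket_hom_eq[of "cochain_component i P" i "cochain_component j Q" j] P Q
    by (auto simp: component_cochain[OF P] component_cochain[OF Q] zero_cochain pre_bracket_zero pre_bracket_zero_right)
  have supp: "fst ?R Xs = 0" "snd ?R Xs = 0" if "length Xs \<noteq> p + q" for Xs
    using cochains_word_facts(4,5)[OF pre_bracket_cochains[OF P Q]] cochains_word_facts(4,5)[OF pre_bracket_cochains[OF Q P]] that
    by (simp_all add: signed_def add.commute)
  have fin: "finite {(i, j). i + j = (n::nat)}" for n
    by (rule finite_subset[of _ "{..n} \<times> {..n}"]) auto
  have eq: "(\<Sum>(i, j) \<in> {(i, j). i + j = n}. if i = p \<and> j = q then x else 0) = (if p + q = n then x else 0)" for n and x :: 'b
  proof -
    have "(\<Sum>(i, j) \<in> {(i, j). i + j = n}. if i = p \<and> j = q then x else 0)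
      = (\<Sum>y \<in> {(i, j). i + j = n}. if y = (p, q) then x else 0)"
      by (rule sum.cong[OF refl]) (simp split: prod.split)
    then show ?thesis
      by (simp add: sum.delta[OF fin])
  qed
  have "fst (LY_bracket scale P Q) Xs = fst ?R Xs" for Xs
    unfolding LY_bracket_def hom using supp(1)[of Xs] eq[where n = "length Xs" and x = "fst ?R Xs"]
    by (simp add: if_distrib[of fst] if_distrib[of "\<lambda>f. f Xs"] cong: if_cong)
  moreover have "snd (LY_bracket scale P Q) Xs x = snd ?R Xs x" for Xs x
    unfolding LY_bracket_def hom using supp(2)[of Xs] eq[where n = "length Xs" and x = "snd ?R Xs x"]
    by (simp add: if_distrib[of snd] if_distrib[of "\<lambda>f. f Xs x"] cong: if_cong)
  ultimately show ?thesis
    by (simp add: prod_eq_iff fun_eq_iff)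
qed

end

context vector_space_pair
begin

lemma cochains_combination:
  assumes "P \<in> cochains s1 s2 p" "P' \<in> cochains s1 s2 p"
  shows "cochain_scale s2 c P + P' \<in> cochains s1 s2 p"
proof -
  have lin: "Vector_Spaces.linear s2 s2 (s2 c)"
    by (simp add: Vector_Spaces.linear_iff vs2.vector_space_axioms vs2.scale_right_distrib mult.commute)
  have sm: "fst (cochain_scale s2 c P + P') = (\<lambda>Xs. s2 c (fst P Xs) + fst P' Xs)"
    "snd (cochain_scale s2 c P + P') = (\<lambda>Xs x. s2 c (snd P Xs x) + snd P' Xs x)"
    by (auto simp: cochain_scale_def fun_eq_iff)
  have linear: "Vector_Spaces.linear s1 s2 (\<lambda>x. s2 c (f x) + g x)"
    if "Vector_Spaces.linear s1 s2 f" "Vector_Spaces.linear s1 s2 g" for f g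
    using that by (auto simp: Vector_Spaces.linear_iff vs2.scale_right_distrib mult.commute)
  note P = assms(1)[unfolded cochains_iff] and P' = assms(2)[unfolded cochains_iff]
  have "cochain_support p (cochain_scale s2 c P + P')"
    using P P' unfolding cochain_support_def sm by (simp add: fun_eq_iff)
  moreover have "word_alt s1 s2 (fst (cochain_scale s2 c P + P'))"
    unfolding sm using P P' by (intro word_alt_add word_alt_comp_linear[OF _ lin]) simp_all
  moreover have "word_alt s1 s2 (\<lambda>Xs. snd (cochain_scale s2 c P + P') Xs x)" for x
    unfolding sm using P P' by (intro word_alt_add word_alt_comp_linear[OF _ lin]) simp_all
  moreover have "Vector_Spaces.linear s1 s2 (snd (cochain_scale s2 c P + P') Xs)" for Xs
    unfolding sm using P P' by (intro linear) simp_all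
  ultimately show ?thesis
    unfolding cochains_iff by blast
qed

lemma zero_cochain_pair: "0 \<in> cochains s1 s2 p"
  by (simp add: cochains_iff cochain_support_def word_alt_zero word_alt_zero[folded zero_fun_def]
      Vector_Spaces.linear_iff vs1.vector_space_axioms vs2.vector_space_axioms)

lemma LY_graded_combination:
  assumes "P \<in> LY_graded s1 s2 n" "P' \<in> LY_graded s1 s2 n"
  shows "cochain_scale s2 c P + P' \<in> LY_graded s1 s2 n"
  using assms cochains_combination
  by (auto simp: LY_graded_def prod_eq_iff fun_eq_iff cochain_scale_def split: if_splits)

lemma zero_LY_graded: "0 \<in> LY_graded s1 s2 n"
  by (simp add: LY_graded_def zero_cochain_pair)

end

lemma (in vector_space) subspace_iff_combination:
  "subspace S \<longleftrightarrow> 0 \<in> S \<and> (\<forall>c. \<forall>x\<in>S. \<forall>y\<in>S. scale c x + y \<in> S)"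
proof
  assume S: "0 \<in> S \<and> (\<forall>c. \<forall>x\<in>S. \<forall>y\<in>S. scale c x + y \<in> S)"
  have "x + y \<in> S" if "x \<in> S" "y \<in> S" for x y
    using S that scale_one by metis
  moreover have "scale c x \<in> S" if "x \<in> S" for c x
    using S that add.right_neutral by metis
  ultimately show "subspace S"
    using S by (simp add: subspace_def)
qed (auto simp: subspace_def)

section \<open>The graded Lie algebra structure\<close>

locale vector_space_char_0 = vector_space scale
  for scale :: "'k::field_char_0 \<Rightarrow> 'b::ab_group_add \<Rightarrow> 'b"
begin

interpretation self: vector_space_pair scale scale ..

interpretation C: vector_space "cochain_scale scale :: 'k \<Rightarrow> ('b, 'b) cochain \<Rightarrow> ('b, 'b) cochain"
  by (rule vector_space_cochain_scale)

text \<open>Lists of length \<open>m\<close> see only the component of degree \<open>m\<close>, so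
  evaluating a vanishing sum there isolates that component.\<close>

lemma graded_cochains:
  "graded_vector_space (cochain_scale scale :: 'k \<Rightarrow> ('b, 'b) cochain \<Rightarrow> ('b, 'b) cochain) (LY_graded scale scale)"
proof unfold_locales
  show "C.subspace (LY_graded scale scale n)" for n
    by (auto simp: C.subspace_iff_combination self.zero_LY_graded self.LY_graded_combination)
  fix I :: "int set" and x :: "int \<Rightarrow> ('b, 'b) cochain" and m
  assume I: "finite I" "\<And>n. n \<in> I \<Longrightarrow> x n \<in> LY_graded scale scale n" "(\<Sum>n\<in>I. x n) = 0" "m \<in> I"
  show "x m = 0"
  proof (cases "m < 0")
    case True
    then show ?thesis
      using I(2)[OF I(4)] by (simp add: LY_graded_def)
  next
    case False
    have n0: "fst (x n) Xs = 0" "snd (x n) Xs = 0" if "n \<in> I" "n \<noteq> m" "length Xs = nat m" for n Xs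
      using I(2)[OF that(1)] cochains_word_facts(4,5)[of "x n" "nat n" Xs] that False
      by (auto simp: LY_graded_def split: if_splits)
    have "fst (x m) Xs = 0" "snd (x m) Xs = 0" for Xs
    proof (atomize (full), cases "length Xs = nat m")
      case True
      have "(\<Sum>n\<in>I. fst (x n) Xs) = fst (x m) Xs" "(\<Sum>n\<in>I. snd (x n) Xs) = snd (x m) Xs"
        using n0 True I(1,4) by (auto simp: sum.remove[of I m])
      moreover have "(\<Sum>n\<in>I. fst (x n) Xs) = fst (\<Sum>n\<in>I. x n) Xs" "(\<Sum>n\<in>I. snd (x n) Xs) = snd (\<Sum>n\<in>I. x n) Xs"
        by (induction I rule: infinite_finite_induct) auto
      ultimately show "fst (x m) Xs = 0 \<and> snd (x m) Xs = 0"
        using I(3) by simp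
    next
      case False
      then show "fst (x m) Xs = 0 \<and> snd (x m) Xs = 0"
        using I(2)[OF I(4)] cochains_word_facts(4,5)[of "x m" "nat m" Xs]
        by (auto simp: LY_graded_def split: if_splits)
    qed
    then show ?thesis
      by (simp add: prod_eq_iff fun_eq_iff)
  qed
qed

interpretation G: graded_vector_space "cochain_scale scale :: 'k \<Rightarrow> ('b, 'b) cochain \<Rightarrow> ('b, 'b) cochain"
  "LY_graded scale scale"
  by (rule graded_cochains)

lemma component_combination:
  "cochain_component p (cochain_scale scale c P + P')
    = cochain_scale scale c (cochain_component p P) + cochain_component p P'"
  by (auto simp: cochain_component_def prod_eq_iff fun_eq_iff)

lemma component_total_space:
  assumes "P \<in> G.total_space"
  shows "cochain_component p P \<in> cochains scale scale p"
  using assms unfolding G.total_space_def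
proof (induction rule: C.span_induct_alt)
  case base
  have "cochain_component p (0 :: ('b, 'b) cochain) = 0"
    by (auto simp: cochain_component_def prod_eq_iff fun_eq_iff)
  then show ?case
    by (simp add: zero_cochain)
next
  case (step c x y)
  then obtain n where "x \<in> LY_graded scale scale n"
    by blast
  then have "x \<in> cochains scale scale (nat n) \<or> x = 0"
    by (auto simp: LY_graded_def split: if_splits)
  then have "cochain_component p x \<in> cochains scale scale p"
    using component_cochain[of x "nat n" p] component_cochain[OF zero_cochain, of p p] zero_cochain[of p] by auto
  then show ?case
    using step.IH by (simp add: component_combination self.cochains_combination)
qed

lemma LY_bracket_combination:
  assumes "P \<in> G.total_space" "P' \<in> G.total_space" "Q \<in> G.total_space"
  shows "LY_bracket scale (cochain_scale scale c P + P') Q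
      = cochain_scale scale c (LY_bracket scale P Q) + LY_bracket scale P' Q"
    and "LY_bracket scale Q (cochain_scale scale c P + P')
      = cochain_scale scale c (LY_bracket scale Q P) + LY_bracket scale Q P'"
proof -
  note comp = component_total_space[OF assms(1)] component_total_space[OF assms(2)] component_total_space[OF assms(3)]
  have sgs: "signed n (cochain_scale scale c R) = cochain_scale scale c (signed n R)" for n and R :: "('b, 'b) cochain"
    by (simp add: signed_def)
  have 1: "LY_bracket_hom scale p q (cochain_component p (cochain_scale scale c P + P')) (cochain_component q Q)
    = cochain_scale scale c (LY_bracket_hom scale p q (cochain_component p P) (cochain_component q Q))
    + LY_bracket_hom scale p q (cochain_component p P') (cochain_component q Q)" for p q
    unfolding component_combination
    by (simp add: LY_bracket_hom_eq comp self.cochains_combination pre_bracket_combination_left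
        pre_bracket_combination_right[OF comp(3)] signed_add sgs C.scale_right_diff_distrib)
  have 2: "LY_bracket_hom scale p q (cochain_component p Q) (cochain_component q (cochain_scale scale c P + P'))
    = cochain_scale scale c (LY_bracket_hom scale p q (cochain_component p Q) (cochain_component q P))
    + LY_bracket_hom scale p q (cochain_component p Q) (cochain_component q P')" for p q
    unfolding component_combination
    by (simp add: LY_bracket_hom_eq comp self.cochains_combination pre_bracket_combination_left
        pre_bracket_combination_right[OF comp(3)] signed_add sgs C.scale_right_diff_distrib)
  show "LY_bracket scale (cochain_scale scale c P + P') Q
      = cochain_scale scale c (LY_bracket scale P Q) + LY_bracket scale P' Q"
    unfolding LY_bracket_def 1
    by (simp add: prod_eq_iff fun_eq_iff case_prod_unfold sum.distrib scale_sum_right)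
  show "LY_bracket scale Q (cochain_scale scale c P + P')
      = cochain_scale scale c (LY_bracket scale Q P) + LY_bracket scale Q P'"
    unfolding LY_bracket_def 2
    by (simp add: prod_eq_iff fun_eq_iff case_prod_unfold sum.distrib scale_sum_right)
qed

lemma cochain_wadditive:
  assumes "P \<in> cochains scale scale p"
  shows "wadditive (rev_cochain P)"
proof -
  have "word_additive (snd (rev_cochain P))"
    using cochains_word_facts(8)[OF assms]
    by (auto simp: word_additive_def biadd_def additive_def fun_eq_iff word_alt_def alt2_iff[OF vector_space_axioms vector_space_axioms])
  then show ?thesis
    using word_alt_additive[OF cochains_word_facts(7)[OF assms]] cochains_word_facts(9)[OF assms]
    by (simp add: wadditive_def)
qed

lemma pre_bracket_associator:
  assumes "P \<in> cochains scale scale p" "Q \<in> cochains scale scale q" "R \<in> cochains scale scale r"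
  shows "pre_bracket r (pre_bracket q P Q) R - pre_bracket (q + r) P (pre_bracket r Q R)
    = signed (int q * int r) (pre_bracket q (pre_bracket r P R) Q - pre_bracket (q + r) P (pre_bracket q R Q))"
proof -
  have e: "pre_bracket r (pre_bracket q P Q) R - pre_bracket (q + r) P (pre_bracket r Q R)
    = rev_cochain (wassociator q r (rev_cochain P) (rev_cochain Q) (rev_cochain R))" for q r Q R
    by (simp add: wassociator_def pre_bracket_def prod_eq_iff fun_eq_iff)
  have "rev_cochain (signed n S) = signed n (rev_cochain S)" for n and S :: "('b, 'b) cochain"
    by (simp add: prod_eq_iff fun_eq_iff signed_def)
  then show ?thesis
    using wassociator_sym[of "rev_cochain P" "rev_cochain Q" "rev_cochain R" q r] cochain_wadditive assms
    by (simp add: e e[of q r R Q, unfolded add.commute[of r q]])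
qed

lemma diff_signed_cochain: "P - signed n P' = cochain_scale scale (- ((- 1) powi n)) P' + (P :: ('b, 'b) cochain)"
  by (simp add: signed_eq_scale[OF C.module_axioms] C.scale_minus_left)

lemma pre_bracket_diff_left:
  "pre_bracket q (P - signed n P') Q = pre_bracket q P Q - signed n (pre_bracket q P' (Q :: ('b, 'b) cochain))"
  unfolding diff_signed_cochain by (rule pre_bracket_combination_left)

lemma pre_bracket_diff_right:
  assumes "P \<in> cochains scale scale p"
  shows "pre_bracket q P (Q - signed n Q') = pre_bracket q P Q - signed n (pre_bracket q P Q')"
  unfolding diff_signed_cochain by (rule pre_bracket_combination_right[OF assms])

lemma LY_bracket_closed:
  assumes "P \<in> cochains scale scale p" "Q \<in> cochains scale scale q"
  shows "LY_bracket scale P Q \<in> cochains scale scale (p + q)"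
  unfolding LY_bracket_cochains[OF assms] diff_signed_cochain
  using pre_bracket_cochains[OF assms] pre_bracket_cochains[OF assms(2,1)]
  by (intro self.cochains_combination) (simp_all add: add.commute)

text \<open>The commutator of a graded right pre-Lie product satisfies the Jacobi identity.\<close>

lemma LY_bracket_Jacobi:
  assumes P: "P \<in> cochains scale scale p" and Q: "Q \<in> cochains scale scale q" and R: "R \<in> cochains scale scale r"
  shows "LY_bracket scale P (LY_bracket scale Q R)
    = LY_bracket scale (LY_bracket scale P Q) R + signed (int p * int q) (LY_bracket scale Q (LY_bracket scale P R))"
proof -
  have expand: "LY_bracket scale P (LY_bracket scale Q R)
    = (pre_bracket (q + r) P (pre_bracket r Q R) - signed (int q * int r) (pre_bracket (q + r) P (pre_bracket q R Q)))
    - signed (int p * int q + int p * int r) (pre_bracket p (pre_bracket r Q R) P - signed (int q * int r) (pre_bracket p (pre_bracket q R Q) P))"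
    if "P \<in> cochains scale scale p" "Q \<in> cochains scale scale q" "R \<in> cochains scale scale r" for p q r P Q R
    unfolding LY_bracket_cochains[OF that(1) LY_bracket_closed[OF that(2,3)]]
    unfolding LY_bracket_cochains[OF that(2,3)]
    by (simp add: pre_bracket_diff_left pre_bracket_diff_right[OF that(1)] distrib_left)
  have expand': "LY_bracket scale (LY_bracket scale P Q) R
    = (pre_bracket r (pre_bracket q P Q) R - signed (int p * int q) (pre_bracket r (pre_bracket p Q P) R))
    - signed (int p * int r + int q * int r) (pre_bracket (p + q) R (pre_bracket q P Q) - signed (int p * int q) (pre_bracket (p + q) R (pre_bracket p Q P)))"
    unfolding LY_bracket_cochains[OF LY_bracket_closed[OF P Q] R]
    unfolding LY_bracket_cochains[OF P Q]
    by (simp add: pre_bracket_diff_left pre_bracket_diff_right[OF R] distrib_right)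
  \<comment> \<open>One associator is named for each choice of the first argument. The symmetry of
    associators expresses the two orders of the remaining arguments by the same element, so all
    products bracketed to the right can be eliminated.\<close>
  define a where "a = pre_bracket q (pre_bracket r P R) Q - pre_bracket (q + r) P (pre_bracket q R Q)"
  define b where "b = pre_bracket p (pre_bracket r Q R) P - pre_bracket (p + r) Q (pre_bracket p R P)"
  define c where "c = pre_bracket p (pre_bracket q R Q) P - pre_bracket (p + q) R (pre_bracket p Q P)"
  have a: "pre_bracket (q + r) P (pre_bracket q R Q) = pre_bracket q (pre_bracket r P R) Q - a"
    "pre_bracket (q + r) P (pre_bracket r Q R) = pre_bracket r (pre_bracket q P Q) R - signed (int q * int r) a"
    using pre_bracket_associator[OF P Q R] by (simp_all add: a_def algebra_simps)
  have b: "pre_bracket (p + r) Q (pre_bracket p R P) = pre_bracket p (pre_bracket r Q R) P - b"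
    "pre_bracket (p + r) Q (pre_bracket r P R) = pre_bracket r (pre_bracket p Q P) R - signed (int p * int r) b"
    using pre_bracket_associator[OF Q P R] by (simp_all add: b_def algebra_simps)
  have c: "pre_bracket (p + q) R (pre_bracket p Q P) = pre_bracket p (pre_bracket q R Q) P - c"
    "pre_bracket (p + q) R (pre_bracket q P Q) = pre_bracket q (pre_bracket p R P) Q - signed (int p * int q) c"
    using pre_bracket_associator[OF R P Q] by (simp_all add: c_def algebra_simps)
  show ?thesis
    unfolding expand[OF P Q R] expand' expand[OF Q P R] a b c
    by (cases "even p"; cases "even q"; cases "even r") (simp_all add: signed_def)
qed

theorem LY_graded_Lie_algebra:
  "graded_Lie_algebra (cochain_scale scale) (LY_graded scale scale) (LY_bracket scale)"
proof (unfold_locales)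
  fix x y z :: "('b, 'b) cochain" and c
  assume "x \<in> G.total_space" "y \<in> G.total_space" "z \<in> G.total_space"
  then show "LY_bracket scale (x + y) z = LY_bracket scale x z + LY_bracket scale y z"
      "LY_bracket scale x (y + z) = LY_bracket scale x y + LY_bracket scale x z"
    using LY_bracket_combination[of x y z 1] LY_bracket_combination[of y z x 1] by simp_all
next
  fix x y :: "('b, 'b) cochain" and c
  assume xy: "x \<in> G.total_space" "y \<in> G.total_space"
  have 0: "0 \<in> G.total_space"
    unfolding G.total_space_def by (rule C.span_zero)
  have "LY_bracket scale 0 y = 0" "LY_bracket scale x 0 = 0"
    using LY_bracket_combination[OF 0 0, of y 1] LY_bracket_combination[OF 0 0, of x 1] xy by simp_all
  then show "LY_bracket scale (cochain_scale scale c x) y = cochain_scale scale c (LY_bracket scale x y)"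
      "LY_bracket scale x (cochain_scale scale c y) = cochain_scale scale c (LY_bracket scale x y)"
    using LY_bracket_combination[OF xy(1) 0 xy(2), of c] LY_bracket_combination[OF xy(2) 0 xy(1), of c] by simp_all
next
  \<comment> \<open>Components of negative degree consist of 0, to which the formulas for cochains
    do not apply directly.\<close>
  have zero_l: "LY_bracket scale 0 y = 0" and zero_r: "LY_bracket scale y 0 = 0"
    if "y \<in> LY_graded scale scale n" for y :: "('b, 'b) cochain" and n
  proof -
    obtain q where "y \<in> cochains scale scale q"
      using \<open>y \<in> LY_graded scale scale n\<close> zero_cochain by (auto simp: LY_graded_def split: if_splits)
    then show "LY_bracket scale 0 y = 0" "LY_bracket scale y 0 = 0"
      using LY_bracket_cochains[OF zero_cochain[of 0]] LY_bracket_cochains[OF _ zero_cochain[of 0]]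
      by (simp_all add: pre_bracket_zero pre_bracket_zero_right)
  qed
  have scale_signed: "cochain_scale scale ((- 1) powi n) x = signed n x" for n and x :: "('b, 'b) cochain"
    by (rule signed_eq_scale[OF C.module_axioms])
  fix x y :: "('b, 'b) cochain" and m n
  assume xy: "x \<in> LY_graded scale scale m" "y \<in> LY_graded scale scale n"
  consider "x = 0 \<or> y = 0" | "m \<ge> 0" "n \<ge> 0" "x \<in> cochains scale scale (nat m)" "y \<in> cochains scale scale (nat n)"
    using xy by (auto simp: LY_graded_def split: if_splits)
  then have "LY_bracket scale x y \<in> LY_graded scale scale (m + n) \<and>
      LY_bracket scale x y = - signed (m * n) (LY_bracket scale y x)"
  proof cases
    case 1
    then show ?thesis
      using zero_l[OF xy(1)] zero_r[OF xy(1)] zero_l[OF xy(2)] zero_r[OF xy(2)] self.zero_LY_graded[of "m + n"]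
      by (elim disjE) simp_all
  next
    case 2
    then show ?thesis
      using LY_bracket_closed[OF 2(3,4)] LY_bracket_cochains[OF 2(3,4)] LY_bracket_cochains[OF 2(4,3)]
      by (simp add: LY_graded_def nat_add_distrib signed_def)
  qed
  then show "LY_bracket scale x y \<in> LY_graded scale scale (m + n)"
      "LY_bracket scale x y = - cochain_scale scale ((- 1) powi (m * n)) (LY_bracket scale y x)"
    unfolding scale_signed by blast+
  fix z :: "('b, 'b) cochain" and k
  assume z: "z \<in> LY_graded scale scale k"
  consider "x = 0 \<or> y = 0 \<or> z = 0" | "m \<ge> 0" "n \<ge> 0" "k \<ge> 0" "x \<in> cochains scale scale (nat m)" "y \<in> cochains scale scale (nat n)"
      "z \<in> cochains scale scale (nat k)"
    using xy z by (auto simp: LY_graded_def split: if_splits)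
  then show "LY_bracket scale x (LY_bracket scale y z)
    = LY_bracket scale (LY_bracket scale x y) z + cochain_scale scale ((- 1) powi (m * n)) (LY_bracket scale y (LY_bracket scale x z))"
  proof cases
    case 1
    have z0: "LY_bracket scale 0 0 = (0 :: ('b, 'b) cochain)"
      by (rule zero_l[OF self.zero_LY_graded])
    have closed: "LY_bracket scale u v \<in> LY_graded scale scale (i + j)"
      if "u \<in> LY_graded scale scale i" "v \<in> LY_graded scale scale j" for u v :: "('b, 'b) cochain" and i j
      using that LY_bracket_closed[of u "nat i" v "nat j"] zero_l[OF that(2)] zero_r[OF that(1)]
      by (auto simp: LY_graded_def nat_add_distrib zero_cochain split: if_splits)
    show ?thesis
      unfolding scale_signed using 1
        zero_l[OF xy(1)] zero_r[OF xy(1)] zero_l[OF xy(2)] zero_r[OF xy(2)] zero_l[OF z] zero_r[OF z]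
        zero_l[OF closed[OF xy]] zero_r[OF closed[OF xy]] zero_l[OF closed[OF xy(1) z]] zero_r[OF closed[OF xy(1) z]]
        zero_l[OF closed[OF xy(2) z]] zero_r[OF closed[OF xy(2) z]] z0
      by (elim disjE) simp_all
  next
    case 2
    then show ?thesis
      using LY_bracket_Jacobi[OF 2(4-6)] by (simp add: scale_signed)
  qed
qed

end

section \<open>Derived brackets of V-data\<close>

context graded_vector_space
begin

lemma component_in_total: "x \<in> L n \<Longrightarrow> x \<in> total_space"
  unfolding total_space_def by (auto intro: span_base)

lemma total_space_zero: "0 \<in> total_space"
  unfolding total_space_def by (rule span_zero)

lemma total_space_combination: "x \<in> total_space \<Longrightarrow> y \<in> total_space \<Longrightarrow> scale c x + y \<in> total_space"
  unfolding total_space_def by (intro span_add span_scale)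

lemma total_space_induct [consumes 1, case_names zero combination]:
  assumes "x \<in> total_space" and zero: "P 0"
    and step: "\<And>c a b n. a \<in> L n \<Longrightarrow> b \<in> total_space \<Longrightarrow> P b \<Longrightarrow> P (scale c a + b)"
  shows "P x"
proof -
  have "x \<in> total_space \<and> P x"
    using assms(1)[unfolded total_space_def]
  proof (induction rule: span_induct_alt)
    case base
    then show ?case
      using zero total_space_zero by blast
  next
    case (step c a b)
    then obtain n where "a \<in> L n"
      by blast
    then show ?case
      using step.IH assms(3) total_space_combination component_in_total by blast
  qed
  then show ?thesis ..
qed

end

context graded_Lie_algebra
begin

lemma br_combination:
  assumes "x \<in> total_space" "y \<in> total_space" "z \<in> total_space"
  shows "br (scale c x + y) z = scale c (br x z) + br y z"
    and "br z (scale c x + y) = scale c (br z x) + br z y"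
  using assms total_space_combination[of x 0 c] total_space_zero
  by (simp_all add: br_add_left br_add_right br_scale_left br_scale_right)

lemma br_zero: "x \<in> total_space \<Longrightarrow> br 0 x = 0" "x \<in> total_space \<Longrightarrow> br x 0 = 0"
  using br_scale_left[OF total_space_zero, of x 0] br_scale_right[OF _ total_space_zero, of x 0] by simp_all

lemma br_total: 
  assumes "x \<in> total_space" "y \<in> total_space"
  shows "br x y \<in> total_space"
proof -
  have hom: "br u y \<in> total_space" if u: "u \<in> L m" for u m
    using assms(2)
  proof (induction rule: total_space_induct)
    case zero
    show ?case
      using br_zero(2)[OF component_in_total[OF u]] total_space_zero by simp
  next
    case (combination c a b n)
    then show ?case
      using br_combination(2)[of a b u c] component_in_total u
        component_in_total[OF br_degree[OF u, of a n]] total_space_combination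
      by simp
  qed
  show ?thesis
    using assms(1)
  proof (induction rule: total_space_induct)
    case zero
    show ?case
      using br_zero(1)[OF assms(2)] total_space_zero by simp
  next
    case (combination c a b n)
    then show ?case
      using br_combination(1)[of a b y c] component_in_total assms(2) hom[of a n] total_space_combination
      by simp
  qed
qed

lemma br_antisym_signed: "x \<in> L m \<Longrightarrow> y \<in> L n \<Longrightarrow> br x y = - signed (m * n) (br y x)"
  by (rule br_antisym[unfolded signed_eq_scale[OF module_axioms]])

lemma br_Jacobi_signed: "x \<in> L m \<Longrightarrow> y \<in> L n \<Longrightarrow> z \<in> L k \<Longrightarrow>
    br x (br y z) = br (br x y) z + signed (m * n) (br y (br x z))"
  by (rule br_Jacobi[unfolded signed_eq_scale[OF module_axioms]])

lemma br_signed: 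
  assumes "x \<in> total_space" "y \<in> total_space"
  shows "br (signed n x) y = signed n (br x y)" "br x (signed n y) = signed n (br x y)"
  using br_scale_left[OF assms, of "(- 1) powi n"] br_scale_right[OF assms, of "(- 1) powi n"]
  by (simp_all add: signed_eq_scale[OF module_axioms])

text \<open>The Jacobi identity in the form needed for repeated bracketing from the right:
  bracketing with \<open>a\<close> is a derivation that passes \<open>v\<close> before it reaches
  \<open>u\<close>.\<close>

lemma br_derivation:
  assumes u: "u \<in> L m" and v: "v \<in> L n" and a: "a \<in> L k"
  shows "br (br u v) a = br u (br v a) + signed (n * k) (br (br u a) v)"
proof -
  have "br v (br u a) = - signed (n * (m + k)) (br (br u a) v)"
    by (rule br_antisym_signed[OF v br_degree[OF u a]])
  then have "br u (br v a) = br (br u v) a - signed (m * n + n * (m + k)) (br (br u a) v)"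
    using br_Jacobi_signed[OF u v a] by simp
  moreover have "signed (m * n + n * (m + k)) x = signed (n * k) x" for x :: 'v
    by (rule signed_cong) auto
  ultimately show ?thesis by simp
qed

end

text \<open>Letters carry a degree because an element alone does not determine one (0 has every
  degree). The head is bracketed last, so these words are read as in
  \<open>unshuffle\<close>.\<close>

definition iterated_bracket :: "('v \<Rightarrow> 'v \<Rightarrow> 'v) \<Rightarrow> 'v \<Rightarrow> ('v \<times> int) list \<Rightarrow> 'v" where
  "iterated_bracket br u w = foldr (\<lambda>X v. br v (fst X)) w u"

lemma iterated_bracket_simps [simp]:
  "iterated_bracket br u [] = u"
  "iterated_bracket br u (X # w) = br (iterated_bracket br u w) (fst X)"
  by (simp_all add: iterated_bracket_def)

lemma foldl_eq_iterated_bracket: "foldl br u (map fst (rev w)) = iterated_bracket br u w"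
  by (induction w) simp_all

context V_data
begin

lemma A_subspace: "subspace (A n)" and A_subset: "A n \<subseteq> L n"
  using subalgebra by (auto simp: graded_Lie_subalgebra_def)

lemma A_graded: "graded_vector_space scale A"
proof unfold_locales
  show "subspace (A n)" for n
    by (rule A_subspace)
  show "x m = 0" if "finite I" "\<And>n. n \<in> I \<Longrightarrow> x n \<in> A n" "(\<Sum>n\<in>I. x n) = 0" "m \<in> I" for I x m
    using components_independent[of I x m] that A_subset by blast
qed

interpretation A: graded_vector_space scale A
  by (rule A_graded)

lemma A_total_subset: "A.total_space \<subseteq> total_space"
  unfolding A.total_space_def total_space_def using A_subset by (intro span_mono) blast

lemma \<Delta>_total: "\<Delta> \<in> total_space"
  by (rule component_in_total[OF \<Delta>_kernel(1)])

lemma p_zero: "p 0 = 0"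
  using p_scale[OF total_space_zero, of 0] by simp

lemma p_signed: "x \<in> total_space \<Longrightarrow> p (signed n x) = signed n (p x)"
  using p_scale[of x "(- 1) powi n"] by (simp add: signed_eq_scale[OF module_axioms])

definition A_word :: "('v \<times> int) list \<Rightarrow> bool" where
  "A_word w \<longleftrightarrow> (\<forall>X\<in>set w. fst X \<in> A (snd X))"

lemma iterated_bracket_degree:
  assumes "u \<in> L n" "A_word w"
  shows "iterated_bracket br u w \<in> L (n + total_degree snd w)"
  using assms(2)
proof (induction w)
  case (Cons X w)
  then have "iterated_bracket br u w \<in> L (n + total_degree snd w)" "fst X \<in> L (snd X)"
    using A_subset by (auto simp: A_word_def)
  then show ?case
    using br_degree by (fastforce simp: algebra_simps)
qed (simp add: assms(1))

lemma A_word_split: "A_word w \<Longrightarrow> mset A' + mset B = mset w \<Longrightarrow> A_word A' \<and> A_word B"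
  using mset_split_facts(3)[of A' B w] by (auto simp: A_word_def)

lemma unshuffle_in_total:
  assumes "\<And>A' B. mset A' + mset B = mset w \<Longrightarrow> H A' B \<in> total_space"
  shows "unshuffle d H w \<in> total_space"
proof -
  have "subgroup_pred (\<lambda>x. x \<in> total_space)"
    unfolding subgroup_pred_def total_space_def by (auto intro: span_add span_neg span_zero)
  then show ?thesis
    by (rule unshuffle_closed) (rule assms)
qed

text \<open>The bracket and the projection are only known to be additive on the total space, which
  therefore has to contain every summand.\<close>

lemma linear_unshuffle:
  assumes "\<And>A' B. mset A' + mset B = mset w \<Longrightarrow> H A' B \<in> total_space"
    and f: "\<And>x y. x \<in> total_space \<Longrightarrow> y \<in> total_space \<Longrightarrow> f (x + y) = f x + f y"
    and fs: "\<And>n x. x \<in> total_space \<Longrightarrow> f (signed n x) = signed n (f x)"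
  shows "f (unshuffle d H w) = unshuffle d (\<lambda>A' B. f (H A' B)) w"
  using assms(1)
proof (induction w arbitrary: H)
  case (Cons X w)
  have signed_total: "signed n x \<in> total_space" if "x \<in> total_space" for n x
    using that unfolding signed_def total_space_def by (auto intro: span_neg)
  have 1: "H (X # A') B \<in> total_space" "H A' (X # B) \<in> total_space" if "mset A' + mset B = mset w" for A' B
    using that Cons.prems by simp_all
  have "f (unshuffle d (\<lambda>A' B. H (X # A') B) w) = unshuffle d (\<lambda>A' B. f (H (X # A') B)) w"
    by (rule Cons.IH) (rule 1)
  moreover have "f (unshuffle d (\<lambda>A' B. signed (d X * total_degree d A') (H A' (X # B))) w)
      = unshuffle d (\<lambda>A' B. f (signed (d X * total_degree d A') (H A' (X # B)))) w"
    by (rule Cons.IH) (rule signed_total, rule 1)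
  moreover have "\<dots> = unshuffle d (\<lambda>A' B. signed (d X * total_degree d A') (f (H A' (X # B)))) w"
    by (rule unshuffle_cong) (simp add: fs 1)
  ultimately show ?case
    by (simp add: f unshuffle_in_total 1 signed_total)
qed simp

text \<open>The Leibniz rule for many letters: \<open>B\<close> collects those that fall on
  \<open>u\<close>. Each of them passes \<open>v\<close>, of degree \<open>n\<close>, whence the
  extra sign.\<close>

lemma iterated_bracket_br:
  assumes u: "u \<in> L m" and v: "v \<in> L n" and w: "A_word w"
  shows "iterated_bracket br (br u v) w
    = unshuffle snd (\<lambda>A' B. signed (n * total_degree snd B) (br (iterated_bracket br u B) (iterated_bracket br v A'))) w"
  using w
proof (induction w)
  case (Cons X w)
  then have w: "A_word w" and X: "fst X \<in> A (snd X)"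
    by (simp_all add: A_word_def)
  then have XL: "fst X \<in> L (snd X)"
    using A_subset by blast
  have hom: "iterated_bracket br u B \<in> L (m + total_degree snd B)" "iterated_bracket br v A' \<in> L (n + total_degree snd A')"
    if "mset A' + mset B = mset w" for A' B
    using A_word_split[OF w that] iterated_bracket_degree u v by blast+
  have signed_total: "signed k x \<in> total_space" if "x \<in> total_space" for k x
    using that unfolding signed_def total_space_def by (auto intro: span_neg)
  have total: "signed (n * total_degree snd B) (br (iterated_bracket br u B) (iterated_bracket br v A')) \<in> total_space"
    if "mset A' + mset B = mset w" for A' B
    by (intro signed_total br_total) (use hom[OF that] component_in_total in blast)+
  have "iterated_bracket br (br u v) (X # w)
    = br (unshuffle snd (\<lambda>A' B. signed (n * total_degree snd B) (br (iterated_bracket br u B) (iterated_bracket br v A'))) w) (fst X)"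
    using Cons.IH[OF w] by simp
  also have "\<dots> = unshuffle snd (\<lambda>A' B. br (signed (n * total_degree snd B) (br (iterated_bracket br u B) (iterated_bracket br v A'))) (fst X)) w"
    by (rule linear_unshuffle[OF total])
       (simp_all add: br_add_left br_signed component_in_total[OF XL])
  also have "\<dots> = unshuffle snd (\<lambda>A' B. signed (n * total_degree snd B) (br (iterated_bracket br u B) (br (iterated_bracket br v A') (fst X)))
      + signed (snd X * total_degree snd A') (signed (n * total_degree snd (X # B)) (br (br (iterated_bracket br u B) (fst X)) (iterated_bracket br v A')))) w"
  proof (rule unshuffle_cong)
    fix A' B
    assume split: "mset A' + mset B = mset w"
    note h = hom[OF split]
    have "br (signed (n * total_degree snd B) (br (iterated_bracket br u B) (iterated_bracket br v A'))) (fst X)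
      = signed (n * total_degree snd B) (br (br (iterated_bracket br u B) (iterated_bracket br v A')) (fst X))"
      by (intro br_signed component_in_total[OF XL] component_in_total[OF br_degree[OF h]])
    also have "\<dots> = signed (n * total_degree snd B) (br (iterated_bracket br u B) (br (iterated_bracket br v A') (fst X)))
      + signed (n * total_degree snd B + (n + total_degree snd A') * snd X) (br (br (iterated_bracket br u B) (fst X)) (iterated_bracket br v A'))"
      unfolding br_derivation[OF h XL] by (simp add: signed_add)
    finally show "br (signed (n * total_degree snd B) (br (iterated_bracket br u B) (iterated_bracket br v A'))) (fst X)
      = signed (n * total_degree snd B) (br (iterated_bracket br u B) (br (iterated_bracket br v A') (fst X)))
      + signed (snd X * total_degree snd A') (signed (n * total_degree snd (X # B)) (br (br (iterated_bracket br u B) (fst X)) (iterated_bracket br v A')))"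
      by (simp add: algebra_simps)
  qed
  finally show ?case
    by (simp add: unshuffle_add)
qed simp

text \<open>The term with the bracket of \<open>a\<close> and \<open>b\<close> in the Leibniz rule
  vanishes.\<close>

lemma swap_abelian:
  assumes u: "u \<in> L m" and a: "a \<in> A i" and b: "b \<in> A j"
  shows "br (br u a) b = signed (i * j) (br (br u b) a)"
proof -
  have "a \<in> L i" "b \<in> L j"
    using a b A_subset by blast+
  then show ?thesis
    using br_derivation[OF u, of a i b j] abelian[OF a b] br_zero(2)[OF component_in_total[OF u]] by simp
qed

lemma iterated_bracket_swap:
  assumes u: "u \<in> L m" and b: "b \<in> A j" and w: "A_word w"
  shows "iterated_bracket br (br u b) w = signed (j * total_degree snd w) (br (iterated_bracket br u w) b)"
  using w
proof (induction w)
  case (Cons X w)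
  then have w: "A_word w" and X: "fst X \<in> A (snd X)"
    by (simp_all add: A_word_def)
  note h = iterated_bracket_degree[OF u w]
  have bL: "b \<in> L j" and XL: "fst X \<in> L (snd X)"
    using b X A_subset by blast+
  have "iterated_bracket br (br u b) (X # w) = signed (j * total_degree snd w) (br (br (iterated_bracket br u w) b) (fst X))"
    using Cons.IH[OF w] by (simp add: br_signed component_in_total[OF XL] component_in_total[OF br_degree[OF h bL]])
  also have "\<dots> = signed (j * total_degree snd w + j * snd X) (br (br (iterated_bracket br u w) (fst X)) b)"
    by (simp add: swap_abelian[OF h b X])
  finally show ?case
    by (simp add: algebra_simps)
qed simp

text \<open>
  Expand \<open>p[x - p x, y - p y] = 0\<close>; the term \<open>[p x, p y]\<close> vanishes.
\<close>

lemma p_br: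
  assumes x: "x \<in> L m" and y: "y \<in> L n"
  shows "p (br x y) = p (br (p x) y) + p (br x (p y))"
proof -
  have pL: "p x \<in> A m" "p y \<in> A n" "p x \<in> L m" "p y \<in> L n"
    using p_range[OF x] p_range[OF y] A_subset by auto
  note T = component_in_total[OF x] component_in_total[OF y] component_in_total[OF pL(3)] component_in_total[OF pL(4)]
  have p_sub: "p (u - v) = p u - p v" if "u \<in> total_space" "v \<in> total_space" for u v
    using that p_add[of "scale (- 1) v" u] p_scale[of v "- 1"] total_space_combination[of v 0 "- 1"] total_space_zero by simp
  have "x - p x \<in> L m" "y - p y \<in> L n"
    using x y pL component_subspace by (auto intro: subspace_diff)
  moreover have "p (x - p x) = 0" "p (y - p y) = 0"
    using p_sub T p_projection pL by simp_all
  ultimately have "p (br (x - p x) (y - p y)) = 0"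
    using kernel_subalgebra unfolding graded_Lie_subalgebra_def by blast
  moreover have "br x y = br (x - p x) (y - p y) + br (p x) y + br x (p y)"
    using T br_combination(1)[of "p x" x "y - p y" "- 1"] br_combination(2)[of "p y" y x "- 1"] br_combination(2)[of "p y" y "p x" "- 1"]
      abelian[OF pL(1,2)] total_space_combination[OF T(4) T(2), of "- 1"] by simp
  moreover have "br (x - p x) (y - p y) \<in> total_space"
    using T total_space_combination[OF T(3) T(1), of "- 1"] total_space_combination[OF T(4) T(2), of "- 1"]
    by (intro br_total) simp_all
  ultimately show ?thesis
    using T total_space_combination[of "br (x - p x) (y - p y)" "br (p x) y" 1] by (simp add: p_add br_total)
qed

end

section \<open>The L-infinity relations for the derived brackets\<close>

lemma unshuffle_sum: "unshuffle d (\<lambda>A B. \<Sum>i\<in>I. H i A B) w = (\<Sum>i\<in>I. unshuffle d (H i) w)"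
  by (induction I rule: infinite_finite_induct) (simp_all add: unshuffle_add)

lemma derived_bracket_foldl:
  assumes "length xs = k" "1 \<le> k" "k \<le> 3"
  shows "derived_bracket br p \<Delta> k xs = p (foldl br \<Delta> xs)"
proof -
  consider "k = 1" | "k = 2" | "k = 3"
    using assms by linarith
  then show ?thesis
  proof cases
    case 1
    then show ?thesis
      using assms by (auto simp: derived_bracket_def length_Suc_conv)
  next
    case 2
    then show ?thesis
      using assms by (auto simp: derived_bracket_def length_Suc_conv numeral_2_eq_2)
  next
    case 3
    then show ?thesis
      using assms by (auto simp: derived_bracket_def length_Suc_conv numeral_3_eq_3)
  qed
qed

lemma derived_bracket_ge_4: "4 \<le> k \<Longrightarrow> derived_bracket br p \<Delta> k xs = 0"
  by (simp add: derived_bracket_def)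

context graded_Lie_algebra
begin

lemma foldl_br_combination:
  assumes "u \<in> total_space" "v \<in> total_space" "set xs \<subseteq> total_space"
  shows "foldl br (scale c u + v) xs = scale c (foldl br u xs) + foldl br v xs"
  using assms by (induction xs arbitrary: u v) (simp_all add: br_combination br_total)

lemma foldl_br_total: "u \<in> total_space \<Longrightarrow> set xs \<subseteq> total_space \<Longrightarrow> foldl br u xs \<in> total_space"
  by (induction xs arbitrary: u) (simp_all add: br_total)

lemma foldl_br_update:
  assumes "u \<in> total_space" "set xs \<subseteq> total_space" "x \<in> total_space" "y \<in> total_space" "i < length xs"
  shows "foldl br u (xs[i := scale c x + y]) = scale c (foldl br u (xs[i := x])) + foldl br u (xs[i := y])"
  using assms
proof (induction xs arbitrary: u i)
  case (Cons a xs)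
  then show ?case
    by (cases i) (simp_all add: br_combination br_total foldl_br_combination)
qed simp

end

lemma inversion_exponent_two:
  "inversion_exponent [i, j] \<sigma> = (if \<sigma> 1 < \<sigma> 0 then [i, j] ! \<sigma> 0 * [i, j] ! \<sigma> 1 else 0)"
proof -
  have "{(a, b). a < b \<and> b < length [i, j] \<and> \<sigma> b < \<sigma> a} = (if \<sigma> 1 < \<sigma> 0 then {(0, 1)} else {})"
    by (auto simp: less_Suc_eq numeral_2_eq_2)
  then show ?thesis
    by (simp add: inversion_exponent_def)
qed

lemma inversion_exponent_three:
  "inversion_exponent [i, j, k] \<sigma> = (if \<sigma> 1 < \<sigma> 0 then [i, j, k] ! \<sigma> 0 * [i, j, k] ! \<sigma> 1 else 0)
     + (if \<sigma> 2 < \<sigma> 0 then [i, j, k] ! \<sigma> 0 * [i, j, k] ! \<sigma> 2 else 0)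
     + (if \<sigma> 2 < \<sigma> 1 then [i, j, k] ! \<sigma> 1 * [i, j, k] ! \<sigma> 2 else 0)"
proof -
  let ?f = "\<lambda>x. [i, j, k] ! \<sigma> (fst x) * [i, j, k] ! \<sigma> (snd x)"
  have "{(a, b). a < b \<and> b < length [i, j, k] \<and> \<sigma> b < \<sigma> a}
    = {x \<in> {(0, 1), (0, 2), (1, 2)}. \<sigma> (snd x) < \<sigma> (fst x)}"
    by (auto simp: less_Suc_eq numeral_2_eq_2)
  moreover have "(\<Sum>x \<in> {x \<in> {(0, 1), (0, 2), (1, 2)}. \<sigma> (snd x) < \<sigma> (fst x)}. ?f x)
    = (\<Sum>x \<in> {(0, 1), (0, 2), (1, 2)}. if \<sigma> (snd x) < \<sigma> (fst x) then ?f x else 0)"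
    by (rule sum.inter_filter) simp
  ultimately show ?thesis
    by (simp add: inversion_exponent_def case_prod_unfold)
qed

context V_data
begin

interpretation A: graded_vector_space scale A
  by (rule A_graded)

text \<open>The two terms in the expansion of \<open>p\<close> on a bracket contribute equal sums:
  exchanging the subwords and applying antisymmetry turns one into the other. Hence twice the sum is
  zero.\<close>

lemma Jacobi_unshuffle:
  assumes w: "A_word w"
  shows "unshuffle snd (\<lambda>A' B. signed (total_degree snd B)
    (p (br (p (iterated_bracket br \<Delta> B)) (iterated_bracket br \<Delta> A')))) w = 0"
proof -
  let ?ad = "iterated_bracket br \<Delta>"
  define T where "T = unshuffle snd (\<lambda>A' B. signed (total_degree snd B) (p (br (p (?ad B)) (?ad A')))) w"
  have hom: "?ad B \<in> L (1 + total_degree snd B)" "?ad A' \<in> L (1 + total_degree snd A')"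
    if "mset A' + mset B = mset w" for A' B
    using A_word_split[OF w that] iterated_bracket_degree \<Delta>_kernel(1) by blast+
  have phom: "p (?ad B) \<in> L (1 + total_degree snd B)" "p (?ad A') \<in> L (1 + total_degree snd A')"
    if "mset A' + mset B = mset w" for A' B
    using hom[OF that] p_range A_subset by blast+
  have signed_total: "signed k x \<in> total_space" if "x \<in> total_space" for k x
    using that unfolding signed_def total_space_def by (auto intro: span_neg)
  have "iterated_bracket br 0 w = 0" if "A_word w" for w
    using that by (induction w) (use A_subset component_in_total br_zero(1) in \<open>force simp: A_word_def\<close>)+
  then have "0 = iterated_bracket br (br \<Delta> \<Delta>) w"
    using w \<Delta>_square by simp
  also have "\<dots> = unshuffle snd (\<lambda>A' B. signed (total_degree snd B) (br (?ad B) (?ad A'))) w"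
    using iterated_bracket_br[OF \<Delta>_kernel(1) \<Delta>_kernel(1) w] by simp
  finally have "0 = p (unshuffle snd (\<lambda>A' B. signed (total_degree snd B) (br (?ad B) (?ad A'))) w)"
    by (simp add: p_zero)
  also have "\<dots> = unshuffle snd (\<lambda>A' B. p (signed (total_degree snd B) (br (?ad B) (?ad A')))) w"
    by (rule linear_unshuffle) (auto intro: signed_total component_in_total br_degree[OF hom] simp: p_add p_signed)
  also have "\<dots> = unshuffle snd (\<lambda>A' B. signed (total_degree snd B) (p (br (p (?ad B)) (?ad A')))
      + signed (total_degree snd B) (p (br (?ad B) (p (?ad A'))))) w"
  proof (rule unshuffle_cong)
    fix A' B
    assume split: "mset A' + mset B = mset w"
    show "p (signed (total_degree snd B) (br (?ad B) (?ad A'))) = signed (total_degree snd B) (p (br (p (?ad B)) (?ad A')))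
      + signed (total_degree snd B) (p (br (?ad B) (p (?ad A'))))"
      using p_br[OF hom[OF split]] p_signed[OF component_in_total[OF br_degree[OF hom[OF split]]]] by (simp add: signed_add)
  qed
  also have "\<dots> = T + unshuffle snd (\<lambda>A' B. signed (total_degree snd B) (p (br (?ad B) (p (?ad A'))))) w"
    by (simp add: unshuffle_add T_def)
  also have "unshuffle snd (\<lambda>A' B. signed (total_degree snd B) (p (br (?ad B) (p (?ad A'))))) w
    = unshuffle snd (\<lambda>A' B. signed (total_degree snd A' * total_degree snd B) (signed (total_degree snd A') (p (br (?ad A') (p (?ad B)))))) w"
    by (rule unshuffle_cocomm)
  also have "\<dots> = T"
    unfolding T_def
  proof (rule unshuffle_cong)
    fix A' B
    assume split: "mset A' + mset B = mset w"
    have "br (?ad A') (p (?ad B)) = - signed ((1 + total_degree snd A') * (1 + total_degree snd B)) (br (p (?ad B)) (?ad A'))"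
      by (rule br_antisym_signed[OF hom(2) phom(1)]) (fact split)+
    \<comment> \<open>The minus sign of antisymmetry adds 1 to the exponent; modulo 2 all exponents
      then add up to the degree of \<open>B\<close>.\<close>
    moreover have "- signed k x = signed (k + 1) x" for k and x :: 'v
      by (simp add: signed_def)
    moreover have "br (p (?ad B)) (?ad A') \<in> total_space"
      by (rule component_in_total[OF br_degree[OF phom(1) hom(2)]]) (fact split)+
    ultimately show "signed (total_degree snd A' * total_degree snd B) (signed (total_degree snd A') (p (br (?ad A') (p (?ad B)))))
      = signed (total_degree snd B) (p (br (p (?ad B)) (?ad A')))"
      by (simp add: p_signed) (rule signed_cong, auto)
  qed
  finally have "scale 2 T = 0"
    using scale_left_distrib[of 1 1 T] by simp
  then show ?thesis
    by (simp add: T_def)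
qed

text \<open>Adjacent arguments may be exchanged because \<open>A\<close> is abelian. With at most
  three arguments every permutation can be written out and its sign compared.\<close>

lemma derived_bracket_symmetric:
  assumes "length xs = k" "length ds = k" "\<And>i. i < k \<Longrightarrow> xs ! i \<in> A (ds ! i)" and \<sigma>: "\<sigma> permutes {..<k}"
    and k: "1 \<le> k" "k \<le> 3"
  shows "p (foldl br \<Delta> (permute_list \<sigma> xs)) = signed (inversion_exponent ds \<sigma>) (p (foldl br \<Delta> xs))"
proof -
  have less: "\<sigma> i < k" if "i < k" for i
    using that permutes_in_image[OF \<sigma>, of i] by auto
  have inj: "\<sigma> i \<noteq> \<sigma> j" if "i \<noteq> j" for i j
    using that permutes_inj[OF \<sigma>] by (auto dest: injD)
  have A_total: "x \<in> total_space" if "x \<in> A n" for x n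
    using that A_subset component_in_total by blast
  have A_L: "x \<in> L n" if "x \<in> A n" for x n
    using that A_subset by blast
  consider "k = 1" | "k = 2" | "k = 3"
    using k by linarith
  then show ?thesis
  proof cases
    case 1
    then have "{..<k} = {0}"
      by auto
    then have "\<sigma> = id"
      using \<sigma> by (simp only: permutes_sing)
    moreover have "inversion_exponent ds id = 0"
      unfolding inversion_exponent_def by (rule sum.neutral) auto
    ultimately show ?thesis
      by simp
  next
    case 2
    then obtain a b i j where xs: "xs = [a, b]" "ds = [i, j]"
      using assms(1,2) by (auto simp: length_Suc_conv numeral_2_eq_2)
    then have ab: "a \<in> A i" "b \<in> A j"
      using assms(3)[of 0] assms(3)[of 1] 2 by simp_all
    have "br (br \<Delta> b) a = signed (i * j) (br (br \<Delta> a) b)"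
      using swap_abelian[OF \<Delta>_kernel(1) ab(2,1)] by (simp add: mult.commute)
    then have swap: "p (br (br \<Delta> b) a) = signed (i * j) (p (br (br \<Delta> a) b))"
      using p_signed[of "br (br \<Delta> a) b"] by (simp add: br_total \<Delta>_total A_total[OF ab(1)] A_total[OF ab(2)])
    have "(\<sigma> 0 = 0 \<and> \<sigma> 1 = 1) \<or> (\<sigma> 0 = 1 \<and> \<sigma> 1 = 0)"
      using less[of 0] less[of 1] inj[of 0 1] 2 by linarith
    then show ?thesis
      using swap by (auto simp: xs permute_list_def inversion_exponent_two mult.commute)
  next
    case 3
    then obtain a b c i j l where xs: "xs = [a, b, c]" "ds = [i, j, l]"
      using assms(1,2) by (auto simp: length_Suc_conv numeral_3_eq_3)
    then have abc: "a \<in> A i" "b \<in> A j" "c \<in> A l"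
      using assms(3)[of 0] assms(3)[of 1] assms(3)[of 2] 3 by simp_all
    define T where "T x y z = p (br (br (br \<Delta> x) y) z)" for x y z
    have T1: "T x y z = signed (m * n) (T y x z)" if "x \<in> A m" "y \<in> A n" "z \<in> A q" for x y z m n q
      using swap_abelian[OF \<Delta>_kernel(1) that(1,2)] p_signed[of "br (br (br \<Delta> y) x) z"]
      by (simp add: T_def br_signed br_total \<Delta>_total A_total[OF that(1)] A_total[OF that(2)] A_total[OF that(3)])
    have T2: "T x y z = signed (n * q) (T x z y)" if "x \<in> A m" "y \<in> A n" "z \<in> A q" for x y z m n q
      using swap_abelian[OF br_degree[OF \<Delta>_kernel(1) A_L[OF that(1)]] that(2,3)] p_signed[of "br (br (br \<Delta> x) z) y"]
      by (simp add: T_def br_total \<Delta>_total A_total[OF that(1)] A_total[OF that(2)] A_total[OF that(3)])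
    have T: "T b a c = signed (j * i) (T a b c)" "T a c b = signed (l * j) (T a b c)"
      "T b c a = signed (l * i + j * i) (T a b c)" "T c a b = signed (l * i + l * j) (T a b c)"
      "T c b a = signed (l * j + (l * i + j * i)) (T a b c)"
      using T1[OF abc(2,1,3)] T2[OF abc(1,3,2)] T2[OF abc(2,3,1)] T1[OF abc(3,1,2)] T1[OF abc(3,2,1)] by simp_all
    have "\<sigma> 0 = 0 \<or> \<sigma> 0 = 1 \<or> \<sigma> 0 = 2" "\<sigma> 1 = 0 \<or> \<sigma> 1 = 1 \<or> \<sigma> 1 = 2" "\<sigma> 2 = 0 \<or> \<sigma> 2 = 1 \<or> \<sigma> 2 = 2"
      using less[of 0] less[of 1] less[of 2] 3 by linarith+
    moreover have "\<sigma> 0 \<noteq> \<sigma> 1" "\<sigma> 0 \<noteq> \<sigma> 2" "\<sigma> 1 \<noteq> \<sigma> 2"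
      by (rule inj, simp)+
    ultimately have "(\<sigma> 0 = 0 \<and> \<sigma> 1 = 1 \<and> \<sigma> 2 = 2) \<or> (\<sigma> 0 = 0 \<and> \<sigma> 1 = 2 \<and> \<sigma> 2 = 1) \<or>
      (\<sigma> 0 = 1 \<and> \<sigma> 1 = 0 \<and> \<sigma> 2 = 2) \<or> (\<sigma> 0 = 1 \<and> \<sigma> 1 = 2 \<and> \<sigma> 2 = 0) \<or>
      (\<sigma> 0 = 2 \<and> \<sigma> 1 = 0 \<and> \<sigma> 2 = 1) \<or> (\<sigma> 0 = 2 \<and> \<sigma> 1 = 1 \<and> \<sigma> 2 = 0)"
      by (elim disjE) simp_all
    then have "T ([a, b, c] ! \<sigma> 0) ([a, b, c] ! \<sigma> 1) ([a, b, c] ! \<sigma> 2) = signed (inversion_exponent ds \<sigma>) (T a b c)"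
      by (elim disjE conjE; simp only: xs inversion_exponent_three; simp add: T add_ac)
    then show ?thesis
      by (simp add: T_def xs permute_list_def upt_rec numeral_2_eq_2)
  qed
qed

text \<open>By \<open>vanish\<close>, the truncated brackets agree with the derived brackets of
  every arity, so the relations of all arities are projections of iterated brackets.\<close>

theorem derived_L_infinity:
  assumes vanish: "\<And>w. A_word w \<Longrightarrow> 4 \<le> length w \<Longrightarrow> p (iterated_bracket br \<Delta> w) = 0"
  shows "L_infinity_algebra scale A (derived_bracket br p \<Delta>)"
proof unfold_locales
  let ?l = "derived_bracket br p \<Delta>"
  \<comment> \<open>The first argument of a bracket is bracketed first and so becomes the last entry
    of the word.\<close>
  have word: "A_word (rev (zip xs ds)) \<and> map fst (rev (rev (zip xs ds))) = xs \<and> total_degree snd (rev (zip xs ds)) = sum_list ds"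
    if "length xs = k" "length ds = k" "\<And>i. i < k \<Longrightarrow> xs ! i \<in> A (ds ! i)" for k xs ds
    using that by (auto simp: A_word_def set_zip rev_map[symmetric])
  have l_eq: "?l k (map fst (rev w)) = p (iterated_bracket br \<Delta> w)"
    if "A_word w" "length w = k" "1 \<le> k" for w k
  proof (cases "k \<le> 3")
    case True
    then show ?thesis
      using that derived_bracket_foldl[of "map fst (rev w)" k br p \<Delta>] by (simp add: foldl_eq_iterated_bracket)
  next
    case False
    then show ?thesis
      using that vanish by (simp add: derived_bracket_ge_4)
  qed
  show "?l k (xs[i := scale c x + y]) = scale c (?l k (xs[i := x])) + ?l k (xs[i := y])"
    if k: "1 \<le> k" "length xs = k" "set xs \<subseteq> A.total_space" "i < k" "x \<in> A.total_space" "y \<in> A.total_space"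
    for k xs i c x y
  proof (cases "k \<le> 3")
    case True
    have t: "set xs \<subseteq> total_space" "x \<in> total_space" "y \<in> total_space"
      using that A_total_subset by blast+
    have t': "foldl br \<Delta> (xs[i := z]) \<in> total_space" if "z \<in> total_space" for z
      using that t(1) set_update_subset_insert[of xs i z] by (intro foldl_br_total \<Delta>_total) blast
    show ?thesis
      using True k foldl_br_update[OF \<Delta>_total t, of i c] t'[OF t(2)] t'[OF t(3)]
        total_space_combination[OF t'[OF t(2)] total_space_zero, of c]
      by (simp add: derived_bracket_foldl p_add p_scale)
  next
    case False
    then show ?thesis
      by (simp add: derived_bracket_ge_4)
  qed
  show "?l k xs \<in> A (sum_list ds + 1)"
    if k: "1 \<le> k" "length xs = k" "length ds = k" "\<And>i. i < k \<Longrightarrow> xs ! i \<in> A (ds ! i)" for k xs ds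
    using word[OF k(2-4)] l_eq[of "rev (zip xs ds)" k] k
      p_range[OF iterated_bracket_degree[OF \<Delta>_kernel(1), of "rev (zip xs ds)"]] by (simp add: add.commute)
  show "?l k (permute_list \<sigma> xs) = scale (koszul_sign ds \<sigma>) (?l k xs)"
    if k: "1 \<le> k" "length xs = k" "length ds = k" "\<And>i. i < k \<Longrightarrow> xs ! i \<in> A (ds ! i)" "\<sigma> permutes {..<k}" for k xs ds \<sigma>
    unfolding koszul_sign_eq signed_eq_scale[OF module_axioms]
  proof (cases "k \<le> 3")
    case True
    then show "?l k (permute_list \<sigma> xs) = signed (inversion_exponent ds \<sigma>) (?l k xs)"
      using derived_bracket_symmetric[OF k(2-5,1)] k by (simp add: derived_bracket_foldl)
  next
    case False
    then show "?l k (permute_list \<sigma> xs) = signed (inversion_exponent ds \<sigma>) (?l k xs)"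
      by (simp add: derived_bracket_ge_4)
  qed
  fix N xs ds
  assume N: "1 \<le> N" "length xs = N" "length ds = N" "\<And>i. i < N \<Longrightarrow> xs ! i \<in> A (ds ! i)"
  define Z where "Z = zip xs ds"
  have Z: "A_word (rev Z)" "map fst Z = xs" "map snd Z = ds" "length Z = N"
    using word[OF N(2-4)] N by (simp_all add: Z_def A_word_def)
  let ?H = "\<lambda>as bs. ?l (length bs + 1) (?l (length as) (map fst as) # map fst bs)"
  have inner: "(\<Sum>\<sigma> \<in> shuffle_perms i (N - i). scale (koszul_sign ds \<sigma>)
      (?l (N - i + 1) (?l i (take i (permute_list \<sigma> xs)) # drop i (permute_list \<sigma> xs))))
    = unshuffle snd (\<lambda>A' B. if length B = i then ?H (rev B) (rev A') else 0) (rev Z)"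
    if i: "i \<in> {1..N}" for i
  proof -
    have len: "length Z = i + (N - i)"
      using i Z(4) by simp
    show ?thesis
      unfolding shuffle_sum_eq_unshuffle[OF len, where d = snd and H = ?H, symmetric]
    proof (rule sum.cong[OF refl])
      fix \<sigma>
      assume "\<sigma> \<in> shuffle_perms i (N - i)"
      then have "\<sigma> permutes {..<length Z}"
        using shuffle_perms_permutes len by metis
      then have "map fst (permute_list \<sigma> Z) = permute_list \<sigma> xs"
        using Z(2) by (simp flip: permute_list_map)
      then show "scale (koszul_sign ds \<sigma>) (?l (N - i + 1) (?l i (take i (permute_list \<sigma> xs)) # drop i (permute_list \<sigma> xs)))
        = signed (inversion_exponent (map snd Z) \<sigma>) (?H (take i (permute_list \<sigma> Z)) (drop i (permute_list \<sigma> Z)))"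
        using i Z by (simp add: koszul_sign_eq signed_eq_scale[OF module_axioms] flip: take_map drop_map)
    qed
  qed
  have "(\<Sum>i = 1..N. unshuffle snd (\<lambda>A' B. if length B = i then ?H (rev B) (rev A') else 0) (rev Z))
    = unshuffle snd (\<lambda>A' B. signed (total_degree snd B) (p (br (p (iterated_bracket br \<Delta> B)) (iterated_bracket br \<Delta> A')))) (rev Z)"
    unfolding unshuffle_sum[symmetric]
  proof (rule unshuffle_cong)
    fix A' B
    assume split: "mset A' + mset B = mset (rev Z)"
    have words: "A_word A'" "A_word B"
      using A_word_split[OF Z(1) split] by blast+
    note h = iterated_bracket_degree[OF \<Delta>_kernel(1) words(1)] iterated_bracket_degree[OF \<Delta>_kernel(1) words(2)]
    have len: "length A' + length B = N"
      using mset_split_facts(1)[OF split] Z(4) by simp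
    show "(\<Sum>i = 1..N. if length B = i then ?H (rev B) (rev A') else 0)
      = signed (total_degree snd B) (p (br (p (iterated_bracket br \<Delta> B)) (iterated_bracket br \<Delta> A')))"
    \<comment> \<open>The relation sums from \<open>i = 1\<close>, whereas the splittings include an
      empty \<open>B\<close>; that term is zero because the projection kills \<Delta>.\<close>
    proof (cases "B = []")
      case True
      then show ?thesis
        using \<Delta>_kernel(2) br_zero(1)[OF component_in_total[OF h(1)]] by (simp add: p_zero)
    next
      case False
      let ?b = "p (iterated_bracket br \<Delta> B)"
      have b: "?b \<in> A (1 + total_degree snd B)"
        by (rule p_range[OF h(2)])
      then have bL: "?b \<in> L (1 + total_degree snd B)"
        using A_subset by blast
      have "(\<Sum>i = 1..N. if length B = i then ?H (rev B) (rev A') else 0) = ?H (rev B) (rev A')"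
        using False len by (simp add: sum.delta') (auto simp: Suc_le_eq)
      also have "\<dots> = ?l (length A' + 1) (map fst (rev (A' @ [(?b, 1 + total_degree snd B)])))"
        using False l_eq[OF words(2) refl] by (simp add: Suc_le_eq)
      also have "\<dots> = p (iterated_bracket br \<Delta> (A' @ [(?b, 1 + total_degree snd B)]))"
        by (rule l_eq) (use words(1) b in \<open>auto simp: A_word_def\<close>)
      \<comment> \<open>The inner value is bracketed first. It is moved past \<open>A'\<close> to
        the outside and then, by antisymmetry, to the left; modulo 2 the exponents add up to the
        degree of \<open>B\<close>.\<close>
      also have "iterated_bracket br \<Delta> (A' @ [(?b, 1 + total_degree snd B)]) = iterated_bracket br (br \<Delta> ?b) A'"
        by (simp add: iterated_bracket_def)
      also have "\<dots> = signed ((1 + total_degree snd B) * total_degree snd A') (br (iterated_bracket br \<Delta> A') ?b)"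
        by (rule iterated_bracket_swap[OF \<Delta>_kernel(1) b words(1)])
      also have "br (iterated_bracket br \<Delta> A') ?b = - signed ((1 + total_degree snd A') * (1 + total_degree snd B)) (br ?b (iterated_bracket br \<Delta> A'))"
        by (rule br_antisym_signed[OF h(1) bL])
      finally show ?thesis
        using component_in_total[OF br_degree[OF bL h(1)]]
        by (simp add: signed_def p_signed[of _ 1, unfolded signed_def, simplified])
    qed
  qed
  also have "\<dots> = 0"
    by (rule Jacobi_unshuffle[OF Z(1)])
  finally show "(\<Sum>i = 1..N. \<Sum>\<sigma> \<in> shuffle_perms i (N - i). scale (koszul_sign ds \<sigma>)
      (?l (N - i + 1) (?l i (take i (permute_list \<sigma> xs)) # drop i (permute_list \<sigma> xs)))) = 0"
    using inner by simp
qed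

end

section \<open>Cochains on a direct sum\<close>

text \<open>A relation rather than a function: 0 has both types, and a vector with two nonzero
  components has none.\<close>

definition slot_type :: "nat \<Rightarrow> 'g::zero \<times> 'h::zero \<Rightarrow> bool" where
  "slot_type t x \<longleftrightarrow> (t = 0 \<and> fst x = 0) \<or> (t = 1 \<and> snd x = 0)"

primrec word_type :: "nat \<Rightarrow> (('g::zero \<times> 'h::zero) \<times> ('g \<times> 'h)) list \<Rightarrow> bool" where
  "word_type c [] \<longleftrightarrow> c = 0"
| "word_type c (X # w) \<longleftrightarrow> (\<exists>a b c'. slot_type a (fst X) \<and> slot_type b (snd X) \<and> word_type c' w \<and> c = a + b + c')"

lemma word_type_append: "word_type c (u @ v) \<longleftrightarrow> (\<exists>c1 c2. word_type c1 u \<and> word_type c2 v \<and> c = c1 + c2)"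
proof (induction u arbitrary: c)
  case (Cons X u)
  show ?case
  proof
    assume "word_type c ((X # u) @ v)"
    then obtain a b c1 c2 where "slot_type a (fst X)" "slot_type b (snd X)" "word_type c1 u" "word_type c2 v" "c = a + b + (c1 + c2)"
      by (auto simp: Cons.IH)
    moreover from this have "word_type (a + b + c1) (X # u)"
      by auto
    ultimately show "\<exists>c1 c2. word_type c1 (X # u) \<and> word_type c2 v \<and> c = c1 + c2"
      by (metis add.assoc)
  next
    assume "\<exists>c1 c2. word_type c1 (X # u) \<and> word_type c2 v \<and> c = c1 + c2"
    then obtain a b c1 c2 where "slot_type a (fst X)" "slot_type b (snd X)" "word_type c1 u" "word_type c2 v" "c = a + b + (c1 + c2)"
      by (auto simp: add.assoc)
    then show "word_type c ((X # u) @ v)"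
      by (simp add: Cons.IH) blast
  qed
qed simp

lemma word_type_rev: "word_type c (rev w) \<longleftrightarrow> word_type c w"
proof (induction w arbitrary: c)
  case (Cons X w)
  show ?case
    by (simp add: word_type_append Cons.IH) (metis add.commute)
qed simp

lemma unshuffle_word_type:
  assumes Z: "subgroup_pred Z" and "word_type c w"
    and "\<And>A B c1 c2. word_type c1 A \<Longrightarrow> word_type c2 B \<Longrightarrow> c = c1 + c2 \<Longrightarrow> Z (H A B)"
  shows "Z (unshuffle d H w)"
  using assms(2,3)
proof (induction w arbitrary: c H)
  case (Cons X w)
  obtain a b c' where X: "slot_type a (fst X)" "slot_type b (snd X)" "word_type c' w" "c = a + b + c'"
    using Cons.prems(1) by auto
  have ext: "word_type (a + b + c1) (X # u)" if "word_type c1 u" for c1 u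
    using that X by auto
  have "Z (unshuffle d (\<lambda>A B. H (X # A) B) w)"
    by (rule Cons.IH[OF X(3)], rule Cons.prems(2)[OF ext]) (simp_all add: X(4))
  moreover have "Z (unshuffle d (\<lambda>A B. signed (d X * total_degree d A) (H A (X # B))) w)"
    by (rule Cons.IH[OF X(3)], rule subgroup_pred_signed[OF Z], rule Cons.prems(2)[OF _ ext]) (simp_all add: X(4))
  ultimately show ?case
    using Z by (simp add: subgroup_pred_def)
qed simp

text \<open>
  \<open>R\<close> records which types occur: \<open>(s, c) \<in> R\<close> allows an output component in the first
  (\<open>s = 1\<close>) or second (\<open>s = 0\<close>) summand when exactly \<open>c\<close> inputs come from the first one.
\<close>

definition out_type :: "(nat \<times> nat) set \<Rightarrow> nat \<Rightarrow> 'g::zero \<times> 'h::zero \<Rightarrow> bool" where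
  "out_type R c v \<longleftrightarrow> (fst v \<noteq> 0 \<longrightarrow> (1, c) \<in> R) \<and> (snd v \<noteq> 0 \<longrightarrow> (0, c) \<in> R)"

definition cochain_types :: "(nat \<times> nat) set \<Rightarrow> ('g::zero \<times> 'h::zero, 'g \<times> 'h) cochain \<Rightarrow> bool" where
  "cochain_types R P \<longleftrightarrow> (\<forall>c w. word_type c w \<longrightarrow> out_type R c (fst P w)) \<and>
     (\<forall>c w t x. word_type c w \<longrightarrow> slot_type t x \<longrightarrow> out_type R (c + t) (snd P w x))"

lemma subgroup_out_type: "subgroup_pred (out_type R c :: 'g::ab_group_add \<times> 'h::ab_group_add \<Rightarrow> bool)"
  by (auto simp: subgroup_pred_def out_type_def)

lemma out_type_mono:
  assumes "out_type R c v" "\<And>s. (s, c) \<in> R \<Longrightarrow> (s, c') \<in> R'"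
  shows "out_type R' c' v"
  using assms by (auto simp: out_type_def)

text \<open>The vector is split into its two components. A component of a type not allowed by
  \<open>R\<close> is 0, which \<open>f\<close> sends to 0 in the subgroup.\<close>

lemma out_type_split:
  fixes f :: "'g::ab_group_add \<times> 'h::ab_group_add \<Rightarrow> 'v::ab_group_add"
  assumes Z: "subgroup_pred Z" and f: "additive f" and v: "out_type R c v"
    and "\<And>s y. (s, c) \<in> R \<Longrightarrow> slot_type s y \<Longrightarrow> Z (f y)"
  shows "Z (f v)"
proof -
  have f0: "f (0, 0) = 0"
    using additive.zero[OF f] by (simp add: zero_prod_def)
  have "Z (f (fst v, 0))" "Z (f (0, snd v))"
    using assms(4)[of 1 "(fst v, 0)"] assms(4)[of 0 "(0, snd v)"] v Z f0
    by (auto simp: out_type_def slot_type_def subgroup_pred_def)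
  moreover have "f v = f (fst v, 0) + f (0, snd v)"
    using additive.add[OF f, of "(fst v, 0)" "(0, snd v)"] by simp
  ultimately show ?thesis
    using Z by (simp add: subgroup_pred_def)
qed

text \<open>In each term, \<open>Q\<close> replaces \<open>c2\<close> inputs from the first summand,
  counting the entry it acts on, by one output of type \<open>s\<close>; the word reaching
  \<open>F\<close> therefore has type \<open>c1 + s\<close>.\<close>

lemma coder_types:
  fixes F :: "(('g::ab_group_add \<times> 'h::ab_group_add) \<times> ('g \<times> 'h)) list \<Rightarrow> 'v::ab_group_add"
  assumes Z: "subgroup_pred Z" and "word_additive F" and "word_type c w"
    and Q: "\<And>c w t x. word_type c w \<Longrightarrow> slot_type t x \<Longrightarrow> out_type R (c + t) (Q w x)"
    and "\<And>c1 c2 s u. word_type (c1 + s) u \<Longrightarrow> s \<le> 1 \<Longrightarrow> (s, c2) \<in> R \<Longrightarrow> c = c1 + c2 \<Longrightarrow> Z (F u)"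
  shows "Z (coder r Q F w)"
  using assms(2,3,5)
proof (induction w arbitrary: c F)
  case Nil
  show ?case
    using Z by (simp add: subgroup_pred_def)
next
  case (Cons X w)
  obtain a b c' where X: "slot_type a (fst X)" "slot_type b (snd X)" "word_type c' w" "c = a + b + c'"
    using Cons.prems(2) by auto
  have "Z (coder r Q (\<lambda>u. F (X # u)) w)"
  proof (rule Cons.IH[OF word_additiveD(2)[OF Cons.prems(1)] X(3)])
    fix c1 c2 s and u :: "(('g \<times> 'h) \<times> ('g \<times> 'h)) list"
    assume u: "word_type (c1 + s) u" "s \<le> 1" "(s, c2) \<in> R" "c' = c1 + c2"
    show "Z (F (X # u))"
      by (rule Cons.prems(3)[of "a + b + c1" s _ c2]) (use X u in \<open>auto simp: add.assoc\<close>)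
  qed
  moreover have "Z (lunsh (\<lambda>A B. if length B = r then wedge_act (Q B) (\<lambda>Y. F (Y # A)) X else 0) w)"
  proof (rule unshuffle_word_type[OF Z X(3)])
    fix A B :: "(('g \<times> 'h) \<times> ('g \<times> 'h)) list" and c1 c2
    assume AB: "word_type c1 A" "word_type c2 B" "c' = c1 + c2"
    have biadd: "additive (\<lambda>y. F ((x, y) # A))" "additive (\<lambda>y. F ((y, x) # A))" for x
      using word_additiveD(1)[OF Cons.prems(1), of A] unfolding biadd_def by blast+
    have "Z (F ((Q B (fst X), snd X) # A))"
    proof (rule out_type_split[OF Z biadd(2) Q[OF AB(2) X(1)]])
      fix s and y :: "'g \<times> 'h"
      assume s: "(s, c2 + a) \<in> R" "slot_type s y"
      have "word_type (b + c1 + s) ((y, snd X) # A)"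
        unfolding word_type.simps fst_conv snd_conv using s(2) X(2) AB(1) by (metis add.assoc add.commute)
      then show "Z (F ((y, snd X) # A))"
        by (rule Cons.prems(3)[of _ s _ "c2 + a"]) (use s X AB in \<open>auto simp: slot_type_def\<close>)
    qed
    moreover have "Z (F ((fst X, Q B (snd X)) # A))"
    proof (rule out_type_split[OF Z biadd(1) Q[OF AB(2) X(2)]])
      fix s and y :: "'g \<times> 'h"
      assume s: "(s, c2 + b) \<in> R" "slot_type s y"
      have "word_type (a + c1 + s) ((fst X, y) # A)"
        unfolding word_type.simps fst_conv snd_conv using s(2) X(1) AB(1) by (metis add.assoc add.commute)
      then show "Z (F ((fst X, y) # A))"
        by (rule Cons.prems(3)[of _ s _ "c2 + b"]) (use s X AB in \<open>auto simp: slot_type_def\<close>)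
    qed
    ultimately show "Z (if length B = r then wedge_act (Q B) (\<lambda>Y. F (Y # A)) X else 0)"
      using Z by (simp add: wedge_act_def subgroup_pred_def)
  qed
  ultimately show ?case
    using Z by (simp add: subgroup_pred_def)
qed

text \<open>Every term inserts an output of \<open>Q\<close> into one input of \<open>P\<close>. The
  hypothesis on \<open>R3\<close> says that it contains all types arising from such a
  substitution.\<close>

lemma pre_bracket_types:
  fixes P Q :: "('g::ab_group_add \<times> 'h::ab_group_add, 'g \<times> 'h) cochain"
  assumes P: "cochain_types R1 P" "wadditive (rev_cochain P)" and Q: "cochain_types R2 Q"
    and R3: "\<And>s s' c1 c2. (s, c1 + s') \<in> R1 \<Longrightarrow> (s', c2) \<in> R2 \<Longrightarrow> s' \<le> 1 \<Longrightarrow> (s, c1 + c2) \<in> R3"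
  shows "cochain_types R3 (pre_bracket q P Q)"
proof -
  let ?P = "rev_cochain P" and ?Q = "rev_cochain Q"
  have add: "word_additive (fst ?P)" "word_additive (snd ?P)" "additive (snd ?P w)" for w
    using P(2) by (simp_all add: wadditive_def)
  have p1: "out_type R1 c (fst ?P w)" if "word_type c w" for c w
    using P(1) that unfolding cochain_types_def rev_cochain_simps by (simp only: word_type_rev)
  have p2: "out_type R1 (c + t) (snd ?P w x)" if "word_type c w" "slot_type t x" for c w t x
    using P(1) that unfolding cochain_types_def rev_cochain_simps by (simp only: word_type_rev)
  have q1: "out_type R2 c (fst ?Q w)" if "word_type c w" for c w
    using Q that unfolding cochain_types_def rev_cochain_simps by (simp only: word_type_rev)
  have q2: "out_type R2 (c + t) (snd ?Q w x)" if "word_type c w" "slot_type t x" for c w t x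
    using Q that unfolding cochain_types_def rev_cochain_simps by (simp only: word_type_rev)
  have comp: "out_type R3 (c1 + c2) (snd ?P A v)" if "word_type c1 A" "out_type R2 c2 v" for c1 c2 A v
  proof (rule out_type_split[OF subgroup_out_type add(3) that(2)])
    fix s and y :: "'g \<times> 'h"
    assume s: "(s, c2) \<in> R2" "slot_type s y"
    then have "s \<le> 1"
      by (auto simp: slot_type_def)
    then show "out_type R3 (c1 + c2) (snd ?P A y)"
      using out_type_mono[OF p2[OF that(1) s(2)]] R3 s(1) by blast
  qed
  have coder1: "out_type R3 c (coder q (snd ?Q) (fst ?P) w)" if "word_type c w" for c w
    by (rule coder_types[OF subgroup_out_type add(1) that q2])
       (use out_type_mono[OF p1] R3 in blast)+
  have coder2: "out_type R3 (c + t) (coder q (snd ?Q) (\<lambda>u. snd ?P u x) w)" if w: "word_type c w" "slot_type t x" for c w t x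
  proof (rule coder_types[OF subgroup_out_type _ w(1) q2])
    show "word_additive (\<lambda>u. snd ?P u x)"
      using add(2) by (simp add: word_additive_def biadd_def additive_def)
    fix c1 c2 s and u :: "(('g \<times> 'h) \<times> ('g \<times> 'h)) list"
    assume u: "word_type (c1 + s) u" "s \<le> 1" "(s, c2) \<in> R2" "c = c1 + c2"
    show "out_type R3 (c + t) (snd ?P u x)"
    proof (rule out_type_mono[OF p2[OF u(1) w(2)]])
      fix s'
      assume "(s', c1 + s + t) \<in> R1"
      then have "(s', (c1 + t) + s) \<in> R1"
        by (simp add: ac_simps)
      then show "(s', c + t) \<in> R3"
        using R3[of s' "c1 + t" s c2] u by (simp add: ac_simps)
    qed
  qed
  have hconv: "out_type R3 c (hconv q (snd ?P) (fst ?Q) w)" if wt: "word_type c w" for c w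
  proof (cases w)
    case Nil
    then show ?thesis by (simp add: out_type_def)
  next
    case (Cons X v)
    then obtain a b c' where X: "slot_type a (fst X)" "slot_type b (snd X)" "word_type c' v" "c = a + b + c'"
      using wt by auto
    show ?thesis
      unfolding Cons hconv.simps
    proof (rule unshuffle_word_type[OF subgroup_out_type X(3)])
      fix A B :: "(('g \<times> 'h) \<times> ('g \<times> 'h)) list" and c1 c2
      assume AB: "word_type c1 A" "word_type c2 B" "c' = c1 + c2"
      have "word_type (a + b + c2) (X # B)"
        using X AB by auto
      then have "out_type R3 (c1 + (a + b + c2)) (snd ?P A (fst ?Q (X # B)))"
        by (intro comp[OF AB(1)] q1)
      then have "out_type R3 c (snd ?P A (fst ?Q (X # B)))"
        using X(4) AB(3) by (simp add: ac_simps)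
      then show "out_type R3 c (if Suc (length B) = q then signed (int (length A)) (snd ?P A (fst ?Q (X # B))) else 0)"
        using subgroup_pred_signed[OF subgroup_out_type, of R3 c "snd ?P A (fst ?Q (X # B))" "int (length A)"]
        by (simp add: out_type_def[of _ _ 0])
    qed
  qed
  have lconv: "out_type R3 (c + t) (lconv q (snd ?P) (snd ?Q) w x)" if w: "word_type c w" "slot_type t x" for c w t x
    unfolding lconv_def unshuffle_apply
  proof (rule unshuffle_word_type[OF subgroup_out_type w(1)])
    fix A B :: "(('g \<times> 'h) \<times> ('g \<times> 'h)) list" and c1 c2
    assume AB: "word_type c1 A" "word_type c2 B" "c = c1 + c2"
    have "out_type R3 (c1 + (c2 + t)) (snd ?P A (snd ?Q B x))"
      by (intro comp[OF AB(1)] q2 AB w)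
    then show "out_type R3 (c + t) ((if length B = q then snd ?P A \<circ> snd ?Q B else 0) x)"
      by (simp add: AB(3) ac_simps) (simp add: out_type_def)
  qed
  have plus: "out_type R3 c (x + y)" if "out_type R3 c x" "out_type R3 c y" for c and x y :: "'g \<times> 'h"
    using that subgroup_out_type[of R3 c] unfolding subgroup_pred_def by blast
  show ?thesis
    unfolding cochain_types_def
    by (auto simp: pre_bracket_def wdiamond_def coder_apply word_type_rev intro!: plus coder1 coder2 hconv lconv
        simp del: rev_cochain_simps(2,3) simp: rev_cochain_simps(2,3)[of "(_, _)"])
qed

lemma cochain_types_diff_signed:
  fixes P Q :: "('g::ab_group_add \<times> 'h::ab_group_add, 'g \<times> 'h) cochain"
  assumes "cochain_types R P" "cochain_types R Q"
  shows "cochain_types R (P - signed n Q)"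
proof -
  have diff: "out_type R c (x - signed n y)" if "out_type R c x" "out_type R c y" for c and x y :: "'g \<times> 'h"
    using that subgroup_pred_signed[OF subgroup_out_type that(2), of n] by (auto simp: out_type_def)
  show ?thesis
    unfolding cochain_types_def
  proof (intro conjI allI impI)
    fix c t and w :: "(('g \<times> 'h) \<times> ('g \<times> 'h)) list" and x :: "'g \<times> 'h"
    assume w: "word_type c w"
    have "fst (P - signed n Q) w = fst P w - signed n (fst Q w)" "snd (P - signed n Q) w x = snd P w x - signed n (snd Q w x)"
      by (simp_all add: signed_def)
    then show "out_type R c (fst (P - signed n Q) w)" "slot_type t x \<Longrightarrow> out_type R (c + t) (snd (P - signed n Q) w x)"
      using assms w unfolding cochain_types_def by (simp_all only: diff)
  qed
qed

text \<open>The excluded pair is the type of a map from the second summand to the first, the part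
  that \<open>cochain_proj\<close> retains.\<close>

definition kernel_types :: "(nat \<times> nat) set" where
  "kernel_types = - {(1, 0)}"

definition weight_types :: "int \<Rightarrow> (nat \<times> nat) set" where
  "weight_types n = {(s, c). n \<le> int s - int c}"

section \<open>V-data on a direct sum and the vanishing of higher brackets\<close>

locale split_space = g: vector_space sg + h: vector_space sh
  for sg :: "'k::field_char_0 \<Rightarrow> 'g::ab_group_add \<Rightarrow> 'g" and sh :: "'k \<Rightarrow> 'h::ab_group_add \<Rightarrow> 'h"
begin

abbreviation sW :: "'k \<Rightarrow> 'g \<times> 'h \<Rightarrow> 'g \<times> 'h" where
  "sW \<equiv> module_prod.scale sg sh"

lemma sW_components: "fst (sW c x) = sg c (fst x)" "snd (sW c x) = sh c (snd x)"
proof -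
  interpret vector_space_prod sg sh ..
  show "fst (sW c x) = sg c (fst x)" "snd (sW c x) = sh c (snd x)"
    by (simp_all add: scale_def)
qed

sublocale W: vector_space_char_0 sW
  by unfold_locales (simp_all add: prod_eq_iff sW_components g.scale_right_distrib h.scale_right_distrib
      g.scale_left_distrib h.scale_left_distrib)

sublocale WW: vector_space_pair sW sW ..

sublocale hg: vector_space_pair sh sg ..

sublocale C: vector_space "cochain_scale sW :: 'k \<Rightarrow> ('g \<times> 'h, 'g \<times> 'h) cochain \<Rightarrow> ('g \<times> 'h, 'g \<times> 'h) cochain"
  by (rule W.vector_space_cochain_scale)

sublocale LY: graded_Lie_algebra "cochain_scale sW :: 'k \<Rightarrow> ('g \<times> 'h, 'g \<times> 'h) cochain \<Rightarrow> ('g \<times> 'h, 'g \<times> 'h) cochain"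
  "LY_graded sW sW" "LY_bracket sW"
  by (rule W.LY_graded_Lie_algebra)

lemma extend_cochains:
  assumes "P \<in> cochains sh sg n"
  shows "extend_cochain P \<in> cochains sW sW n"
proof -
  note P = assms[unfolded hg.cochains_iff]
  have "cochain_support n (extend_cochain P)"
    using P by (auto simp: cochain_support_def extend_cochain_def fun_eq_iff zero_prod_def)
  moreover have alt: "alt2 sW sW (\<lambda>X. (G (map_prod snd snd X), 0))" if "alt2 sh sg G" for G
    using that by (simp add: alt2_iff[OF W.vector_space_axioms W.vector_space_axioms]
        alt2_iff[OF h.vector_space_axioms g.vector_space_axioms] prod_eq_iff sW_components)
  have "word_alt sW sW (fst (extend_cochain P))" "word_alt sW sW (\<lambda>Xs. snd (extend_cochain P) Xs x)" for x
    using P unfolding word_alt_def extend_cochain_def by (auto simp: map_prod_def[symmetric] intro!: alt)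
  moreover have "Vector_Spaces.linear sW sW (snd (extend_cochain P) Xs)" for Xs
    using P by (auto simp: Vector_Spaces.linear_iff extend_cochain_def prod_eq_iff sW_components W.vector_space_axioms)
  ultimately show ?thesis
    unfolding WW.cochains_iff by blast
qed

lemma restrict_cochains:
  assumes "P \<in> cochains sW sW n"
  shows "restrict_cochain P \<in> cochains sh sg n"
proof -
  note P = assms[unfolded WW.cochains_iff]
  have sW0: "(0, sh c x) = sW c (0, x)" "(0 :: 'g, x + y) = (0, x) + (0, y)" for c x y
    by (simp_all add: prod_eq_iff sW_components)
  have "cochain_support n (restrict_cochain P)"
    using P by (auto simp: cochain_support_def restrict_cochain_def fun_eq_iff)
  moreover have alt: "alt2 sh sg (\<lambda>X. fst (G (map_prod (Pair 0) (Pair 0) X)))" if "alt2 sW sW G" for G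
    using that unfolding alt2_iff[OF W.vector_space_axioms W.vector_space_axioms]
        alt2_iff[OF h.vector_space_axioms g.vector_space_axioms] map_prod_simp sW0
    by (simp add: sW_components del: split_paired_All add_Pair)
  have "word_alt sh sg (fst (restrict_cochain P))" "word_alt sh sg (\<lambda>Xs. snd (restrict_cochain P) Xs x)" for x
    using P unfolding word_alt_def restrict_cochain_def by (auto intro!: alt)
  moreover have "Vector_Spaces.linear sh sg (snd (restrict_cochain P) Xs)" for Xs
    using P unfolding Vector_Spaces.linear_iff restrict_cochain_def snd_conv sW0
    by (simp add: h.vector_space_axioms g.vector_space_axioms sW_components del: split_paired_All add_Pair)
  ultimately show ?thesis
    unfolding hg.cochains_iff by blast
qed

lemma restrict_extend [simp]: "restrict_cochain (extend_cochain P) = (P :: ('h, 'g) cochain)"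
  by (simp add: restrict_cochain_def extend_cochain_def comp_def prod.map_comp map_prod_def case_prod_unfold)

lemma extend_combination:
  "extend_cochain (cochain_scale sg c P + P') = cochain_scale sW c (extend_cochain P) + extend_cochain P'"
  by (simp add: extend_cochain_def cochain_scale_def prod_eq_iff fun_eq_iff sW_components)

lemma restrict_combination:
  "restrict_cochain (cochain_scale sW c P + P') = cochain_scale sg c (restrict_cochain P) + restrict_cochain P'"
  by (simp add: restrict_cochain_def cochain_scale_def prod_eq_iff fun_eq_iff sW_components)

lemma extend_zero: "extend_cochain (0 :: ('h, 'g) cochain) = 0"
  by (simp add: extend_cochain_def prod_eq_iff fun_eq_iff)

lemma proj_combination:
  "cochain_proj (cochain_scale sW c P + P') = cochain_scale sW c (cochain_proj P) + cochain_proj P'"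
  by (simp add: cochain_proj_def restrict_combination extend_combination)

lemma proj_zero: "cochain_proj (0 :: ('g \<times> 'h, 'g \<times> 'h) cochain) = 0"
  by (simp add: cochain_proj_def restrict_cochain_def extend_cochain_def prod_eq_iff fun_eq_iff)

lemma restrict_zero: "restrict_cochain (0 :: ('g \<times> 'h, 'g \<times> 'h) cochain) = 0"
  by (simp add: restrict_cochain_def prod_eq_iff fun_eq_iff)

lemma extend_eq_zero_iff: "extend_cochain (P :: ('h, 'g) cochain) = 0 \<longleftrightarrow> P = 0"
proof
  assume "extend_cochain P = 0"
  then have "restrict_cochain (extend_cochain P) = 0"
    by (simp only: restrict_zero)
  then show "P = 0"
    by (simp only: restrict_extend)
qed (simp only: extend_zero)

lemma sub_graded_subset: "sub_graded sg sh n \<subseteq> LY_graded sW sW n"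
  using extend_cochains extend_zero by (auto simp: sub_graded_def LY_graded_def)

lemma sub_graded_cochains:
  assumes "x \<in> sub_graded sg sh n"
  obtains P k where "x = extend_cochain P" "P \<in> cochains sh sg k"
  using assms hg.zero_cochain_pair by (auto simp: sub_graded_def LY_graded_def split: if_splits)

text \<open>Outputs of \<open>Q\<close> lie in the first summand, and \<open>P\<close> vanishes as
  soon as one of its inputs does, so every substitution is zero.\<close>

lemma pre_bracket_sub_graded:
  assumes P: "P \<in> cochains sh sg m" and Q: "Q \<in> cochains sh sg n"
  shows "pre_bracket n (extend_cochain P) (extend_cochain Q) = 0"
proof -
  let ?P = "rev_cochain (extend_cochain P)" and ?Q = "rev_cochain (extend_cochain Q)"
  note Pe = W.cochains_word_facts[OF extend_cochains[OF P]]
  have out: "snd (fst ?Q w) = 0" "snd (snd ?Q w x) = 0" for w x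
    by (simp_all add: extend_cochain_def)
  have Pz: "snd ?P w x = 0" if "snd x = 0" for w x
  proof -
    have "snd ?P w x = snd ?P w 0"
      using that by (simp add: extend_cochain_def)
    then show ?thesis
      using additive.zero[OF Pe(9)] by simp
  qed
  \<comment> \<open>The hypothesis \<open>dep\<close> says that \<open>F\<close> reads only second
    components; with additivity it makes \<open>F\<close> vanish on every letter that has received a
    value of \<open>Q\<close>.\<close>
  have coder0: "coder n (snd ?Q) F w = 0"
    if alt: "word_alt sW sW F" and dep: "\<And>u v. map (map_prod snd snd) u = map (map_prod snd snd) v \<Longrightarrow> F u = F v"
    for F :: "_ \<Rightarrow> 'g \<times> 'h" and w
    using that
  proof (induction w arbitrary: F)
    case (Cons X w)
    have z: "F ((x, y) # A) = 0" if "snd x = 0 \<or> snd y = 0" for x y A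
    proof -
      have "F ((x, y) # A) = (if snd x = 0 then F ((0, y) # A) else F ((x, 0) # A))"
        using that by (auto intro!: Cons.prems(2))
      moreover have "F ((0, y) # A) = 0" "F ((x, 0) # A) = 0"
        using alt2_biadd[OF word_altD(1)[OF Cons.prems(1)], of A] additive.zero unfolding biadd_def by blast+
      ultimately show ?thesis by simp
    qed
    have "coder n (snd ?Q) (\<lambda>u. F (X # u)) w = 0"
      by (rule Cons.IH) (use word_altD(2)[OF Cons.prems(1)] Cons.prems(2) in auto)
    moreover have "lunsh (\<lambda>A B. if length B = n then wedge_act (snd ?Q B) (\<lambda>Y. F (Y # A)) X else 0) w = lunsh (\<lambda>A B. 0) w"
      by (rule unshuffle_cong) (simp add: wedge_act_def z out del: rev_cochain_simps)
    ultimately show ?case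
      by (simp del: rev_cochain_simps)
  qed simp
  have dep: "fst ?P u = fst ?P v" "snd ?P u x = snd ?P v x"
    if "map (map_prod snd snd) u = map (map_prod snd snd) v" for u v x
    using that by (simp_all add: extend_cochain_def flip: rev_map)
  have c: "coder n (snd ?Q) (fst ?P) w = 0" "coder n (snd ?Q) (\<lambda>w. snd ?P w x) w = 0" for w x
    by (rule coder0, rule Pe, rule dep, assumption)+
  have h: "hconv n (snd ?P) (fst ?Q) w = 0" for w
  proof (cases w)
    case (Cons X v)
    have "hconv n (snd ?P) (fst ?Q) w = lunsh (\<lambda>A B. 0) v"
      unfolding Cons hconv.simps by (rule unshuffle_cong) (simp add: Pz out del: rev_cochain_simps)
    then show ?thesis by simp
  qed simp
  have l: "lconv n (snd ?P) (snd ?Q) w x = 0" for w x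
  proof -
    have "lconv n (snd ?P) (snd ?Q) w x = lunsh (\<lambda>A B. 0) w"
      unfolding lconv_def unshuffle_apply by (rule unshuffle_cong) (simp add: Pz out del: rev_cochain_simps)
    then show ?thesis by simp
  qed
  have "wdiamond n ?P ?Q = 0"
    unfolding wdiamond_def by (simp add: prod_eq_iff fun_eq_iff coder_apply c h l del: rev_cochain_simps)
  then show ?thesis
    by (simp add: pre_bracket_def prod_eq_iff fun_eq_iff)
qed

lemma sub_graded_abelian:
  assumes "x \<in> sub_graded sg sh m" "y \<in> sub_graded sg sh n"
  shows "LY_bracket sW x y = 0"
proof -
  obtain P k Q j where "x = extend_cochain P" "P \<in> cochains sh sg k" "y = extend_cochain Q" "Q \<in> cochains sh sg j"
    using assms by (elim sub_graded_cochains)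
  then show ?thesis
    using W.LY_bracket_cochains[OF extend_cochains extend_cochains] pre_bracket_sub_graded by simp
qed

lemma word_type_zero_iff: "word_type 0 w \<longleftrightarrow> map (map_prod (Pair (0::'g)) (Pair (0::'g))) (map (map_prod snd (snd :: 'g \<times> 'h \<Rightarrow> 'h)) w) = w"
  by (induction w) (auto simp: slot_type_def prod_eq_iff)

lemma proj_zero_iff_types: "cochain_proj P = 0 \<longleftrightarrow> cochain_types kernel_types (P :: ('g \<times> 'h, 'g \<times> 'h) cochain)"
proof -
  have out: "out_type kernel_types c v \<longleftrightarrow> (c = 0 \<longrightarrow> fst v = 0)" for c and v :: "'g \<times> 'h"
    by (auto simp: out_type_def kernel_types_def)
  have "cochain_proj P = 0 \<longleftrightarrow> restrict_cochain P = 0"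
    by (simp add: cochain_proj_def extend_eq_zero_iff)
  also have "\<dots> \<longleftrightarrow> (\<forall>Ys. fst (fst P (map (map_prod (Pair 0) (Pair 0)) Ys)) = 0) \<and>
      (\<forall>Ys y. fst (snd P (map (map_prod (Pair 0) (Pair 0)) Ys) (0, y)) = 0)"
    by (simp add: restrict_cochain_def prod_eq_iff fun_eq_iff)
  also have "\<dots> \<longleftrightarrow> (\<forall>w. word_type 0 w \<longrightarrow> fst (fst P w) = 0) \<and>
      (\<forall>w x. word_type 0 w \<longrightarrow> slot_type 0 x \<longrightarrow> fst (snd P w x) = 0)"
  proof -
    have *: "(\<forall>w. word_type 0 w \<longrightarrow> S w) \<longleftrightarrow> (\<forall>Ys. S (map (map_prod (Pair (0::'g)) (Pair 0)) (Ys :: ('h \<times> 'h) list)))" for S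
    proof (intro iffI allI impI)
      fix Ys :: "('h \<times> 'h) list"
      assume "\<forall>w. word_type 0 w \<longrightarrow> S w"
      moreover have "word_type 0 (map (map_prod (Pair (0::'g)) (Pair 0)) Ys)"
        by (induction Ys) (auto simp: slot_type_def)
      ultimately show "S (map (map_prod (Pair 0) (Pair 0)) Ys)"
        by blast
    next
      fix w :: "(('g \<times> 'h) \<times> ('g \<times> 'h)) list"
      assume "\<forall>Ys :: ('h \<times> 'h) list. S (map (map_prod (Pair (0::'g)) (Pair 0)) Ys)" "word_type 0 w"
      then show "S w"
        unfolding word_type_zero_iff by metis
    qed
    have **: "(\<forall>x :: 'g \<times> 'h. slot_type 0 x \<longrightarrow> S x) \<longleftrightarrow> (\<forall>y. S (0, y))" for S
      by (auto simp: slot_type_def)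
    have "(\<forall>w x. word_type 0 w \<longrightarrow> slot_type 0 x \<longrightarrow> fst (snd P w x) = 0)
      \<longleftrightarrow> (\<forall>w. word_type 0 w \<longrightarrow> (\<forall>x. slot_type 0 x \<longrightarrow> fst (snd P w x) = 0))"
      by blast
    then show ?thesis
      by (simp only: * **)
  qed
  also have "\<dots> \<longleftrightarrow> cochain_types kernel_types P"
    unfolding cochain_types_def out by auto
  finally show ?thesis .
qed

lemma LY_bracket_types:
  assumes P: "P \<in> cochains sW sW p" "cochain_types R1 P" and Q: "Q \<in> cochains sW sW q" "cochain_types R2 Q"
    and R: "\<And>s s' c1 c2. (s, c1 + s') \<in> R1 \<Longrightarrow> (s', c2) \<in> R2 \<Longrightarrow> s' \<le> 1 \<Longrightarrow> (s, c1 + c2) \<in> R3"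
    and R': "\<And>s s' c1 c2. (s, c1 + s') \<in> R2 \<Longrightarrow> (s', c2) \<in> R1 \<Longrightarrow> s' \<le> 1 \<Longrightarrow> (s, c1 + c2) \<in> R3"
  shows "cochain_types R3 (LY_bracket sW P Q)"
  unfolding W.LY_bracket_cochains[OF P(1) Q(1)]
  by (intro cochain_types_diff_signed pre_bracket_types[OF P(2) W.cochain_wadditive[OF P(1)] Q(2) R]
      pre_bracket_types[OF Q(2) W.cochain_wadditive[OF Q(1)] P(2) R'])

text \<open>When all inputs are in the second summand, the inner cochain outputs only there. The
  outer cochain then also sees such inputs only, and its output has no first component.\<close>

lemma kernel_bracket:
  assumes "P \<in> cochains sW sW p" "cochain_proj P = 0" "Q \<in> cochains sW sW q" "cochain_proj Q = 0"
  shows "cochain_proj (LY_bracket sW P Q) = 0"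
proof -
  have K: "(s, c1 + c2) \<in> kernel_types" if "(s, c1 + s') \<in> kernel_types" "(s', c2) \<in> kernel_types" "s' \<le> 1" for s s' c1 c2
    using that by (cases s') (auto simp: kernel_types_def)
  show ?thesis
    using assms unfolding proj_zero_iff_types
    by (intro LY_bracket_types[OF _ _ _ _ K K])
qed

text \<open>Weights add: the inserted value counts once as an output and once as an input, and the
  two counts cancel.\<close>

lemma weight_bracket:
  assumes "P \<in> cochains sW sW p" "cochain_types (weight_types m) P" "Q \<in> cochains sW sW q" "cochain_types (weight_types n) Q"
  shows "cochain_types (weight_types (m + n)) (LY_bracket sW P Q)"
  by (rule LY_bracket_types[OF assms]) (auto simp: weight_types_def)

text \<open>An extended cochain can be nonzero only if all inputs are in the second summand, and its
  output is in the first.\<close>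

lemma extend_weight:
  assumes "P \<in> cochains sh sg n"
  shows "cochain_types (weight_types 1) (extend_cochain P)"
proof -
  note P = assms[unfolded hg.cochains_iff]
  have alt0: "G (x, y) = 0" if "alt2 sh sg G" "x = 0 \<or> y = 0" for G :: "'h \<times> 'h \<Rightarrow> 'g" and x y
    using alt2_biadd[OF that(1)] that(2) additive.zero unfolding biadd_def by fastforce
  have F0: "F (map (map_prod snd snd) w) = 0" if "word_type c w" "c > 0" "word_alt sh sg F" for c F and w :: "(('g \<times> 'h) \<times> 'g \<times> 'h) list"
    using that
  proof (induction w arbitrary: c F)
    case (Cons X w)
    then obtain a b c' where X: "slot_type a (fst X)" "slot_type b (snd X)" "word_type c' w" "c = a + b + c'"
      by auto
    show ?case
    proof (cases "c' = 0")
      case True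
      then have "snd (fst X) = 0 \<or> snd (snd X) = 0"
        using X Cons.prems(2) by (auto simp: slot_type_def)
      then show ?thesis
        using alt0[OF word_altD(1)[OF Cons.prems(3)]] by (cases X) simp
    next
      case False
      then show ?thesis
        using Cons.IH[OF X(3) _ word_altD(2)[OF Cons.prems(3)]] by simp
    qed
  qed simp
  have out: "out_type (weight_types 1) c (v, 0 :: 'h) \<longleftrightarrow> (c > 0 \<longrightarrow> v = 0)" for c and v :: 'g
    by (auto simp: out_type_def weight_types_def)
  show ?thesis
    unfolding cochain_types_def
  proof (intro conjI allI impI)
    fix c t and w :: "(('g \<times> 'h) \<times> 'g \<times> 'h) list" and x :: "'g \<times> 'h"
    assume w: "word_type c w"
    show "out_type (weight_types 1) c (fst (extend_cochain P) w)"
      using F0[OF w] P by (simp add: extend_cochain_def out)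
    assume t: "slot_type t x"
    have "snd P (map (map_prod snd snd) w) (snd x) = 0" if "c + t > 0"
    proof (cases "c > 0")
      case True
      then show ?thesis
        using F0[OF w, of "\<lambda>Xs. snd P Xs (snd x)"] P by simp
    next
      case False
      then have "snd x = 0"
        using that t by (auto simp: slot_type_def)
      moreover have "additive (snd P (map (map_prod snd snd) w))"
        using P by (simp add: Vector_Spaces.linear_iff additive_def)
      ultimately show ?thesis
        using additive.zero by simp
    qed
    then show "out_type (weight_types 1) (c + t) (snd (extend_cochain P) w x)"
      by (simp add: extend_cochain_def out)
  qed
qed

lemma V_data_bicrossed:
  assumes \<Phi>: "\<Phi> \<in> cochains sW sW 1" "cochain_proj \<Phi> = 0" "LY_bracket sW \<Phi> \<Phi> = 0"
  shows "V_data (cochain_scale sW) (LY_graded sW sW) (LY_bracket sW) (sub_graded sg sh) cochain_proj \<Phi>"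
proof unfold_locales
  note subspace_iff = C.subspace_iff_combination
  show "LY.graded_Lie_subalgebra (sub_graded sg sh)"
    unfolding LY.graded_Lie_subalgebra_def
  proof (intro conjI allI ballI)
    fix m n :: int
    show sub: "C.subspace (sub_graded sg sh k)" for k
    proof -
      have "0 \<in> sub_graded sg sh k"
        using hg.zero_LY_graded extend_zero unfolding sub_graded_def by (metis image_eqI)
      moreover have "cochain_scale sW c x + y \<in> sub_graded sg sh k" if "x \<in> sub_graded sg sh k" "y \<in> sub_graded sg sh k" for c x y
        using that hg.LY_graded_combination by (auto simp: sub_graded_def simp flip: extend_combination)
      ultimately show ?thesis
        unfolding subspace_iff by blast
    qed
    show "sub_graded sg sh n \<subseteq> LY_graded sW sW n"
      by (rule sub_graded_subset)
    fix x y
    assume "x \<in> sub_graded sg sh m" "y \<in> sub_graded sg sh n"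
    then show "LY_bracket sW x y \<in> sub_graded sg sh (m + n)"
      using sub_graded_abelian C.subspace_0[OF sub] by simp
  qed
  show "LY_bracket sW x y = 0" if "x \<in> sub_graded sg sh m" "y \<in> sub_graded sg sh n" for x y m n
    using that by (rule sub_graded_abelian)
  show "cochain_proj (x + y) = cochain_proj x + cochain_proj y" for x y :: "('g \<times> 'h, 'g \<times> 'h) cochain"
    using proj_combination[of 1 x y] by simp
  show "cochain_proj (cochain_scale sW c x) = cochain_scale sW c (cochain_proj x)" for c and x :: "('g \<times> 'h, 'g \<times> 'h) cochain"
    using proj_combination[of c x 0] by (simp add: proj_zero)
  show "cochain_proj x \<in> sub_graded sg sh n" if "x \<in> LY_graded sW sW n" for x n
    using that restrict_cochains[of x "nat n"]
    by (auto simp: LY_graded_def sub_graded_def cochain_proj_def restrict_zero split: if_splits)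
  show "cochain_proj x = x" if "x \<in> sub_graded sg sh n" for x n
    using that by (auto simp: sub_graded_def cochain_proj_def)
  show "LY.graded_Lie_subalgebra (\<lambda>n. {x \<in> LY_graded sW sW n. cochain_proj x = 0})"
    unfolding LY.graded_Lie_subalgebra_def
  proof (intro conjI allI ballI)
    fix m n
    show "C.subspace {x \<in> LY_graded sW sW n. cochain_proj x = 0}"
      unfolding subspace_iff by (auto simp: proj_zero WW.zero_LY_graded proj_combination WW.LY_graded_combination W.cochain_scale_zero)
    fix x y
    assume xy: "x \<in> {x \<in> LY_graded sW sW m. cochain_proj x = 0}" "y \<in> {x \<in> LY_graded sW sW n. cochain_proj x = 0}"
    have cochain: "\<exists>k. z \<in> cochains sW sW k" if "z \<in> LY_graded sW sW i" for z i
      using that W.zero_cochain by (auto simp: LY_graded_def split: if_splits)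
    then obtain i j where "x \<in> cochains sW sW i" "y \<in> cochains sW sW j"
      using xy by blast
    then show "LY_bracket sW x y \<in> {x \<in> LY_graded sW sW (m + n). cochain_proj x = 0}"
      using xy LY.br_degree kernel_bracket by blast
  qed auto
  show "\<Phi> \<in> LY_graded sW sW 1" "cochain_proj \<Phi> = 0" "LY_bracket sW \<Phi> \<Phi> = 0"
    using \<Phi> by (simp_all add: LY_graded_def)
qed

text \<open>
  The weight of a component is the number of its outputs minus the number of its inputs in the
  first summand.  Elements of \<^const>\<open>sub_graded\<close> have weight \<open>1\<close>, which is the largest
  possible weight.
\<close>

lemma iterated_bracket_vanishes:
  assumes \<Phi>: "\<Phi> \<in> cochains sW sW 1" "cochain_types (weight_types (- 2)) \<Phi>"
    and w: "\<forall>X\<in>set w. fst X \<in> sub_graded sg sh (snd X)" "4 \<le> length w"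
  shows "cochain_proj (iterated_bracket (LY_bracket sW) \<Phi> w) = 0"
proof -
  have "(\<exists>k. iterated_bracket (LY_bracket sW) \<Phi> w \<in> cochains sW sW k) \<and>
      cochain_types (weight_types (int (length w) - 2)) (iterated_bracket (LY_bracket sW) \<Phi> w)"
    using w(1)
  proof (induction w)
    case Nil
    then show ?case
      using \<Phi> by auto
  next
    case (Cons X w)
    obtain P j where P: "fst X = extend_cochain P" "P \<in> cochains sh sg j"
      using Cons.prems by (auto elim: sub_graded_cochains)
    obtain k where k: "iterated_bracket (LY_bracket sW) \<Phi> w \<in> cochains sW sW k"
        "cochain_types (weight_types (int (length w) - 2)) (iterated_bracket (LY_bracket sW) \<Phi> w)"
      using Cons.IH Cons.prems by auto
    have "LY_bracket sW (iterated_bracket (LY_bracket sW) \<Phi> w) (fst X) \<in> cochains sW sW (k + j)"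
      unfolding P(1) by (rule W.LY_bracket_closed[OF k(1) extend_cochains[OF P(2)]])
    moreover have "cochain_types (weight_types (int (length w) - 2 + 1)) (LY_bracket sW (iterated_bracket (LY_bracket sW) \<Phi> w) (fst X))"
      unfolding P(1) by (rule weight_bracket[OF k extend_cochains[OF P(2)] extend_weight[OF P(2)]])
    moreover have "int (length w) - 2 + 1 = int (length (X # w)) - 2"
      by simp
    ultimately show ?case
      unfolding iterated_bracket_simps by metis
  qed
  then have "cochain_types (weight_types (int (length w) - 2)) (iterated_bracket (LY_bracket sW) \<Phi> w)"
    by blast
  \<comment> \<open>After at least four brackets the weight is at least 2, whereas the type removed
    from \<open>kernel_types\<close> has weight 1.\<close>
  moreover have "out_type kernel_types c v" if "out_type (weight_types (int (length w) - 2)) c v" for c and v :: "'g \<times> 'h"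
    using that w(2) by (auto simp: out_type_def weight_types_def kernel_types_def)
  ultimately show ?thesis
    unfolding proj_zero_iff_types cochain_types_def by blast
qed

end

section \<open>Pairs of operations as cochains and the exponential of a square-zero map\<close>

lemma linear_map_additive: "Vector_Spaces.linear s1 s2 f \<Longrightarrow> additive f"
  by (simp add: Vector_Spaces.linear_iff additive_def)

lemmas linear_map_zero = additive.zero[OF linear_map_additive]

lemma bilinear_map_zero:
  assumes "bilinear_map s1 s2 s3 f"
  shows "f x 0 = 0" "f 0 y = 0"
  using assms linear_map_zero[of s2 s3 "f x"] linear_map_zero[of s1 s3 "\<lambda>x. f x y"]
  by (simp_all add: bilinear_map_def)

lemma trilinear_map_zero:
  assumes "trilinear_map s1 s2 s3 s4 f"
  shows "f x y 0 = 0" "f x 0 z = 0" "f 0 y z = 0"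
  using assms linear_map_zero[of s3 s4 "f x y"] linear_map_zero[of s2 s4 "\<lambda>y. f x y z"]
    linear_map_zero[of s1 s4 "\<lambda>x. f x y z"]
  by (simp_all add: trilinear_map_def)

lemma ops_cochain_simps [simp]:
  "fst (ops_cochain b t) [] = 0" "snd (ops_cochain b t) [] = 0"
  "fst (ops_cochain b t) [X] = b (fst X) (snd X)" "snd (ops_cochain b t) [X] z = t (fst X) (snd X) z"
  "fst (ops_cochain b t) (X # Y # Xs) = 0" "snd (ops_cochain b t) (X # Y # Xs) = 0"
  by (auto simp: ops_cochain_def fun_eq_iff split: prod.splits)

lemma ops_cochain_eqI:
  assumes "fst P [] = 0" "snd P [] = 0" "\<And>x y. fst P [(x, y)] = b x y" "\<And>x y z. snd P [(x, y)] z = t x y z"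
    "\<And>X Y Xs. fst P (X # Y # Xs) = 0" "\<And>X Y Xs. snd P (X # Y # Xs) = 0"
  shows "P = ops_cochain b t"
proof -
  have "fst P Xs = fst (ops_cochain b t) Xs \<and> snd P Xs = snd (ops_cochain b t) Xs" for Xs
    \<comment> \<open>This case rule separates lists of length 0, of length 1 and of length at least
      2.\<close>
    by (cases Xs rule: remdups_adj.cases) (use assms in \<open>auto simp: fun_eq_iff\<close>)
  then show ?thesis
    by (simp add: prod_eq_iff fun_eq_iff)
qed

context vector_space_char_0
begin

interpretation self: vector_space_pair scale scale ..

lemma ops_cochain_cochains:
  assumes "bilinear_map scale scale scale b" "\<And>x. b x x = 0"
    and "trilinear_map scale scale scale scale t" "\<And>x z. t x x z = 0"
  shows "ops_cochain b t \<in> cochains scale scale 1"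
proof -
  have len: "\<exists>X. Xs = [X]" if "length Xs = 1" for Xs :: "('b \<times> 'b) list"
    using that by (cases Xs) auto
  have len': "fst (ops_cochain b t) Xs = 0 \<and> snd (ops_cochain b t) Xs = 0" if "length Xs \<noteq> 1" for Xs
    using that by (cases Xs rule: remdups_adj.cases) auto
  have upd: "Xs[i := X] = [X]" if "length Xs = 1 \<and> i < 1" for Xs :: "('b \<times> 'b) list" and i X
    using that len[of Xs] by auto
  have "wedge_multilinear scale scale 1 (fst (ops_cochain b t))"
    unfolding wedge_multilinear_def
  proof (intro conjI allI impI)
    fix Xs :: "('b \<times> 'b) list" and i :: nat and x
    assume "length Xs = 1 \<and> i < 1"
    then show "bilinear_map scale scale scale (\<lambda>x y. fst (ops_cochain b t) (Xs[i := (x, y)]))"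
      "fst (ops_cochain b t) (Xs[i := (x, x)]) = 0"
      using assms by (simp_all add: upd)
  qed (use len' in blast)
  moreover have "wedge_multilinear scale scale 1 (\<lambda>Xs. snd (ops_cochain b t) Xs z)" for z
    unfolding wedge_multilinear_def
  proof (intro conjI allI impI)
    fix Xs :: "('b \<times> 'b) list" and i :: nat and x
    assume "length Xs = 1 \<and> i < 1"
    then show "bilinear_map scale scale scale (\<lambda>x y. snd (ops_cochain b t) (Xs[i := (x, y)]) z)"
      "snd (ops_cochain b t) (Xs[i := (x, x)]) z = 0"
      using assms by (simp_all add: upd trilinear_map_def bilinear_map_def)
  qed (use len' in auto)
  moreover have "Vector_Spaces.linear scale scale (snd (ops_cochain b t) Xs)" if Xs: "length Xs = 1" for Xs
  proof -
    obtain X where "Xs = [X]"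
      using len[OF Xs] by blast
    moreover have "snd (ops_cochain b t) [X] = t (fst X) (snd X)"
      by (simp add: fun_eq_iff)
    ultimately show ?thesis
      using assms(3) by (simp add: trilinear_map_def)
  qed
  ultimately show ?thesis
    by (simp add: cochains_def)
qed

text \<open>At a list of two letters the entries of the product of the cochain with itself are
  \<open>LY3\<close> and \<open>LY4\<close>, with all terms on one side; at other lengths they
  vanish by support.\<close>

lemma LY_bracket_square:
  assumes "Lie_Yamaguti_algebra scale b t"
  shows "LY_bracket scale (ops_cochain b t) (ops_cochain b t) = 0"
proof -
  interpret Y: Lie_Yamaguti_algebra scale b t
    by (rule assms)
  let ?C = "ops_cochain b t"
  have C: "?C \<in> cochains scale scale 1"
    by (rule ops_cochain_cochains) (fact Y.br_bilinear Y.br_alternating Y.tb_trilinear Y.tb_alternating)+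
  have two: "fst (pre_bracket 1 ?C ?C) [X, Y] = 0" "snd (pre_bracket 1 ?C ?C) [X, Y] z = 0" for X Y z
    using Y.LY3[of "fst X" "snd X" "fst Y" "snd Y"] Y.LY4[of "fst X" "snd X" "fst Y" "snd Y" z]
    by (simp_all add: pre_bracket_def wdiamond_def wedge_act_def lconv_def signed_def algebra_simps)
  have "fst (pre_bracket 1 ?C ?C) Xs = 0 \<and> snd (pre_bracket 1 ?C ?C) Xs = 0" for Xs
  proof (cases "length Xs = 2")
    case True
    then obtain X Y where "Xs = [X, Y]"
      by (auto simp: length_Suc_conv numeral_2_eq_2)
    then show ?thesis
      using two by (simp add: fun_eq_iff)
  next
    case False
    then show ?thesis
      using cochains_word_facts(4,5)[OF pre_bracket_cochains[OF C C], of Xs] by simp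
  qed
  then have "pre_bracket 1 ?C ?C = 0"
    by (simp add: prod_eq_iff fun_eq_iff)
  then show ?thesis
    by (simp add: LY_bracket_cochains[OF C C])
qed

definition derive2 :: "('b \<Rightarrow> 'b) \<Rightarrow> ('b \<Rightarrow> 'b \<Rightarrow> 'b) \<Rightarrow> 'b \<Rightarrow> 'b \<Rightarrow> 'b" where
  "derive2 f b x y = b (f x) y + b x (f y) - f (b x y)"

definition derive3 :: "('b \<Rightarrow> 'b) \<Rightarrow> ('b \<Rightarrow> 'b \<Rightarrow> 'b \<Rightarrow> 'b) \<Rightarrow> 'b \<Rightarrow> 'b \<Rightarrow> 'b \<Rightarrow> 'b" where
  "derive3 f t x y z = t (f x) y z + t x (f y) z + t x y (f z) - f (t x y z)"

lemma hom_cochain_cochains: "Vector_Spaces.linear scale scale f \<Longrightarrow> hom_cochain f \<in> cochains scale scale 0"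
  by (auto simp: cochains_def)

lemma LY_bracket_ops_hom:
  assumes C: "ops_cochain b t \<in> cochains scale scale 1" and f: "Vector_Spaces.linear scale scale f"
  shows "LY_bracket scale (ops_cochain b t) (hom_cochain f) = ops_cochain (derive2 f b) (derive3 f t)"
proof -
  note F = hom_cochain_cochains[OF f]
  have 1: "pre_bracket 0 (ops_cochain b t) (hom_cochain f)
    = ops_cochain (\<lambda>x y. b (f x) y + b x (f y)) (\<lambda>x y z. t (f x) y z + t x (f y) z + t x y (f z))"
    unfolding diamond_eq_pre_bracket[OF C F, symmetric]
    by (rule ops_cochain_eqI) (simp_all add: diamond_def hom_cochain_def Let_def fun_eq_iff)
  have 2: "pre_bracket 1 (hom_cochain f) (ops_cochain b t) = ops_cochain (\<lambda>x y. f (b x y)) (\<lambda>x y z. f (t x y z))"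
    unfolding diamond_eq_pre_bracket[OF F C, symmetric]
    by (rule ops_cochain_eqI) (simp_all add: diamond_def hom_cochain_def fun_eq_iff)
  have 3: "LY_bracket scale (ops_cochain b t) (hom_cochain f) =
    ops_cochain (\<lambda>x y. b (f x) y + b x (f y)) (\<lambda>x y z. t (f x) y z + t x (f y) z + t x y (f z))
    - ops_cochain (\<lambda>x y. f (b x y)) (\<lambda>x y z. f (t x y z))"
    unfolding LY_bracket_cochains[OF C F] 1 2 by simp
  show ?thesis
    unfolding 3 by (rule ops_cochain_eqI) (simp_all add: derive2_def derive3_def)
qed

text \<open>
  The exponential series of the derivation induced by a square-zero map \<open>f\<close>, cut off after the
  third power.
\<close>

lemma exp_derive2:
  assumes b: "bilinear_map scale scale scale b" and f: "Vector_Spaces.linear scale scale f" "\<And>x. f (f x) = 0"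
  shows "derive2 f b x y + scale (1 / 2) (derive2 f (derive2 f b) x y)
      + scale (1 / 6) (derive2 f (derive2 f (derive2 f b)) x y)
    = b (x + f x) (y + f y) - f (b (x + f x) (y + f y)) - b x y"
proof -
  have lin: "f (x + y) = f x + f y" "f (x - y) = f x - f y" "f (- x) = - f x" "f 0 = 0" for x y
    using additive.add additive.diff additive.minus additive.zero linear_map_additive[OF f(1)] by blast+
  have bl: "b (x + x') y = b x y + b x' y" "b x (y + y') = b x y + b x y'" for x x' y y'
    using b by (auto simp: bilinear_map_def Vector_Spaces.linear_iff)
  have sc: "scale (1 / 2) (u + u) = u" "scale (1 / 6) (u + u + u + u + u + u) = u" for u
    using scale_left_distrib[of "1 / 2" "1 / 2" u]
    by (simp_all add: scale_right_distrib flip: scale_left_distrib)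
  \<comment> \<open>These are the parts of order two and three in \<open>f\<close> of
    \<open>(1 - f) b ((1 + f) x) ((1 + f) y)\<close>. The second and third powers of the derivation
    contain them 2 and 6 times, matching the factorials.\<close>
  let ?u = "\<lambda>x y. b (f x) (f y) - f (b (f x) y) - f (b x (f y))" and ?v = "- f (b (f x) (f y))"
  have d2: "derive2 f (derive2 f b) x y = ?u x y + ?u x y" for x y
    by (simp add: derive2_def lin bl f(2) bilinear_map_zero[OF b])
  have d3: "derive2 f (derive2 f (derive2 f b)) x y = ?v + ?v + ?v + ?v + ?v + ?v"
    unfolding derive2_def[of f "derive2 f (derive2 f b)"] d2
    by (simp add: lin bl f(2) bilinear_map_zero[OF b])
  show ?thesis
    unfolding d2 d3 sc by (simp add: derive2_def bl lin f(2) algebra_simps)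
qed

text \<open>A ternary operation offers four places for \<open>f\<close>, three inputs and one
  output, so a part of order four remains on the right. It consists of the single term that
  \<open>t0\<close> sets to zero.\<close>

lemma exp_derive3:
  assumes t: "trilinear_map scale scale scale scale t" and f: "Vector_Spaces.linear scale scale f" "\<And>x. f (f x) = 0"
    and t0: "f (t (f x) (f y) (f z)) = 0"
  shows "derive3 f t x y z + scale (1 / 2) (derive3 f (derive3 f t) x y z)
      + scale (1 / 6) (derive3 f (derive3 f (derive3 f t)) x y z)
    = t (x + f x) (y + f y) (z + f z) - f (t (x + f x) (y + f y) (z + f z)) - t x y z"
proof -
  have lin: "f (x + y) = f x + f y" "f (x - y) = f x - f y" "f (- x) = - f x" "f 0 = 0" for x y
    using additive.add additive.diff additive.minus additive.zero linear_map_additive[OF f(1)] by blast+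
  have tl: "t (x + x') y z = t x y z + t x' y z" "t x (y + y') z = t x y z + t x y' z" "t x y (z + z') = t x y z + t x y z'"
    for x x' y y' z z'
    using t by (auto simp: trilinear_map_def Vector_Spaces.linear_iff)
  have sc: "scale (1 / 2) (u + u) = u" "scale (1 / 6) (u + u + u + u + u + u) = u" for u
    using scale_left_distrib[of "1 / 2" "1 / 2" u]
    by (simp_all add: scale_right_distrib flip: scale_left_distrib)
  let ?u = "\<lambda>x y z. t (f x) (f y) z + t (f x) y (f z) + t x (f y) (f z) - f (t (f x) y z) - f (t x (f y) z) - f (t x y (f z))"
    and ?v = "t (f x) (f y) (f z) - f (t (f x) (f y) z) - f (t (f x) y (f z)) - f (t x (f y) (f z))"
  have d2: "derive3 f (derive3 f t) x y z = ?u x y z + ?u x y z" for x y z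
    by (simp add: derive3_def lin tl f(2) trilinear_map_zero[OF t])
  have d3: "derive3 f (derive3 f (derive3 f t)) x y z = ?v + ?v + ?v + ?v + ?v + ?v"
    unfolding derive3_def[of f "derive3 f (derive3 f t)"] d2
    by (simp add: lin tl f(2) trilinear_map_zero[OF t])
  show ?thesis
    unfolding d2 d3 sc by (simp add: derive3_def tl lin f(2) t0 algebra_simps)
qed

end

lemma maurer_cartan_iff:
  fixes sc :: "'k::field_char_0 \<Rightarrow> 'v::ab_group_add \<Rightarrow> 'v"
  assumes sc: "vector_space sc" and "\<And>k. 4 \<le> k \<Longrightarrow> l k (replicate k c) = 0"
  shows "maurer_cartan sc L l c \<longleftrightarrow>
    c \<in> L 0 \<and> l 1 [c] + sc (1 / 2) (l 2 [c, c]) + sc (1 / 6) (l 3 [c, c, c]) = 0"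
proof -
  interpret vector_space sc
    by (rule sc)
  let ?K = "{k. k \<ge> 1 \<and> l k (replicate k c) \<noteq> 0}"
  have sub: "?K \<subseteq> {1, 2, 3}"
  proof
    fix k
    assume "k \<in> ?K"
    then have "1 \<le> k" "\<not> 4 \<le> k"
      using assms(2) by auto
    then show "k \<in> {1, 2, 3}"
      by auto
  qed
  then have fin: "finite ?K"
    by (rule finite_subset) simp
  have "(\<Sum>k\<in>?K. sc (1 / fact k) (l k (replicate k c))) = (\<Sum>k\<in>{1, 2, 3}. sc (1 / fact k) (l k (replicate k c)))"
    by (rule sum.mono_neutral_left[OF _ sub]) auto
  also have "\<dots> = l 1 [c] + sc (1 / 2) (l 2 [c, c]) + sc (1 / 6) (l 3 [c, c, c])"
    by (simp add: numeral_2_eq_2 numeral_3_eq_3 fact_numeral add.assoc)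
  finally show ?thesis
    using fin by (simp add: maurer_cartan_def)
qed

section \<open>Maurer-Cartan elements and graphs closed under the operations\<close>

context split_space
begin

lemma linear_first: 
  assumes "Vector_Spaces.linear sh sg r"
  shows "Vector_Spaces.linear sW sW (\<lambda>x. (r (snd x), 0))"
  using assms by (simp add: Vector_Spaces.linear_iff prod_eq_iff sW_components W.vector_space_axioms)

lemma extend_hom: "extend_cochain (hom_cochain r) = hom_cochain (\<lambda>x. (r (snd x), 0 :: 'h) :: 'g \<times> 'h)"
  by (simp add: extend_cochain_def hom_cochain_def prod_eq_iff fun_eq_iff)

lemma proj_ops_eq_zero_iff:
  "cochain_proj (ops_cochain b t) = 0 \<longleftrightarrow>
    (\<forall>\<alpha> \<beta>. fst (b (0, \<alpha>) (0, \<beta>)) = 0) \<and> (\<forall>\<alpha> \<beta> \<gamma>. fst (t (0, \<alpha>) (0, \<beta>) (0, \<gamma>)) = (0 :: 'g))"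
  for b :: "'g \<times> 'h \<Rightarrow> 'g \<times> 'h \<Rightarrow> 'g \<times> 'h" and t
proof -
  have "restrict_cochain (ops_cochain b t)
    = ops_cochain (\<lambda>\<alpha> \<beta>. fst (b (0, \<alpha>) (0, \<beta>))) (\<lambda>\<alpha> \<beta> \<gamma>. fst (t (0, \<alpha>) (0, \<beta>) (0, \<gamma>)))"
    by (rule ops_cochain_eqI) (simp_all add: restrict_cochain_def fun_eq_iff)
  moreover have "ops_cochain b' t' = 0 \<longleftrightarrow> (\<forall>\<alpha> \<beta>. b' \<alpha> \<beta> = 0) \<and> (\<forall>\<alpha> \<beta> \<gamma>. t' \<alpha> \<beta> \<gamma> = 0)"
    for b' :: "'h \<Rightarrow> 'h \<Rightarrow> 'g" and t'
  proof
    assume z: "ops_cochain b' t' = 0"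
    have "b' \<alpha> \<beta> = fst (ops_cochain b' t') [(\<alpha>, \<beta>)]" "t' \<alpha> \<beta> \<gamma> = snd (ops_cochain b' t') [(\<alpha>, \<beta>)] \<gamma>" for \<alpha> \<beta> \<gamma>
      by simp_all
    then show "(\<forall>\<alpha> \<beta>. b' \<alpha> \<beta> = 0) \<and> (\<forall>\<alpha> \<beta> \<gamma>. t' \<alpha> \<beta> \<gamma> = 0)"
      unfolding z by simp
  next
    assume "(\<forall>\<alpha> \<beta>. b' \<alpha> \<beta> = 0) \<and> (\<forall>\<alpha> \<beta> \<gamma>. t' \<alpha> \<beta> \<gamma> = 0)"
    then show "ops_cochain b' t' = 0"
      by (intro ops_cochain_eqI[symmetric]) simp_all
  qed
  ultimately show ?thesis
    by (simp add: cochain_proj_def extend_eq_zero_iff)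
qed

text \<open>At inputs from the second summand, \<open>1 + f\<close> maps onto the graph of
  \<open>r\<close>. The first component of \<open>1 - f\<close> is the difference between the first
  component of a vector and \<open>r\<close> of its second, so it vanishes precisely on the
  graph.\<close>

lemma maurer_cartan_ops_iff:
  fixes b :: "'g \<times> 'h \<Rightarrow> 'g \<times> 'h \<Rightarrow> 'g \<times> 'h" and t r
  defines "f \<equiv> \<lambda>x :: 'g \<times> 'h. (r (snd x), 0 :: 'h)" and "gr \<equiv> \<lambda>\<alpha>. (r \<alpha>, \<alpha>)"
  assumes LY: "Lie_Yamaguti_algebra sW b t" and r: "Vector_Spaces.linear sh sg r"
    and b0: "\<And>\<alpha> \<beta>. fst (b (0, \<alpha>) (0, \<beta>)) = 0" and t0: "\<And>\<alpha> \<beta> \<gamma>. fst (t (0, \<alpha>) (0, \<beta>) (0, \<gamma>)) = 0"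
    and tg: "\<And>x y z. snd (t (x, 0) (y, 0) (z, 0)) = 0"
  shows "maurer_cartan (cochain_scale sW) (sub_graded sg sh)
      (derived_bracket (LY_bracket sW) cochain_proj (ops_cochain b t)) (extend_cochain (hom_cochain r)) \<longleftrightarrow>
    (\<forall>\<alpha> \<beta>. fst (b (gr \<alpha>) (gr \<beta>)) = r (snd (b (gr \<alpha>) (gr \<beta>)))) \<and>
    (\<forall>\<alpha> \<beta> \<gamma>. fst (t (gr \<alpha>) (gr \<beta>) (gr \<gamma>)) = r (snd (t (gr \<alpha>) (gr \<beta>) (gr \<gamma>))))"
proof -
  interpret Y: Lie_Yamaguti_algebra sW b t
    by (rule LY)
  have r0: "r 0 = 0"
    by (rule linear_map_zero[OF r])
  have f: "Vector_Spaces.linear sW sW f" "f (f x) = 0" for x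
    using linear_first[OF r] by (simp_all add: f_def r0 zero_prod_def)
  note F = W.hom_cochain_cochains[OF f(1)]
  let ?F = "hom_cochain f" and ?D2 = "W.derive2 f" and ?D3 = "W.derive3 f"
  have C0: "ops_cochain b t \<in> cochains sW sW 1"
    by (rule W.ops_cochain_cochains) (fact Y.br_bilinear Y.br_alternating Y.tb_trilinear Y.tb_alternating)+
  have step: "LY_bracket sW (ops_cochain b' t') ?F = ops_cochain (?D2 b') (?D3 t')"
    "ops_cochain (?D2 b') (?D3 t') \<in> cochains sW sW 1"
    if "ops_cochain b' t' \<in> cochains sW sW 1" for b' t'
    using W.LY_bracket_ops_hom[OF that f(1)] W.LY_bracket_closed[OF that F] by simp_all
  note C1 = step(2)[OF C0] and C2 = step(2)[OF step(2)[OF C0]]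
  let ?l = "derived_bracket (LY_bracket sW) cochain_proj (ops_cochain b t)"
  let ?b = "\<lambda>x y. b (x + f x) (y + f y) - f (b (x + f x) (y + f y)) - b x y"
  let ?t = "\<lambda>x y z. t (x + f x) (y + f y) (z + f z) - f (t (x + f x) (y + f y) (z + f z)) - t x y z"
  have l: "?l 1 [?F] = cochain_proj (ops_cochain (?D2 b) (?D3 t))"
    "?l 2 [?F, ?F] = cochain_proj (ops_cochain (?D2 (?D2 b)) (?D3 (?D3 t)))"
    "?l 3 [?F, ?F, ?F] = cochain_proj (ops_cochain (?D2 (?D2 (?D2 b))) (?D3 (?D3 (?D3 t))))"
    by (simp_all add: derived_bracket_def step(1)[OF C0] step(1)[OF C1] step(1)[OF C2])
  have "?l 1 [?F] + cochain_scale sW (1 / 2) (?l 2 [?F, ?F]) + cochain_scale sW (1 / 6) (?l 3 [?F, ?F, ?F])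
    = cochain_proj (cochain_scale sW (1 / 6) (ops_cochain (?D2 (?D2 (?D2 b))) (?D3 (?D3 (?D3 t))))
      + (cochain_scale sW (1 / 2) (ops_cochain (?D2 (?D2 b)) (?D3 (?D3 t))) + ops_cochain (?D2 b) (?D3 t)))"
    unfolding l proj_combination by (simp add: add.assoc add.commute)
  also have "cochain_scale sW (1 / 6) (ops_cochain (?D2 (?D2 (?D2 b))) (?D3 (?D3 (?D3 t))))
      + (cochain_scale sW (1 / 2) (ops_cochain (?D2 (?D2 b)) (?D3 (?D3 t))) + ops_cochain (?D2 b) (?D3 t))
    = ops_cochain ?b ?t"
  proof (rule ops_cochain_eqI)
    fix x y z
    \<comment> \<open>Three inputs from the first summand give, by \<open>tg\<close>, no second
      component, which is the only one that \<open>f\<close> sees; this excludes the part of order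
      four.\<close>
    have ft: "f (t (f x) (f y) (f z)) = 0"
      by (simp add: f_def tg r0 zero_prod_def)
    show "fst (cochain_scale sW (1 / 6) (ops_cochain (?D2 (?D2 (?D2 b))) (?D3 (?D3 (?D3 t))))
      + (cochain_scale sW (1 / 2) (ops_cochain (?D2 (?D2 b)) (?D3 (?D3 t))) + ops_cochain (?D2 b) (?D3 t))) [(x, y)] = ?b x y"
      using W.exp_derive2[OF Y.br_bilinear f, of x y] by (simp add: add_ac)
    show "snd (cochain_scale sW (1 / 6) (ops_cochain (?D2 (?D2 (?D2 b))) (?D3 (?D3 (?D3 t))))
      + (cochain_scale sW (1 / 2) (ops_cochain (?D2 (?D2 b)) (?D3 (?D3 t))) + ops_cochain (?D2 b) (?D3 t))) [(x, y)] z = ?t x y z"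
      using W.exp_derive3[OF Y.tb_trilinear f ft] by (simp add: add_ac)
  qed (simp_all add: fun_eq_iff)
  finally have sum: "?l 1 [?F] + cochain_scale sW (1 / 2) (?l 2 [?F, ?F]) + cochain_scale sW (1 / 6) (?l 3 [?F, ?F, ?F])
    = cochain_proj (ops_cochain ?b ?t)" .
  have r_eq: "extend_cochain (hom_cochain r) = ?F"
    by (simp add: extend_hom f_def)
  have "extend_cochain (hom_cochain r) \<in> sub_graded sg sh 0"
    using r by (auto simp: sub_graded_def LY_graded_def cochains_def)
  then have mc: "maurer_cartan (cochain_scale sW) (sub_graded sg sh) ?l ?F \<longleftrightarrow> cochain_proj (ops_cochain ?b ?t) = 0"
    using maurer_cartan_iff[of "cochain_scale sW" ?l ?F "sub_graded sg sh", OF C.vector_space_axioms derived_bracket_ge_4]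
    unfolding sum r_eq by blast
  have gr: "(0, \<alpha>) + f (0, \<alpha>) = gr \<alpha>" for \<alpha>
    by (simp add: f_def gr_def)
  show ?thesis
    unfolding r_eq mc proj_ops_eq_zero_iff gr by (simp add: b0 t0) (simp add: f_def)
qed

end

theorem theorem5p6:
  fixes sg :: "'k::field_char_0 \<Rightarrow> 'g::ab_group_add \<Rightarrow> 'g"
    and brg :: "'g \<Rightarrow> 'g \<Rightarrow> 'g" and tbg :: "'g \<Rightarrow> 'g \<Rightarrow> 'g \<Rightarrow> 'g"
    and sh :: "'k \<Rightarrow> 'h::ab_group_add \<Rightarrow> 'h"
    and brh :: "'h \<Rightarrow> 'h \<Rightarrow> 'h" and tbh :: "'h \<Rightarrow> 'h \<Rightarrow> 'h \<Rightarrow> 'h"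
    and rho :: "'g \<Rightarrow> 'h \<Rightarrow> 'h" and mu :: "'g \<Rightarrow> 'g \<Rightarrow> 'h \<Rightarrow> 'h"
    and psi :: "'h \<Rightarrow> 'g \<Rightarrow> 'g" and nu :: "'h \<Rightarrow> 'h \<Rightarrow> 'g \<Rightarrow> 'g"
  defines "sW \<equiv> module_prod.scale sg sh"
    and "brW \<equiv> bicrossed_br brg brh rho psi"
    and "tbW \<equiv> bicrossed_tb brg tbg brh tbh rho mu psi nu"
  defines "sC \<equiv> cochain_scale sW"
    and "L \<equiv> LY_graded sW sW"
    and "A \<equiv> sub_graded sg sh"
    and "PiW \<equiv> ops_cochain brW tbW"
  defines "l \<equiv> derived_bracket (LY_bracket sW) cochain_proj PiW"
  assumes mp: "matched_pair sg brg tbg sh brh tbh rho mu psi nu"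
    and bicrossed: "Lie_Yamaguti_algebra sW brW tbW"
  shows "V_data sC L (LY_bracket sW) A cochain_proj PiW \<and>
    L_infinity_algebra sC A l \<and>
    (\<forall>r. Vector_Spaces.linear sh sg r \<longrightarrow>
       deformation_map sg brg tbg sh brh tbh rho mu psi nu r \<longleftrightarrow>
       maurer_cartan sC A l (extend_cochain (hom_cochain r)))"
proof -
  interpret mp: matched_pair sg brg tbg sh brh tbh rho mu psi nu
    by (rule mp)
  interpret S: split_space sg sh ..
  interpret Y: Lie_Yamaguti_algebra sW brW tbW
    by (rule bicrossed)
  note zero = bilinear_map_zero[OF mp.g.br_bilinear] bilinear_map_zero[OF mp.h.br_bilinear]
    bilinear_map_zero[OF mp.g.rho_linear] bilinear_map_zero[OF mp.h.rho_linear]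
    trilinear_map_zero[OF mp.g.tb_trilinear] trilinear_map_zero[OF mp.h.tb_trilinear]
    trilinear_map_zero[OF mp.g.mu_linear] trilinear_map_zero[OF mp.h.mu_linear]
  have b0: "fst (brW (0, \<alpha>) (0, \<beta>)) = 0" for \<alpha> \<beta>
    by (simp add: brW_def bicrossed_br_def zero)
  have t0: "fst (tbW (0, \<alpha>) (0, \<beta>) (0, \<gamma>)) = 0" for \<alpha> \<beta> \<gamma>
    by (simp add: tbW_def bicrossed_tb_def rep_D_def zero)
  have tg: "snd (tbW (x, 0) (y, 0) (z, 0)) = 0" for x y z
    by (simp add: tbW_def bicrossed_tb_def rep_D_def zero)
  have C: "PiW \<in> cochains sW sW 1"
    unfolding PiW_def sW_def
    by (rule S.W.ops_cochain_cochains)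
      (use Y.br_bilinear Y.br_alternating Y.tb_trilinear Y.tb_alternating in \<open>simp_all add: sW_def\<close>)
  have proj: "cochain_proj PiW = 0"
    unfolding PiW_def S.proj_ops_eq_zero_iff using b0 t0 by simp
  have square: "LY_bracket sW PiW PiW = 0"
    using S.W.LY_bracket_square bicrossed by (simp add: sW_def PiW_def)
  have V: "V_data sC L (LY_bracket sW) A cochain_proj PiW"
    using S.V_data_bicrossed C proj square by (simp add: sC_def L_def A_def sW_def)
  have weight: "cochain_types (weight_types (- 2)) PiW"
    unfolding PiW_def
  proof -
    show "cochain_types (weight_types (- 2)) (ops_cochain brW tbW)"
      unfolding cochain_types_def
    proof (intro conjI allI impI)
      fix c t and w :: "(('g \<times> 'h) \<times> ('g \<times> 'h)) list" and z :: "'g \<times> 'h"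
      assume w: "word_type c w"
      have le: "s \<le> 1" if "slot_type s x" for s and x :: "'g \<times> 'h"
        using that by (auto simp: slot_type_def)
      consider "w = []" | x y where "w = [(x, y)]" | X Y v where "w = X # Y # v"
        by (cases w rule: remdups_adj.cases) auto
      then have "out_type (weight_types (- 2)) c (fst (ops_cochain brW tbW) w) \<and>
          (slot_type t z \<longrightarrow> out_type (weight_types (- 2)) (c + t) (snd (ops_cochain brW tbW) w z))"
      proof cases
        case 2
        obtain i j where ij: "slot_type i x" "slot_type j y" "c = i + j"
          using w 2 by auto
        have "snd (tbW x y z) = 0" if t: "slot_type t z" "\<not> c + t \<le> 2"
        proof -
          have "i = 1" "j = 1" "t = 1"
            using le[OF ij(1)] le[OF ij(2)] le[OF t(1)] t(2) ij(3) by simp_all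
          then have "snd x = 0" "snd y = 0" "snd z = 0"
            using ij t by (auto simp: slot_type_def)
          then show ?thesis
            using tg[of "fst x" "fst y" "fst z"] by (metis prod.collapse)
        qed
        then show ?thesis
          using 2 ij(3) le[OF ij(1)] le[OF ij(2)] le[of t z] by (auto simp: out_type_def weight_types_def)
      qed (simp_all add: out_type_def)
      then show "out_type (weight_types (- 2)) c (fst (ops_cochain brW tbW) w)"
        "slot_type t z \<Longrightarrow> out_type (weight_types (- 2)) (c + t) (snd (ops_cochain brW tbW) w z)"
        by blast+
    qed
  qed
  have inf: "L_infinity_algebra sC A l"
    unfolding l_def
  proof (rule V_data.derived_L_infinity[OF V])
    fix w
    assume "V_data.A_word A w" "4 \<le> length w"
    then show "cochain_proj (iterated_bracket (LY_bracket sW) PiW w) = 0"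
      using S.iterated_bracket_vanishes[of PiW w] C weight V_data.A_word_def[OF V] by (simp add: sW_def A_def)
  qed
  have "deformation_map sg brg tbg sh brh tbh rho mu psi nu r \<longleftrightarrow> maurer_cartan sC A l (extend_cochain (hom_cochain r))"
    if r: "Vector_Spaces.linear sh sg r" for r
  proof -
    have "maurer_cartan sC A l (extend_cochain (hom_cochain r)) \<longleftrightarrow>
      (\<forall>\<alpha> \<beta>. fst (brW (r \<alpha>, \<alpha>) (r \<beta>, \<beta>)) = r (snd (brW (r \<alpha>, \<alpha>) (r \<beta>, \<beta>)))) \<and>
      (\<forall>\<alpha> \<beta> \<gamma>. fst (tbW (r \<alpha>, \<alpha>) (r \<beta>, \<beta>) (r \<gamma>, \<gamma>)) = r (snd (tbW (r \<alpha>, \<alpha>) (r \<beta>, \<beta>) (r \<gamma>, \<gamma>))))"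
      using S.maurer_cartan_ops_iff[OF bicrossed[unfolded sW_def] r b0 t0 tg]
      by (simp add: sC_def A_def l_def PiW_def sW_def)
    then show ?thesis
      using r by (simp add: deformation_map_def brW_def tbW_def bicrossed_br_def bicrossed_tb_def)
  qed
  then show ?thesis
    using V inf by blast
qed

end
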